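(* The category $\mathrm{Fund}(\mathfrak{sl}_3\text{-}\mathrm{Crys})$ is isomorphic, as a $\Bbbk$-linear monoidal category, to the $\Bbbk$-linear monoidal category generated by two objects $B_1,B_2$ and generating morphisms (besides identities) $$m_1:B_1\otimes B_1\to B_2,\quad s_1:B_2\to B_1\otimes B_1,\quad c_{12}:B_1\otimes B_2\to\mathbb 1,\quad u_{21}:\mathbb 1\to B_2\otimes B_1,$$ $$\beta_{12}:B_1\otimes B_2\to B_2\otimes B_1,\quad\beta_{21}:B_2\otimes B_1\to B_1\otimes B_2,$$ subject to the following relations for $(i,j)=(1,2)$ and $(2,1)$, together with all their vertical and horizontal reflections. In the relations $m_2:B_2\otimes B_2\to B_1$, $c_{21}:B_2\otimes B_1\to\mathbb 1$ and their vertical reflections $s_2:B_1\to B_2\otimes B_2$, $u_{12}$ (reflection of $c_{12}$) are additional morphisms defined by (SL3.0) and its reflections. (SL3.0) $m_j=(\mathrm{id}_{B_i}\otimes c_{ji})\circ(\beta_{ji}\otimes\mathrm{id}_{B_i})\circ(\mathrm{id}_{B_j}\otimes s_i):B_j\otimes B_j\to B_i$, and $c_{ji}=c_{ij}\circ\beta_{ji}$. (SL3.1) $\beta_{ji}\circ\beta_{ij}=\mathrm{id}$. (SL3.2) $c_{ij}\circ u_{ij}=1$. (SL3.3) $m_i\circ s_i=\mathrm{id}_{B_j}$. (SL3.4) $(\mathrm{id}_{B_i}\otimes c_{ij})\circ(s_i\otimes\mathrm{id}_{B_j})=0$ and $(\mathrm{id}_{B_i}\otimes c_{ji})\circ(u_{ij}\otimes\mathrm{id}_{B_i})=0$.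 (SL3.5) $(\mathrm{id}_{B_i}\otimes m_i)\circ(s_i\otimes\mathrm{id}_{B_i})=u_{ij}\circ c_{ji}$. (SL3.6) $c_{ij}\circ(\mathrm{id}_{B_i}\otimes m_i)=c_{ji}\circ(m_i\otimes\mathrm{id}_{B_i})$. (SL3.7) $(\mathrm{id}_{B_j}\otimes m_i)\circ(\beta_{ij}\otimes\mathrm{id}_{B_i})\circ(\mathrm{id}_{B_i}\otimes\beta_{ij})=m_i\otimes\mathrm{id}_{B_j}+s_j\otimes c_{ij}-s_j\circ m_j\circ(m_i\otimes\mathrm{id}_{B_j})$. (SL3.8) $(c_{ij}\otimes\mathrm{id}_{B_i})\circ(\mathrm{id}_{B_i}\otimes\beta_{ij})=m_j\circ(m_i\otimes\mathrm{id}_{B_j})$. (SL3.9) $(m_i\otimes\mathrm{id}_{B_j})\circ(\mathrm{id}_{B_i}\otimes\beta_{ji})=(\mathrm{id}_{B_j}\otimes m_i)\circ(\beta_{ij}\otimes\mathrm{id}_{B_i})-s_j\otimes c_{ji}+c_{ij}\otimes s_j$.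
   Context: $\Bbbk$ is a field. $\mathfrak{sl}_3$-Crys is the (strictified) $\Bbbk$-linear monoidal category whose objects are finite direct sums (disjoint unions) of the highest weight crystals $B(\lambda)$ ($\lambda$ dominant) of $\mathfrak{sl}_3$, with morphisms $\Bbbk$-linear combinations of strict crystal morphisms (maps $B\sqcup\{0\}\to C\sqcup\{0\}$ with $0\mapsto0$, preserving weights and commuting with the Kashiwara operators $e_i,f_i$), viewed as linear maps between $\Bbbk$-spans. The tensor product convention is $e_i(b\otimes c)=e_ib\otimes c$ if $\varphi_i(b)\ge\varepsilon_i(c)$, else $b\otimes e_ic$; $f_i(b\otimes c)=f_ib\otimes c$ if $\varphi_i(b)>\varepsilon_i(c)$, else $b\otimes f_ic$, where $\varepsilon_i(b)=\max\{m:e_i^mb\ne0\}$, $\varphi_i(b)=\max\{m:f_i^mb\ne0\}$. $\mathrm{Fund}(\mathfrak{sl}_3\text{-Crys})$ is the full monoidal subcategory whose objects are the tensor words in $B_1=B(\omega_1)$, $B_2=B(\omega_2)$, including the empty word $\mathbb 1$. Vertical reflection reverses composition and exchanges domain and codomain: $m_i\leftrightarrow s_i$, $c_{ij}\leftrightarrow u_{ij}$, $\beta_{ij}\leftrightarrow\beta_{ji}$, keeping the left-right order of tensor factors. Horizontal reflection reverses the order of tensor factors and keeps the order of composition: $m_i\mapsto m_i$, $s_i\mapsto s_i$, $c_{ij}\mapsto c_{ji}$, $u_{ij}\mapsto u_{ji}$, $\beta_{ij}\mapsto\beta_{ji}$. (For example, the vertical reflection of $c_{21}=c_{12}\circ\beta_{21}$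 is $u_{21}=\beta_{12}\circ u_{12}$.) Under the isomorphism, $m_i$ projects $B_i\otimes B_i$ onto its component isomorphic to $B_j$, $c_{ij}$ projects $B_i\otimes B_j$ onto its trivial component, and $\beta_{ij}$ is the unique crystal isomorphism. *)

theory Defs
  imports Main
begin

section \<open>Strict linear monoidal categories\<close>

text \<open>Morphisms carry their domain and codomain, so the operations on morphisms need no object
  arguments; \<open>cmp C g f\<close> is \<open>g\<close> after \<open>f\<close>.\<close>

record ('o, 'm, 'k) lmcat =
  obj :: "'o set"
  hom :: "'o \<Rightarrow> 'o \<Rightarrow> 'm set"
  ident :: "'o \<Rightarrow> 'm"
  cmp :: "'m \<Rightarrow> 'm \<Rightarrow> 'm"
  unit_obj :: "'o"
  tens_obj :: "'o \<Rightarrow> 'o \<Rightarrow> 'o"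
  tens_mor :: "'m \<Rightarrow> 'm \<Rightarrow> 'm"
  zero_mor :: "'o \<Rightarrow> 'o \<Rightarrow> 'm"
  add_mor :: "'m \<Rightarrow> 'm \<Rightarrow> 'm"
  scale_mor :: "'k \<Rightarrow> 'm \<Rightarrow> 'm"

locale linear_moncat =
  fixes C :: "('o, 'm, 'k::field) lmcat"
  assumes hom_disjoint:
      "\<lbrakk>a \<in> obj C; b \<in> obj C; a' \<in> obj C; b' \<in> obj C; f \<in> hom C a b; f \<in> hom C a' b'\<rbrakk>
        \<Longrightarrow> a = a' \<and> b = b'"
    and ident_hom: "a \<in> obj C \<Longrightarrow> ident C a \<in> hom C a a"
    and comp_hom:
      "\<lbrakk>a \<in> obj C; b \<in> obj C; c \<in> obj C; f \<in> hom C a b; g \<in> hom C b c\<rbrakk>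
        \<Longrightarrow> cmp C g f \<in> hom C a c"
    and comp_assoc:
      "\<lbrakk>a \<in> obj C; b \<in> obj C; c \<in> obj C; d \<in> obj C; f \<in> hom C a b; g \<in> hom C b c; h \<in> hom C c d\<rbrakk>
        \<Longrightarrow> cmp C h (cmp C g f) = cmp C (cmp C h g) f"
    and comp_ident_right:
      "\<lbrakk>a \<in> obj C; b \<in> obj C; f \<in> hom C a b\<rbrakk> \<Longrightarrow> cmp C f (ident C a) = f"
    and comp_ident_left:
      "\<lbrakk>a \<in> obj C; b \<in> obj C; f \<in> hom C a b\<rbrakk> \<Longrightarrow> cmp C (ident C b) f = f"
    and unit_obj: "unit_obj C \<in> obj C"
    and tens_obj: "\<lbrakk>a \<in> obj C; b \<in> obj C\<rbrakk> \<Longrightarrow> tens_obj C a b \<in> obj C"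
    and tens_obj_assoc:
      "\<lbrakk>a \<in> obj C; b \<in> obj C; c \<in> obj C\<rbrakk>
        \<Longrightarrow> tens_obj C (tens_obj C a b) c = tens_obj C a (tens_obj C b c)"
    and tens_obj_unit_left: "a \<in> obj C \<Longrightarrow> tens_obj C (unit_obj C) a = a"
    and tens_obj_unit_right: "a \<in> obj C \<Longrightarrow> tens_obj C a (unit_obj C) = a"
    and tens_hom:
      "\<lbrakk>a \<in> obj C; b \<in> obj C; a' \<in> obj C; b' \<in> obj C; f \<in> hom C a b; f' \<in> hom C a' b'\<rbrakk>
        \<Longrightarrow> tens_mor C f f' \<in> hom C (tens_obj C a a') (tens_obj C b b')"
    and tens_assoc:
      "\<lbrakk>a \<in> obj C; b \<in> obj C; a' \<in> obj C; b' \<in> obj C; a'' \<in> obj C; b'' \<in> obj C;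
        f \<in> hom C a b; f' \<in> hom C a' b'; f'' \<in> hom C a'' b''\<rbrakk>
        \<Longrightarrow> tens_mor C (tens_mor C f f') f'' = tens_mor C f (tens_mor C f' f'')"
    and tens_unit_left:
      "\<lbrakk>a \<in> obj C; b \<in> obj C; f \<in> hom C a b\<rbrakk> \<Longrightarrow> tens_mor C (ident C (unit_obj C)) f = f"
    and tens_unit_right:
      "\<lbrakk>a \<in> obj C; b \<in> obj C; f \<in> hom C a b\<rbrakk> \<Longrightarrow> tens_mor C f (ident C (unit_obj C)) = f"
    and tens_ident:
      "\<lbrakk>a \<in> obj C; b \<in> obj C\<rbrakk>
        \<Longrightarrow> tens_mor C (ident C a) (ident C b) = ident C (tens_obj C a b)"
    and interchange:
      "\<lbrakk>a \<in> obj C; b \<in> obj C; c \<in> obj C; a' \<in> obj C; b' \<in> obj C; c' \<in> obj C;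
        f \<in> hom C a b; g \<in> hom C b c; f' \<in> hom C a' b'; g' \<in> hom C b' c'\<rbrakk>
        \<Longrightarrow> tens_mor C (cmp C g f) (cmp C g' f') = cmp C (tens_mor C g g') (tens_mor C f f')"
    and zero_hom: "\<lbrakk>a \<in> obj C; b \<in> obj C\<rbrakk> \<Longrightarrow> zero_mor C a b \<in> hom C a b"
    and add_hom:
      "\<lbrakk>a \<in> obj C; b \<in> obj C; f \<in> hom C a b; g \<in> hom C a b\<rbrakk> \<Longrightarrow> add_mor C f g \<in> hom C a b"
    and scale_hom:
      "\<lbrakk>a \<in> obj C; b \<in> obj C; f \<in> hom C a b\<rbrakk> \<Longrightarrow> scale_mor C x f \<in> hom C a b"
    and add_assoc:
      "\<lbrakk>a \<in> obj C; b \<in> obj C; f \<in> hom C a b; g \<in> hom C a b; h \<in> hom C a b\<rbrakk>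
        \<Longrightarrow> add_mor C (add_mor C f g) h = add_mor C f (add_mor C g h)"
    and add_commute:
      "\<lbrakk>a \<in> obj C; b \<in> obj C; f \<in> hom C a b; g \<in> hom C a b\<rbrakk>
        \<Longrightarrow> add_mor C f g = add_mor C g f"
    and add_zero:
      "\<lbrakk>a \<in> obj C; b \<in> obj C; f \<in> hom C a b\<rbrakk> \<Longrightarrow> add_mor C f (zero_mor C a b) = f"
    and add_neg:
      "\<lbrakk>a \<in> obj C; b \<in> obj C; f \<in> hom C a b\<rbrakk>
        \<Longrightarrow> add_mor C f (scale_mor C (-1) f) = zero_mor C a b"
    and scale_one: "\<lbrakk>a \<in> obj C; b \<in> obj C; f \<in> hom C a b\<rbrakk> \<Longrightarrow> scale_mor C 1 f = f"
    and scale_scale: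
      "\<lbrakk>a \<in> obj C; b \<in> obj C; f \<in> hom C a b\<rbrakk>
        \<Longrightarrow> scale_mor C x (scale_mor C y f) = scale_mor C (x * y) f"
    and scale_add_right:
      "\<lbrakk>a \<in> obj C; b \<in> obj C; f \<in> hom C a b; g \<in> hom C a b\<rbrakk>
        \<Longrightarrow> scale_mor C x (add_mor C f g) = add_mor C (scale_mor C x f) (scale_mor C x g)"
    and scale_add_left:
      "\<lbrakk>a \<in> obj C; b \<in> obj C; f \<in> hom C a b\<rbrakk>
        \<Longrightarrow> scale_mor C (x + y) f = add_mor C (scale_mor C x f) (scale_mor C y f)"
    and comp_add_left:
      "\<lbrakk>a \<in> obj C; b \<in> obj C; c \<in> obj C; f \<in> hom C a b; g \<in> hom C b c; g' \<in> hom C b c\<rbrakk>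
        \<Longrightarrow> cmp C (add_mor C g g') f = add_mor C (cmp C g f) (cmp C g' f)"
    and comp_add_right:
      "\<lbrakk>a \<in> obj C; b \<in> obj C; c \<in> obj C; f \<in> hom C a b; f' \<in> hom C a b; g \<in> hom C b c\<rbrakk>
        \<Longrightarrow> cmp C g (add_mor C f f') = add_mor C (cmp C g f) (cmp C g f')"
    and comp_scale_left:
      "\<lbrakk>a \<in> obj C; b \<in> obj C; c \<in> obj C; f \<in> hom C a b; g \<in> hom C b c\<rbrakk>
        \<Longrightarrow> cmp C (scale_mor C x g) f = scale_mor C x (cmp C g f)"
    and comp_scale_right:
      "\<lbrakk>a \<in> obj C; b \<in> obj C; c \<in> obj C; f \<in> hom C a b; g \<in> hom C b c\<rbrakk>
        \<Longrightarrow> cmp C g (scale_mor C x f) = scale_mor C x (cmp C g f)"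
    and tens_add_left:
      "\<lbrakk>a \<in> obj C; b \<in> obj C; a' \<in> obj C; b' \<in> obj C;
        f \<in> hom C a b; g \<in> hom C a b; f' \<in> hom C a' b'\<rbrakk>
        \<Longrightarrow> tens_mor C (add_mor C f g) f' = add_mor C (tens_mor C f f') (tens_mor C g f')"
    and tens_add_right:
      "\<lbrakk>a \<in> obj C; b \<in> obj C; a' \<in> obj C; b' \<in> obj C;
        f \<in> hom C a b; f' \<in> hom C a' b'; g' \<in> hom C a' b'\<rbrakk>
        \<Longrightarrow> tens_mor C f (add_mor C f' g') = add_mor C (tens_mor C f f') (tens_mor C f g')"
    and tens_scale_left:
      "\<lbrakk>a \<in> obj C; b \<in> obj C; a' \<in> obj C; b' \<in> obj C; f \<in> hom C a b; f' \<in> hom C a' b'\<rbrakk>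
        \<Longrightarrow> tens_mor C (scale_mor C x f) f' = scale_mor C x (tens_mor C f f')"
    and tens_scale_right:
      "\<lbrakk>a \<in> obj C; b \<in> obj C; a' \<in> obj C; b' \<in> obj C; f \<in> hom C a b; f' \<in> hom C a' b'\<rbrakk>
        \<Longrightarrow> tens_mor C f (scale_mor C x f') = scale_mor C x (tens_mor C f f')"

definition linear_moncat_iso ::
  "('o, 'm, 'k::field) lmcat \<Rightarrow> ('p, 'n, 'k) lmcat \<Rightarrow> ('o \<Rightarrow> 'p) \<Rightarrow> ('m \<Rightarrow> 'n) \<Rightarrow> bool" where
  "linear_moncat_iso C D Fo Fm \<longleftrightarrow>
     linear_moncat C \<and> linear_moncat D \<and>
     bij_betw Fo (obj C) (obj D) \<and>
     (\<forall>a\<in>obj C. \<forall>b\<in>obj C. bij_betw Fm (hom C a b) (hom D (Fo a) (Fo b))) \<and>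
     (\<forall>a\<in>obj C. Fm (ident C a) = ident D (Fo a)) \<and>
     (\<forall>a\<in>obj C. \<forall>b\<in>obj C. \<forall>c\<in>obj C. \<forall>f\<in>hom C a b. \<forall>g\<in>hom C b c.
        Fm (cmp C g f) = cmp D (Fm g) (Fm f)) \<and>
     Fo (unit_obj C) = unit_obj D \<and>
     (\<forall>a\<in>obj C. \<forall>b\<in>obj C. Fo (tens_obj C a b) = tens_obj D (Fo a) (Fo b)) \<and>
     (\<forall>a\<in>obj C. \<forall>b\<in>obj C. \<forall>a'\<in>obj C. \<forall>b'\<in>obj C. \<forall>f\<in>hom C a b. \<forall>f'\<in>hom C a' b'.
        Fm (tens_mor C f f') = tens_mor D (Fm f) (Fm f')) \<and>
     (\<forall>a\<in>obj C. \<forall>b\<in>obj C. \<forall>f\<in>hom C a b. \<forall>g\<in>hom C a b.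
        Fm (add_mor C f g) = add_mor D (Fm f) (Fm g)) \<and>
     (\<forall>a\<in>obj C. \<forall>b\<in>obj C. \<forall>f\<in>hom C a b. \<forall>x.
        Fm (scale_mor C x f) = scale_mor D x (Fm f))"


section \<open>Presentations by generators and relations\<close>

text \<open>Formal expressions in generating morphisms \<open>'g\<close>; the objects are the words over the
  generating objects \<open>'o\<close>.\<close>

datatype ('o, 'g, 'k) tm =
    Gen 'g
  | Ident "'o list"
  | Zero "'o list" "'o list"
  | Comp "('o, 'g, 'k) tm" "('o, 'g, 'k) tm" (infixr "\<odot>" 70)
  | Tens "('o, 'g, 'k) tm" "('o, 'g, 'k) tm" (infixr "\<otimes>" 75)
  | Add "('o, 'g, 'k) tm" "('o, 'g, 'k) tm" (infixl "\<oplus>" 65)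
  | Scale 'k "('o, 'g, 'k) tm"

context
  fixes gdom gcod :: "'g \<Rightarrow> 'o list"
begin

fun tm_dom :: "('o, 'g, 'k) tm \<Rightarrow> 'o list" where
  "tm_dom (Gen x) = gdom x"
| "tm_dom (Ident a) = a"
| "tm_dom (Zero a b) = a"
| "tm_dom (Comp g f) = tm_dom f"
| "tm_dom (Tens f g) = tm_dom f @ tm_dom g"
| "tm_dom (Add f g) = tm_dom f"
| "tm_dom (Scale x f) = tm_dom f"

fun tm_cod :: "('o, 'g, 'k) tm \<Rightarrow> 'o list" where
  "tm_cod (Gen x) = gcod x"
| "tm_cod (Ident a) = a"
| "tm_cod (Zero a b) = b"
| "tm_cod (Comp g f) = tm_cod g"
| "tm_cod (Tens f g) = tm_cod f @ tm_cod g"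
| "tm_cod (Add f g) = tm_cod f"
| "tm_cod (Scale x f) = tm_cod f"

fun tm_wf :: "('o, 'g, 'k) tm \<Rightarrow> bool" where
  "tm_wf (Gen x) = True"
| "tm_wf (Ident a) = True"
| "tm_wf (Zero a b) = True"
| "tm_wf (Comp g f) = (tm_wf g \<and> tm_wf f \<and> tm_cod f = tm_dom g)"
| "tm_wf (Tens f g) = (tm_wf f \<and> tm_wf g)"
| "tm_wf (Add f g) = (tm_wf f \<and> tm_wf g \<and> tm_dom f = tm_dom g \<and> tm_cod f = tm_cod g)"
| "tm_wf (Scale x f) = tm_wf f"

definition tm_typed :: "('o, 'g, 'k) tm \<Rightarrow> 'o list \<Rightarrow> 'o list \<Rightarrow> bool" where
  "tm_typed t a b \<longleftrightarrow> tm_wf t \<and> tm_dom t = a \<and> tm_cod t = b"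

end

text \<open>The congruence on well-typed expressions generated by the axioms of a strict linear monoidal
  category and the pairs in \<open>R\<close>.\<close>

inductive tm_eq ::
  "('g \<Rightarrow> 'o list) \<Rightarrow> ('g \<Rightarrow> 'o list) \<Rightarrow> (('o, 'g, 'k::field) tm \<times> ('o, 'g, 'k) tm) set \<Rightarrow>
   'o list \<Rightarrow> 'o list \<Rightarrow> ('o, 'g, 'k) tm \<Rightarrow> ('o, 'g, 'k) tm \<Rightarrow> bool"
  for gdom gcod R where
  rel: "\<lbrakk>(t, s) \<in> R; tm_typed gdom gcod t a b; tm_typed gdom gcod s a b\<rbrakk>
    \<Longrightarrow> tm_eq gdom gcod R a b t s"
| refl: "tm_typed gdom gcod t a b \<Longrightarrow> tm_eq gdom gcod R a b t t"
| sym: "tm_eq gdom gcod R a b t s \<Longrightarrow> tm_eq gdom gcod R a b s t"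
| trans: "\<lbrakk>tm_eq gdom gcod R a b t s; tm_eq gdom gcod R a b s r\<rbrakk> \<Longrightarrow> tm_eq gdom gcod R a b t r"
| cong_comp: "\<lbrakk>tm_eq gdom gcod R b c g g'; tm_eq gdom gcod R a b f f'\<rbrakk>
    \<Longrightarrow> tm_eq gdom gcod R a c (g \<odot> f) (g' \<odot> f')"
| cong_tens: "\<lbrakk>tm_eq gdom gcod R a b f f'; tm_eq gdom gcod R c d g g'\<rbrakk>
    \<Longrightarrow> tm_eq gdom gcod R (a @ c) (b @ d) (f \<otimes> g) (f' \<otimes> g')"
| cong_add: "\<lbrakk>tm_eq gdom gcod R a b f f'; tm_eq gdom gcod R a b g g'\<rbrakk>
    \<Longrightarrow> tm_eq gdom gcod R a b (f \<oplus> g) (f' \<oplus> g')"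
| cong_scale: "tm_eq gdom gcod R a b f f' \<Longrightarrow> tm_eq gdom gcod R a b (Scale x f) (Scale x f')"
| comp_assoc: "tm_typed gdom gcod (h \<odot> (g \<odot> f)) a b
    \<Longrightarrow> tm_eq gdom gcod R a b (h \<odot> (g \<odot> f)) ((h \<odot> g) \<odot> f)"
| comp_ident_right: "tm_typed gdom gcod f a b \<Longrightarrow> tm_eq gdom gcod R a b (f \<odot> Ident a) f"
| comp_ident_left: "tm_typed gdom gcod f a b \<Longrightarrow> tm_eq gdom gcod R a b (Ident b \<odot> f) f"
| tens_assoc: "tm_typed gdom gcod ((f \<otimes> g) \<otimes> h) a b
    \<Longrightarrow> tm_eq gdom gcod R a b ((f \<otimes> g) \<otimes> h) (f \<otimes> (g \<otimes> h))"
| tens_unit_left: "tm_typed gdom gcod f a b \<Longrightarrow> tm_eq gdom gcod R a b (Ident [] \<otimes> f) f"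
| tens_unit_right: "tm_typed gdom gcod f a b \<Longrightarrow> tm_eq gdom gcod R a b (f \<otimes> Ident []) f"
| tens_ident: "tm_eq gdom gcod R (a @ b) (a @ b) (Ident a \<otimes> Ident b) (Ident (a @ b))"
| interchange: "tm_typed gdom gcod ((g \<odot> f) \<otimes> (g' \<odot> f')) a b
    \<Longrightarrow> tm_eq gdom gcod R a b ((g \<odot> f) \<otimes> (g' \<odot> f')) ((g \<otimes> g') \<odot> (f \<otimes> f'))"
| add_assoc: "tm_typed gdom gcod ((f \<oplus> g) \<oplus> h) a b
    \<Longrightarrow> tm_eq gdom gcod R a b ((f \<oplus> g) \<oplus> h) (f \<oplus> (g \<oplus> h))"
| add_commute: "tm_typed gdom gcod (f \<oplus> g) a b \<Longrightarrow> tm_eq gdom gcod R a b (f \<oplus> g) (g \<oplus> f)"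
| add_zero: "tm_typed gdom gcod f a b \<Longrightarrow> tm_eq gdom gcod R a b (f \<oplus> Zero a b) f"
| add_neg: "tm_typed gdom gcod f a b \<Longrightarrow> tm_eq gdom gcod R a b (f \<oplus> Scale (-1) f) (Zero a b)"
| scale_one: "tm_typed gdom gcod f a b \<Longrightarrow> tm_eq gdom gcod R a b (Scale 1 f) f"
| scale_scale: "tm_typed gdom gcod f a b
    \<Longrightarrow> tm_eq gdom gcod R a b (Scale x (Scale y f)) (Scale (x * y) f)"
| scale_add_right: "tm_typed gdom gcod (f \<oplus> g) a b
    \<Longrightarrow> tm_eq gdom gcod R a b (Scale x (f \<oplus> g)) (Scale x f \<oplus> Scale x g)"
| scale_add_left: "tm_typed gdom gcod f a b
    \<Longrightarrow> tm_eq gdom gcod R a b (Scale (x + y) f) (Scale x f \<oplus> Scale y f)"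
| comp_add_left: "tm_typed gdom gcod ((g \<oplus> g') \<odot> f) a b
    \<Longrightarrow> tm_eq gdom gcod R a b ((g \<oplus> g') \<odot> f) ((g \<odot> f) \<oplus> (g' \<odot> f))"
| comp_add_right: "tm_typed gdom gcod (g \<odot> (f \<oplus> f')) a b
    \<Longrightarrow> tm_eq gdom gcod R a b (g \<odot> (f \<oplus> f')) ((g \<odot> f) \<oplus> (g \<odot> f'))"
| comp_scale_left: "tm_typed gdom gcod (g \<odot> f) a b
    \<Longrightarrow> tm_eq gdom gcod R a b (Scale x g \<odot> f) (Scale x (g \<odot> f))"
| comp_scale_right: "tm_typed gdom gcod (g \<odot> f) a b
    \<Longrightarrow> tm_eq gdom gcod R a b (g \<odot> Scale x f) (Scale x (g \<odot> f))"
| tens_add_left: "tm_typed gdom gcod ((f \<oplus> g) \<otimes> f') a b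
    \<Longrightarrow> tm_eq gdom gcod R a b ((f \<oplus> g) \<otimes> f') ((f \<otimes> f') \<oplus> (g \<otimes> f'))"
| tens_add_right: "tm_typed gdom gcod (f \<otimes> (f' \<oplus> g')) a b
    \<Longrightarrow> tm_eq gdom gcod R a b (f \<otimes> (f' \<oplus> g')) ((f \<otimes> f') \<oplus> (f \<otimes> g'))"
| tens_scale_left: "tm_typed gdom gcod (f \<otimes> f') a b
    \<Longrightarrow> tm_eq gdom gcod R a b (Scale x f \<otimes> f') (Scale x (f \<otimes> f'))"
| tens_scale_right: "tm_typed gdom gcod (f \<otimes> f') a b
    \<Longrightarrow> tm_eq gdom gcod R a b (f \<otimes> Scale x f') (Scale x (f \<otimes> f'))"

definition tm_class ::
  "('g \<Rightarrow> 'o list) \<Rightarrow> ('g \<Rightarrow> 'o list) \<Rightarrow> (('o, 'g, 'k::field) tm \<times> ('o, 'g, 'k) tm) set \<Rightarrow>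
   ('o, 'g, 'k) tm \<Rightarrow> ('o, 'g, 'k) tm set" where
  "tm_class gdom gcod R t = {s. \<exists>a b. tm_eq gdom gcod R a b t s}"

definition presented ::
  "('g \<Rightarrow> 'o list) \<Rightarrow> ('g \<Rightarrow> 'o list) \<Rightarrow> (('o, 'g, 'k::field) tm \<times> ('o, 'g, 'k) tm) set \<Rightarrow>
   ('o list, ('o, 'g, 'k) tm set, 'k) lmcat" where
  "presented gdom gcod R = (let cls = tm_class gdom gcod R in
    \<lparr> obj = UNIV,
      hom = (\<lambda>a b. {cls t | t. tm_typed gdom gcod t a b}),
      ident = (\<lambda>a. cls (Ident a)),
      cmp = (\<lambda>X Y. \<Union>g\<in>X. \<Union>f\<in>Y. cls (g \<odot> f)),
      unit_obj = [],
      tens_obj = (@),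
      tens_mor = (\<lambda>X Y. \<Union>f\<in>X. \<Union>g\<in>Y. cls (f \<otimes> g)),
      zero_mor = (\<lambda>a b. cls (Zero a b)),
      add_mor = (\<lambda>X Y. \<Union>f\<in>X. \<Union>g\<in>Y. cls (f \<oplus> g)),
      scale_mor = (\<lambda>x X. \<Union>f\<in>X. cls (Scale x f)) \<rparr>)"


section \<open>Crystals of type A2\<close>

datatype ix = I1 | I2

text \<open>\<open>op_ix\<close> exchanges 1 and 2.\<close>

fun op_ix :: "ix \<Rightarrow> ix" where
  "op_ix I1 = I2"
| "op_ix I2 = I1"

text \<open>Weights are given by their coordinates in the basis of fundamental weights. The element 0
  adjoined to a crystal is rendered as \<open>None\<close>.\<close>

record 'b crystal =
  elts :: "'b set"
  wt :: "'b \<Rightarrow> ix \<Rightarrow> int"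
  ke :: "ix \<Rightarrow> 'b \<Rightarrow> 'b option"
  kf :: "ix \<Rightarrow> 'b \<Rightarrow> 'b option"

text \<open>Only used for finite crystals, where the maxima below exist.\<close>

definition eps :: "'b crystal \<Rightarrow> ix \<Rightarrow> 'b \<Rightarrow> nat" where
  "eps B i b = Max {m. ((\<lambda>x. Option.bind x (ke B i)) ^^ m) (Some b) \<noteq> None}"

definition phi :: "'b crystal \<Rightarrow> ix \<Rightarrow> 'b \<Rightarrow> nat" where
  "phi B i b = Max {m. ((\<lambda>x. Option.bind x (kf B i)) ^^ m) (Some b) \<noteq> None}"

definition crystal_tensor :: "'b crystal \<Rightarrow> 'c crystal \<Rightarrow> ('b \<times> 'c) crystal" where
  "crystal_tensor B C =
    \<lparr> elts = elts B \<times> elts C,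
      wt = (\<lambda>(b, c) k. wt B b k + wt C c k),
      ke = (\<lambda>i (b, c). if phi B i b \<ge> eps C i c
              then map_option (\<lambda>b'. (b', c)) (ke B i b)
              else map_option (\<lambda>c'. (b, c')) (ke C i c)),
      kf = (\<lambda>i (b, c). if phi B i b > eps C i c
              then map_option (\<lambda>b'. (b', c)) (kf B i b)
              else map_option (\<lambda>c'. (b, c')) (kf C i c)) \<rparr>"

text \<open>A map \<open>B \<squnion> {0} \<rightarrow> C \<squnion> {0}\<close> sending 0 to 0 is determined by its restriction to \<open>B\<close>;
  its value on 0 enters through \<open>Option.bind\<close>.\<close>

definition strict_morphism :: "'b crystal \<Rightarrow> 'c crystal \<Rightarrow> ('b \<Rightarrow> 'c option) \<Rightarrow> bool" where
  "strict_morphism B C \<psi> \<longleftrightarrow>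
    (\<forall>b\<in>elts B. \<forall>c. \<psi> b = Some c \<longrightarrow> c \<in> elts C \<and> wt C c = wt B b) \<and>
    (\<forall>b\<in>elts B. \<forall>i. Option.bind (ke B i b) \<psi> = Option.bind (\<psi> b) (ke C i)) \<and>
    (\<forall>b\<in>elts B. \<forall>i. Option.bind (kf B i b) \<psi> = Option.bind (\<psi> b) (kf C i))"

text \<open>Linear maps between the spans of \<open>B\<close> and \<open>C\<close> are represented by their matrices: \<open>M c b\<close> is
  the coefficient of \<open>c\<close> in the image of \<open>b\<close>, and it is 0 outside \<open>elts C \<times> elts B\<close>.\<close>

definition crystal_matrix :: "'b crystal \<Rightarrow> ('b \<Rightarrow> 'c option) \<Rightarrow> 'c \<Rightarrow> 'b \<Rightarrow> 'k::field" where
  "crystal_matrix B \<psi> = (\<lambda>c b. if b \<in> elts B \<and> \<psi> b = Some c then 1 else 0)"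

definition crystal_hom :: "'b crystal \<Rightarrow> 'c crystal \<Rightarrow> ('c \<Rightarrow> 'b \<Rightarrow> 'k::field) set" where
  "crystal_hom B C =
    {M. \<exists>S x. finite S \<and> (\<forall>\<psi>\<in>S. strict_morphism B C \<psi>) \<and>
              M = (\<lambda>c b. \<Sum>\<psi>\<in>S. x \<psi> * crystal_matrix B \<psi> c b)}"

text \<open>The projection of \<open>B\<close> onto a component isomorphic to \<open>C\<close>: everything outside the component
  goes to 0.\<close>

definition crystal_projection :: "'b crystal \<Rightarrow> 'c crystal \<Rightarrow> ('b \<Rightarrow> 'c option) \<Rightarrow> bool" where
  "crystal_projection B C \<psi> \<longleftrightarrow>
    strict_morphism B C \<psi> \<and> bij_betw (\<lambda>b. the (\<psi> b)) {b \<in> elts B. \<psi> b \<noteq> None} (elts C)"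

definition crystal_iso :: "'b crystal \<Rightarrow> 'c crystal \<Rightarrow> ('b \<Rightarrow> 'c option) \<Rightarrow> bool" where
  "crystal_iso B C \<psi> \<longleftrightarrow> crystal_projection B C \<psi> \<and> (\<forall>b\<in>elts B. \<psi> b \<noteq> None)"

text \<open>The crystal \<open>B(\<omega>\<^sub>i)\<close> is \<open>Top \<rightarrow> Mid \<rightarrow> Bot\<close>, the arrows being \<open>f\<^sub>i\<close> and \<open>f\<^sub>j\<close> with \<open>j \<noteq> i\<close>;
  the weights are \<open>\<omega>\<^sub>i\<close>, \<open>\<omega>\<^sub>j - \<omega>\<^sub>i\<close> and \<open>- \<omega>\<^sub>j\<close>.\<close>

datatype node = Top | Mid | Bot

definition fund_crystal :: "ix \<Rightarrow> node crystal" where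
  "fund_crystal i =
    \<lparr> elts = UNIV,
      wt = (\<lambda>b k. case b of
              Top \<Rightarrow> (if k = i then 1 else 0)
            | Mid \<Rightarrow> (if k = i then - 1 else 1)
            | Bot \<Rightarrow> (if k = i then 0 else - 1)),
      ke = (\<lambda>k b. case b of
              Top \<Rightarrow> None
            | Mid \<Rightarrow> (if k = i then Some Top else None)
            | Bot \<Rightarrow> (if k = op_ix i then Some Mid else None)),
      kf = (\<lambda>k b. case b of
              Top \<Rightarrow> (if k = i then Some Mid else None)
            | Mid \<Rightarrow> (if k = op_ix i then Some Bot else None)
            | Bot \<Rightarrow> None) \<rparr>"

definition unit_crystal :: "node list crystal" where
  "unit_crystal = \<lparr> elts = {[]}, wt = (\<lambda>_ _. 0), ke = (\<lambda>_ _. None), kf = (\<lambda>_ _. None) \<rparr>"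

text \<open>The crystal of a tensor word. Writing \<open>b\<^sub>1 \<otimes> \<cdots> \<otimes> b\<^sub>n\<close> as a list identifies all
  bracketings; concatenation of lists is then the strictified tensor product.\<close>

definition cons_crystal :: "'b crystal \<Rightarrow> 'b list crystal \<Rightarrow> 'b list crystal" where
  "cons_crystal A B = (let T = crystal_tensor A B; join = (\<lambda>(b, bs). b # bs) in
    \<lparr> elts = join ` elts T,
      wt = (\<lambda>bs. wt T (hd bs, tl bs)),
      ke = (\<lambda>i bs. map_option join (ke T i (hd bs, tl bs))),
      kf = (\<lambda>i bs. map_option join (kf T i (hd bs, tl bs))) \<rparr>)"

fun word_crystal :: "ix list \<Rightarrow> node list crystal" where
  "word_crystal [] = unit_crystal"
| "word_crystal (i # w) = cons_crystal (fund_crystal i) (word_crystal w)"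


section \<open>The category Fund\<close>

type_synonym 'k fund_mor = "ix list \<times> ix list \<times> (node list \<Rightarrow> node list \<Rightarrow> 'k)"

text \<open>A morphism is a triple of domain, codomain and matrix. The tensor product of morphisms is the
  tensor product of linear maps, i.e. the Kronecker product of matrices.\<close>

definition fund_comp :: "'k::field fund_mor \<Rightarrow> 'k fund_mor \<Rightarrow> 'k fund_mor" where
  "fund_comp = (\<lambda>(v', w', N) (v, w, M).
     (v, w', \<lambda>d b. \<Sum>c\<in>elts (word_crystal w). N d c * M c b))"

definition fund_tens :: "'k::field fund_mor \<Rightarrow> 'k fund_mor \<Rightarrow> 'k fund_mor" where
  "fund_tens = (\<lambda>(v, w, M) (v', w', M').
     (v @ v', w @ w', \<lambda>c b. M (take (length w) c) (take (length v) b) *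
                            M' (drop (length w) c) (drop (length v) b)))"

definition Fund :: "(ix list, 'k::field fund_mor, 'k) lmcat" where
  "Fund =
    \<lparr> obj = UNIV,
      hom = (\<lambda>v w. {(v, w, M) | M. M \<in> crystal_hom (word_crystal v) (word_crystal w)}),
      ident = (\<lambda>w. (w, w, crystal_matrix (word_crystal w) Some)),
      cmp = fund_comp,
      unit_obj = [],
      tens_obj = (@),
      tens_mor = fund_tens,
      zero_mor = (\<lambda>v w. (v, w, \<lambda>c b. 0)),
      add_mor = (\<lambda>(v, w, M) (v', w', N). (v, w, \<lambda>c b. M c b + N c b)),
      scale_mor = (\<lambda>x (v, w, M). (v, w, \<lambda>c b. x * M c b)) \<rparr>"

definition fund_arrow :: "ix list \<Rightarrow> ix list \<Rightarrow> (node list \<Rightarrow> node list option) \<Rightarrow> 'k::field fund_mor"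
  where "fund_arrow v w \<psi> = (v, w, crystal_matrix (word_crystal v) \<psi>)"

definition projections :: "ix list \<Rightarrow> ix list \<Rightarrow> 'k::field fund_mor set" where
  "projections v w =
    {fund_arrow v w \<psi> | \<psi>. crystal_projection (word_crystal v) (word_crystal w) \<psi>}"

definition isomorphisms :: "ix list \<Rightarrow> ix list \<Rightarrow> 'k::field fund_mor set" where
  "isomorphisms v w =
    {fund_arrow v w \<psi> | \<psi>. crystal_iso (word_crystal v) (word_crystal w) \<psi>}"


section \<open>The presentation\<close>

text \<open>The relations are written in the ten symbols \<open>m\<^sub>i\<close>, \<open>s\<^sub>i\<close>, \<open>c\<^sub>i\<^sub>j\<close>, \<open>u\<^sub>i\<^sub>j\<close>, \<open>\<beta>\<^sub>i\<^sub>j\<close> (with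
  \<open>j = op_ix i\<close> omitted), on which the reflections act by permutation; six of them are generators and
  the other four abbreviate expressions in the generators.\<close>

datatype sym = Sym_m ix | Sym_s ix | Sym_c ix | Sym_u ix | Sym_b ix

fun sym_dom :: "sym \<Rightarrow> ix list" where
  "sym_dom (Sym_m i) = [i, i]"
| "sym_dom (Sym_s i) = [op_ix i]"
| "sym_dom (Sym_c i) = [i, op_ix i]"
| "sym_dom (Sym_u i) = []"
| "sym_dom (Sym_b i) = [i, op_ix i]"

fun sym_cod :: "sym \<Rightarrow> ix list" where
  "sym_cod (Sym_m i) = [op_ix i]"
| "sym_cod (Sym_s i) = [i, i]"
| "sym_cod (Sym_c i) = []"
| "sym_cod (Sym_u i) = [i, op_ix i]"
| "sym_cod (Sym_b i) = [op_ix i, i]"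

datatype gen = g_m1 | g_s1 | g_c12 | g_u21 | g_beta12 | g_beta21

fun gen_sym :: "gen \<Rightarrow> sym" where
  "gen_sym g_m1 = Sym_m I1"
| "gen_sym g_s1 = Sym_s I1"
| "gen_sym g_c12 = Sym_c I1"
| "gen_sym g_u21 = Sym_u I2"
| "gen_sym g_beta12 = Sym_b I1"
| "gen_sym g_beta21 = Sym_b I2"

abbreviation gen_dom :: "gen \<Rightarrow> ix list" where "gen_dom x \<equiv> sym_dom (gen_sym x)"
abbreviation gen_cod :: "gen \<Rightarrow> ix list" where "gen_cod x \<equiv> sym_cod (gen_sym x)"

fun sym_tm :: "sym \<Rightarrow> (ix, gen, 'k) tm" where
  "sym_tm (Sym_m I1) = Gen g_m1"
| "sym_tm (Sym_s I1) = Gen g_s1"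
| "sym_tm (Sym_c I1) = Gen g_c12"
| "sym_tm (Sym_u I2) = Gen g_u21"
| "sym_tm (Sym_b I1) = Gen g_beta12"
| "sym_tm (Sym_b I2) = Gen g_beta21"
| "sym_tm (Sym_c I2) = Gen g_c12 \<odot> Gen g_beta21"
| "sym_tm (Sym_u I1) = Gen g_beta21 \<odot> Gen g_u21"
| "sym_tm (Sym_m I2) =
     (Ident [I1] \<otimes> (Gen g_c12 \<odot> Gen g_beta21)) \<odot> (Gen g_beta21 \<otimes> Ident [I1]) \<odot>
     (Ident [I2] \<otimes> Gen g_s1)"
| "sym_tm (Sym_s I2) =
     (Ident [I2] \<otimes> Gen g_m1) \<odot> (Gen g_beta12 \<otimes> Ident [I1]) \<odot> (Ident [I1] \<otimes> Gen g_u21)"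

fun expand :: "(ix, sym, 'k) tm \<Rightarrow> (ix, gen, 'k) tm" where
  "expand (Gen x) = sym_tm x"
| "expand (Ident a) = Ident a"
| "expand (Zero a b) = Zero a b"
| "expand (Comp g f) = Comp (expand g) (expand f)"
| "expand (Tens f g) = Tens (expand f) (expand g)"
| "expand (Add f g) = Add (expand f) (expand g)"
| "expand (Scale x f) = Scale x (expand f)"

fun vsym :: "sym \<Rightarrow> sym" where
  "vsym (Sym_m i) = Sym_s i"
| "vsym (Sym_s i) = Sym_m i"
| "vsym (Sym_c i) = Sym_u i"
| "vsym (Sym_u i) = Sym_c i"
| "vsym (Sym_b i) = Sym_b (op_ix i)"

fun hsym :: "sym \<Rightarrow> sym" where
  "hsym (Sym_m i) = Sym_m i"
| "hsym (Sym_s i) = Sym_s i"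
| "hsym (Sym_c i) = Sym_c (op_ix i)"
| "hsym (Sym_u i) = Sym_u (op_ix i)"
| "hsym (Sym_b i) = Sym_b (op_ix i)"

fun vrefl :: "(ix, sym, 'k) tm \<Rightarrow> (ix, sym, 'k) tm" where
  "vrefl (Gen x) = Gen (vsym x)"
| "vrefl (Ident a) = Ident a"
| "vrefl (Zero a b) = Zero b a"
| "vrefl (Comp g f) = Comp (vrefl f) (vrefl g)"
| "vrefl (Tens f g) = Tens (vrefl f) (vrefl g)"
| "vrefl (Add f g) = Add (vrefl f) (vrefl g)"
| "vrefl (Scale x f) = Scale x (vrefl f)"

fun hrefl :: "(ix, sym, 'k) tm \<Rightarrow> (ix, sym, 'k) tm" where
  "hrefl (Gen x) = Gen (hsym x)"
| "hrefl (Ident a) = Ident (rev a)"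
| "hrefl (Zero a b) = Zero (rev a) (rev b)"
| "hrefl (Comp g f) = Comp (hrefl g) (hrefl f)"
| "hrefl (Tens f g) = Tens (hrefl g) (hrefl f)"
| "hrefl (Add f g) = Add (hrefl f) (hrefl g)"
| "hrefl (Scale x f) = Scale x (hrefl f)"

abbreviation mg :: "ix \<Rightarrow> (ix, sym, 'k) tm" where "mg i \<equiv> Gen (Sym_m i)"
abbreviation sg :: "ix \<Rightarrow> (ix, sym, 'k) tm" where "sg i \<equiv> Gen (Sym_s i)"
abbreviation cg :: "ix \<Rightarrow> (ix, sym, 'k) tm" where "cg i \<equiv> Gen (Sym_c i)"
abbreviation ug :: "ix \<Rightarrow> (ix, sym, 'k) tm" where "ug i \<equiv> Gen (Sym_u i)"
abbreviation bg :: "ix \<Rightarrow> (ix, sym, 'k) tm" where "bg i \<equiv> Gen (Sym_b i)"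
abbreviation idg :: "ix \<Rightarrow> (ix, sym, 'k) tm" where "idg i \<equiv> Ident [i]"

inductive sl3_rel :: "(ix, sym, 'k::field) tm \<Rightarrow> (ix, sym, 'k) tm \<Rightarrow> bool" where
  SL3_0a: "j = op_ix i \<Longrightarrow>
    sl3_rel (mg j) ((idg i \<otimes> cg j) \<odot> (bg j \<otimes> idg i) \<odot> (idg j \<otimes> sg i))"
| SL3_0b: "j = op_ix i \<Longrightarrow> sl3_rel (cg j) (cg i \<odot> bg j)"
| SL3_1: "j = op_ix i \<Longrightarrow> sl3_rel (bg j \<odot> bg i) (Ident [i, j])"
| SL3_2: "sl3_rel (cg i \<odot> ug i) (Ident [])"
| SL3_3: "j = op_ix i \<Longrightarrow> sl3_rel (mg i \<odot> sg i) (idg j)"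
| SL3_4a: "j = op_ix i \<Longrightarrow> sl3_rel ((idg i \<otimes> cg i) \<odot> (sg i \<otimes> idg j)) (Zero [j, j] [i])"
| SL3_4b: "j = op_ix i \<Longrightarrow> sl3_rel ((idg i \<otimes> cg j) \<odot> (ug i \<otimes> idg i)) (Zero [i] [i])"
| SL3_5: "j = op_ix i \<Longrightarrow> sl3_rel ((idg i \<otimes> mg i) \<odot> (sg i \<otimes> idg i)) (ug i \<odot> cg j)"
| SL3_6: "j = op_ix i \<Longrightarrow> sl3_rel (cg i \<odot> (idg i \<otimes> mg i)) (cg j \<odot> (mg i \<otimes> idg i))"
| SL3_7: "j = op_ix i \<Longrightarrow>
    sl3_rel ((idg j \<otimes> mg i) \<odot> (bg i \<otimes> idg i) \<odot> (idg i \<otimes> bg i))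
            ((mg i \<otimes> idg j) \<oplus> (sg j \<otimes> cg i) \<oplus> Scale (-1) (sg j \<odot> mg j \<odot> (mg i \<otimes> idg j)))"
| SL3_8: "j = op_ix i \<Longrightarrow>
    sl3_rel ((cg i \<otimes> idg i) \<odot> (idg i \<otimes> bg i)) (mg j \<odot> (mg i \<otimes> idg j))"
| SL3_9: "j = op_ix i \<Longrightarrow>
    sl3_rel ((mg i \<otimes> idg j) \<odot> (idg i \<otimes> bg j))
            (((idg j \<otimes> mg i) \<odot> (bg i \<otimes> idg i)) \<oplus> Scale (-1) (sg j \<otimes> cg j) \<oplus> (cg i \<otimes> sg j))"

no_notation Comp (infixr "\<odot>" 70) and Tens (infixr "\<otimes>" 75) and Add (infixl "\<oplus>" 65)

definition sl3_relations :: "((ix, gen, 'k::field) tm \<times> (ix, gen, 'k) tm) set" where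
  "sl3_relations =
    {(expand (\<rho> t), expand (\<rho> t')) | \<rho> t t'.
       sl3_rel t t' \<and> \<rho> \<in> {id, vrefl, hrefl, vrefl \<circ> hrefl}}"

text \<open>Rule \<open>tm_eq.rel\<close> silently skips ill-typed pairs; there are none.\<close>

lemma op_ix_op_ix [simp]: "op_ix (op_ix i) = i"
  by (cases i) simp_all

lemma sl3_rel_typed:
  assumes "sl3_rel t t'" and "\<rho> \<in> {id, vrefl, hrefl, vrefl \<circ> hrefl}"
  shows "tm_wf gen_dom gen_cod (expand (\<rho> t)) \<and> tm_wf gen_dom gen_cod (expand (\<rho> t')) \<and>
         tm_dom gen_dom (expand (\<rho> t)) = tm_dom gen_dom (expand (\<rho> t')) \<and>
         tm_cod gen_cod (expand (\<rho> t)) = tm_cod gen_cod (expand (\<rho> t'))"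
  using assms by (induction rule: sl3_rel.induct; case_tac i; auto)

lemma sl3_relations_typed:
  assumes "(t, t') \<in> sl3_relations"
  shows "\<exists>a b. tm_typed gen_dom gen_cod t a b \<and> tm_typed gen_dom gen_cod t' a b"
  using assms sl3_rel_typed unfolding sl3_relations_def tm_typed_def by blast

definition sl3_presented :: "(ix list, (ix, gen, 'k::field) tm set, 'k) lmcat" where
  "sl3_presented = presented gen_dom gen_cod sl3_relations"

definition sym_class :: "sym \<Rightarrow> (ix, gen, 'k::field) tm set" where
  "sym_class x = tm_class gen_dom gen_cod sl3_relations (sym_tm x)"

end

theory Submission
  imports Defs
begin

text \<open>
  The crystal category is semisimple, and the presented category is shown to be semisimple with the
  same simple objects. For a word \<open>w\<close>, let \<open>e\<^sub>w\<close> be the product of the idempotents \<open>1 - Q\<^sub>k\<close>, where \<open>Q\<^sub>k\<close>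
  splits the non-top component off the letters \<open>k\<close> and \<open>k + 1\<close> (\<open>Q = s m\<close> or \<open>Q = u c\<close>). Since
  \<open>1 - e\<^sub>w\<close> factors through shorter words and every word can be sorted to \<open>1\<^sup>a 2\<^sup>b\<close> by the invertible
  \<open>\<beta>\<close>'s, each morphism is a sum of morphisms factoring through the \<open>e\<^sub>w\<close> with \<open>w\<close> sorted.

  The main point is Schur's lemma \<open>e\<^sub>v f e\<^sub>w \<in> k \<delta>\<^sub>v\<^sub>w e\<^sub>w\<close> in the presented category. It holds because
  the morphisms obtained from \<open>e\<^sub>w\<close> by applying \<open>s\<close>, \<open>u\<close> and \<open>\<beta>\<close> span a subspace closed under \<open>m\<close> and
  \<open>c\<close>: the relations (SL3.7) and (SL3.8) move these past \<open>\<beta>\<close>'s modulo terms that factor through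
  shorter words, so that only sorted words remain. Schur's lemma for crystals is the fact
  that \<open>T \<otimes> \<cdots> \<otimes> T\<close> is the only highest weight element of the component cut out by \<open>e\<^sub>w\<close>, and comparing
  the two gives full faithfulness.
\<close>

text \<open>Both ends of a morphism are therefore decomposed, and the ideal of morphisms through the
  \<open>e\<^sub>w\<close> takes the place of a basis of diagrams: no dimension is counted.
  Sortedness is what makes Schur's lemma true. For the unsorted word 1 2 1 the element Top Top Mid
  is annihilated by all raising operators and by every \<open>m\<close> and \<open>c\<close>, just
  like Top Top Top, so \<open>e\<^sub>w\<close> cuts out more than one component there. The
  correction terms of (SL3.7) contain further \<open>m\<close> and \<open>c\<close>, some on words
  of the same length with fewer inversions and some on shorter words. This dictates the form of the
  closure argument, an induction on the length of the word and, inside it, on the number of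
  inversions.\<close>

notation Comp (infixr "\<odot>" 70) and Tens (infixr "\<otimes>" 75) and Add (infixl "\<oplus>" 65)

section \<open>Presented categories\<close>

lemma tm_eq_typed:
  "tm_eq gdom gcod R a b t s \<Longrightarrow> tm_typed gdom gcod t a b \<and> tm_typed gdom gcod s a b"
  by (induction rule: tm_eq.induct) (auto simp: tm_typed_def)

lemma tm_eq_typing:
  assumes "tm_eq gdom gcod R a b t s"
  shows "tm_wf gdom gcod t" "tm_dom gdom t = a" "tm_cod gcod t = b"
    "tm_wf gdom gcod s" "tm_dom gdom s = a" "tm_cod gcod s = b"
  using tm_eq_typed[OF assms] by (auto simp: tm_typed_def)

locale presentation =
  fixes gdom gcod :: "'g \<Rightarrow> 'o list"
    and R :: "(('o, 'g, 'k::field) tm \<times> ('o, 'g, 'k) tm) set"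
begin

abbreviation "cls \<equiv> tm_class gdom gcod R"
abbreviation "Pr \<equiv> presented gdom gcod R"
abbreviation twf :: "('o, 'g, 'k) tm \<Rightarrow> bool" where "twf \<equiv> tm_wf gdom gcod"
abbreviation dm :: "('o, 'g, 'k) tm \<Rightarrow> 'o list" where "dm \<equiv> tm_dom gdom"
abbreviation cd :: "('o, 'g, 'k) tm \<Rightarrow> 'o list" where "cd \<equiv> tm_cod gcod"

lemma cls_self: "twf t \<Longrightarrow> t \<in> cls t"
  unfolding tm_class_def using tm_eq.refl[of gdom gcod t "dm t" "cd t" R]
  by (auto simp: tm_typed_def)

lemma cls_eqI: "tm_eq gdom gcod R a b t s \<Longrightarrow> cls t = cls s"
proof -
  have "cls t \<subseteq> cls s" if "tm_eq gdom gcod R a b t s" for t s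
  proof
    fix r assume "r \<in> cls t"
    then obtain a' b' where r: "tm_eq gdom gcod R a' b' t r"
      by (auto simp: tm_class_def)
    \<comment> \<open>An expression determines its domain and codomain, so the two derivations have
      the same type and can be composed.\<close>
    have "a' = a" "b' = b" using tm_eq_typing[OF r] tm_eq_typing[OF that] by auto
    then show "r \<in> cls s"
      using r tm_eq.trans[OF tm_eq.sym[OF that]] by (auto simp: tm_class_def)
  qed
  then show "tm_eq gdom gcod R a b t s \<Longrightarrow> cls t = cls s"
    using tm_eq.sym by (metis subset_antisym)
qed

lemma cls_mem: "s \<in> cls t \<Longrightarrow> tm_eq gdom gcod R (dm t) (cd t) t s"
  unfolding tm_class_def using tm_eq_typing by fastforce

lemma cls_eqD: "twf s \<Longrightarrow> cls t = cls s \<Longrightarrow> tm_eq gdom gcod R (dm t) (cd t) t s"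
  using cls_self cls_mem by blast

lemma cls_eq_types: "twf s \<Longrightarrow> cls t = cls s \<Longrightarrow> dm t = dm s \<and> cd t = cd s"
  using cls_eqD tm_eq_typing(5,6) by metis

lemma hom_Pr: "hom Pr a b = {cls t | t. twf t \<and> dm t = a \<and> cd t = b}"
  by (auto simp: presented_def Let_def tm_typed_def)

lemma ident_Pr: "ident Pr a = cls (Ident a)"
  by (simp add: presented_def Let_def)

lemma zero_Pr: "zero_mor Pr a b = cls (Zero a b)"
  by (simp add: presented_def Let_def)

lemma cmp_Pr:
  assumes "twf g" "twf f" "cd f = dm g"
  shows "cmp Pr (cls g) (cls f) = cls (g \<odot> f)"
proof -
  have *: "cls (g' \<odot> f') = cls (g \<odot> f)" if "g' \<in> cls g" "f' \<in> cls f" for g' f'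
    using tm_eq.cong_comp[OF cls_mem[OF that(1)], of _ f f'] cls_mem[OF that(2)] assms
    by (metis cls_eqI)
  \<comment> \<open>The operation is a union of one and the same class over all representatives; it
    equals that class only because a representative exists.\<close>
  have "cls f \<noteq> {}" "cls g \<noteq> {}"
    using cls_self assms by blast+
  then show ?thesis
    by (simp add: presented_def Let_def * cong: SUP_cong_simp)
qed

lemma tens_Pr:
  assumes "twf f" "twf g"
  shows "tens_mor Pr (cls f) (cls g) = cls (f \<otimes> g)"
proof -
  have *: "cls (f' \<otimes> g') = cls (f \<otimes> g)" if "f' \<in> cls f" "g' \<in> cls g" for g' f'
    using tm_eq.cong_tens[OF cls_mem[OF that(1)] cls_mem[OF that(2)]]
    by (metis cls_eqI)
  have "cls f \<noteq> {}" "cls g \<noteq> {}"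
    using cls_self assms by blast+
  then show ?thesis
    by (simp add: presented_def Let_def * cong: SUP_cong_simp)
qed

lemma add_Pr:
  assumes "twf f" "twf g" "dm f = dm g" "cd f = cd g"
  shows "add_mor Pr (cls f) (cls g) = cls (f \<oplus> g)"
proof -
  have *: "cls (f' \<oplus> g') = cls (f \<oplus> g)" if "f' \<in> cls f" "g' \<in> cls g" for g' f'
    using tm_eq.cong_add[OF cls_mem[OF that(1)], of g g'] cls_mem[OF that(2)] assms
    by (metis cls_eqI)
  have "cls f \<noteq> {}" "cls g \<noteq> {}"
    using cls_self assms by blast+
  then show ?thesis
    by (simp add: presented_def Let_def * cong: SUP_cong_simp)
qed

lemma scale_Pr:
  assumes "twf f"
  shows "scale_mor Pr x (cls f) = cls (Scale x f)"
proof -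
  have *: "cls (Scale x f') = cls (Scale x f)" if "f' \<in> cls f" for f'
    using tm_eq.cong_scale[OF cls_mem[OF that]] by (metis cls_eqI)
  have "cls f \<noteq> {}"
    using cls_self assms by blast
  then show ?thesis
    by (simp add: presented_def Let_def * cong: SUP_cong_simp)
qed

lemmas ops_Pr = ident_Pr zero_Pr cmp_Pr tens_Pr add_Pr scale_Pr

lemma obj_Pr [simp]: "obj Pr = UNIV" "unit_obj Pr = []" "tens_obj Pr = (@)"
  by (simp_all add: presented_def Let_def)

text \<open>Apart from disjointness of the hom sets, where the expression fixes its type, each axiom
  is either a typing statement or, on representatives, literally one of the rules that generate the
  congruence.\<close>

lemma linear_moncat_presented: "linear_moncat Pr"
proof
  fix a b a' b' f
  assume "f \<in> hom Pr a b" "f \<in> hom Pr a' b'"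
  then show "a = a' \<and> b = b'"
    using cls_eq_types by (auto simp: hom_Pr)
qed ((clarsimp simp: hom_Pr ops_Pr; fail) |
    (clarsimp simp: hom_Pr ops_Pr, rule cls_eqI, rule
      tm_eq.comp_assoc tm_eq.comp_ident_right tm_eq.comp_ident_left tm_eq.tens_assoc
      tm_eq.tens_unit_left tm_eq.tens_unit_right tm_eq.tens_ident tm_eq.interchange
      tm_eq.add_assoc tm_eq.add_commute tm_eq.add_zero tm_eq.add_neg tm_eq.scale_one
      tm_eq.scale_scale tm_eq.scale_add_right tm_eq.scale_add_left tm_eq.comp_add_left
      tm_eq.comp_add_right tm_eq.comp_scale_left tm_eq.comp_scale_right
      tm_eq.tens_add_left tm_eq.tens_add_right tm_eq.tens_scale_left
      tm_eq.tens_scale_right;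
      unfold tm_typed_def; intro conjI; (rule HOL.refl | simp)) |
    (clarsimp simp: hom_Pr ops_Pr, intro exI conjI, rule HOL.refl; simp))+

end

section \<open>Interpretations in categories whose objects are words\<close>

locale word_moncat = linear_moncat C
  for C :: "('o list, 'm, 'k::field) lmcat" +
  assumes obj_UNIV [simp]: "obj C = UNIV"
    and unit_Nil [simp]: "unit_obj C = []"
    and tens_append [simp]: "tens_obj C = (@)"
begin

abbreviation comp_C (infixr "\<cdot>" 70) where "g \<cdot> f \<equiv> cmp C g f"
abbreviation tens_C (infixr "\<star>" 75) where "f \<star> g \<equiv> tens_mor C f g"
abbreviation "\<iota> \<equiv> ident C"
abbreviation add_C (infixl "+\<^sub>C" 65) where "f +\<^sub>C g \<equiv> add_mor C f g"
abbreviation scale_C (infixr "*\<^sub>C" 72) where "x *\<^sub>C f \<equiv> scale_mor C x f"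
abbreviation diff_C (infixl "-\<^sub>C" 65) where "f -\<^sub>C g \<equiv> add_mor C f (scale_mor C (-1) g)"

text \<open>Recovering domain and codomain from the morphism turns the membership premises of the
  axioms into equations between words, which simplification can discharge. The axioms are restated
  below in this form.\<close>

definition arr :: "'m \<Rightarrow> bool" where "arr f \<longleftrightarrow> (\<exists>a b. f \<in> hom C a b)"
definition src :: "'m \<Rightarrow> 'o list" where "src f = (THE a. \<exists>b. f \<in> hom C a b)"
definition tgt :: "'m \<Rightarrow> 'o list" where "tgt f = (THE b. \<exists>a. f \<in> hom C a b)"

lemma hom_iff: "f \<in> hom C a b \<longleftrightarrow> arr f \<and> src f = a \<and> tgt f = b"
proof -
  have *: "src f = a \<and> tgt f = b" if "f \<in> hom C a b" for a b
  proof -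
    have u: "a' = a \<and> b' = b" if "f \<in> hom C a' b'" for a' b'
      using hom_disjoint[of a' b' a b f] that \<open>f \<in> hom C a b\<close> by simp
    show ?thesis
      unfolding src_def tgt_def using that u by (blast intro: the_equality)
  qed
  then show ?thesis unfolding arr_def by blast
qed

lemma arr_simps [simp]:
  "arr (\<iota> a)" "src (\<iota> a) = a" "tgt (\<iota> a) = a"
  "arr (zero_mor C a b)" "src (zero_mor C a b) = a" "tgt (zero_mor C a b) = b"
  "\<lbrakk>arr g; arr f; tgt f = src g\<rbrakk> \<Longrightarrow> arr (g \<cdot> f)"
  "\<lbrakk>arr g; arr f; tgt f = src g\<rbrakk> \<Longrightarrow> src (g \<cdot> f) = src f"
  "\<lbrakk>arr g; arr f; tgt f = src g\<rbrakk> \<Longrightarrow> tgt (g \<cdot> f) = tgt g"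
  "\<lbrakk>arr g; arr f\<rbrakk> \<Longrightarrow> arr (f \<star> g)"
  "\<lbrakk>arr g; arr f\<rbrakk> \<Longrightarrow> src (f \<star> g) = src f @ src g"
  "\<lbrakk>arr g; arr f\<rbrakk> \<Longrightarrow> tgt (f \<star> g) = tgt f @ tgt g"
  "\<lbrakk>arr f; arr g; src g = src f; tgt g = tgt f\<rbrakk> \<Longrightarrow> arr (f +\<^sub>C g)"
  "\<lbrakk>arr f; arr g; src g = src f; tgt g = tgt f\<rbrakk> \<Longrightarrow> src (f +\<^sub>C g) = src f"
  "\<lbrakk>arr f; arr g; src g = src f; tgt g = tgt f\<rbrakk> \<Longrightarrow> tgt (f +\<^sub>C g) = tgt f"
  "arr f \<Longrightarrow> arr (x *\<^sub>C f)"
  "arr f \<Longrightarrow> src (x *\<^sub>C f) = src f"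
  "arr f \<Longrightarrow> tgt (x *\<^sub>C f) = tgt f"
  using ident_hom[of a] zero_hom[of a b] comp_hom[of "src f" "src g" "tgt g" f g]
    tens_hom[of "src f" "tgt f" "src g" "tgt g" f g] add_hom[of "src f" "tgt f" f g]
    scale_hom[of "src f" "tgt f" f x]
  by (simp_all add: hom_iff)

lemma c_assoc:
  "\<lbrakk>arr f; arr g; arr h; tgt f = src g; tgt g = src h\<rbrakk> \<Longrightarrow> (h \<cdot> g) \<cdot> f = h \<cdot> (g \<cdot> f)"
  using comp_assoc[of "src f" "src g" "src h" "tgt h" f g h] by (simp add: hom_iff)

lemma c_ident [simp]:
  "\<lbrakk>arr f; src f = a\<rbrakk> \<Longrightarrow> f \<cdot> \<iota> a = f" "\<lbrakk>arr f; tgt f = b\<rbrakk> \<Longrightarrow> \<iota> b \<cdot> f = f"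
  using comp_ident_right[of a "tgt f" f] comp_ident_left[of "src f" b f] by (simp_all add: hom_iff)

lemma t_assoc: "\<lbrakk>arr f; arr g; arr h\<rbrakk> \<Longrightarrow> (f \<star> g) \<star> h = f \<star> (g \<star> h)"
  using tens_assoc[of "src f" "tgt f" "src g" "tgt g" "src h" "tgt h" f g h] by (simp add: hom_iff)

lemma t_unit [simp]: "arr f \<Longrightarrow> \<iota> [] \<star> f = f" "arr f \<Longrightarrow> f \<star> \<iota> [] = f"
  using tens_unit_left[of "src f" "tgt f" f] tens_unit_right[of "src f" "tgt f" f]
  by (simp_all add: hom_iff)

lemma t_ident: "\<iota> a \<star> \<iota> b = \<iota> (a @ b)"
  using tens_ident[of a b] by simp

lemma t_comp:
  "\<lbrakk>arr f; arr g; arr f'; arr g'; tgt f = src g; tgt f' = src g'\<rbrakk>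
    \<Longrightarrow> (g \<star> g') \<cdot> (f \<star> f') = (g \<cdot> f) \<star> (g' \<cdot> f')"
  using interchange[of "src f" "src g" "tgt g" "src f'" "src g'" "tgt g'" f g f' g']
  by (simp add: hom_iff)

abbreviation parallel :: "'m \<Rightarrow> 'm \<Rightarrow> bool" where
  "parallel f g \<equiv> arr f \<and> arr g \<and> src g = src f \<and> tgt g = tgt f"

lemma a_assoc: "\<lbrakk>parallel f g; parallel f h\<rbrakk> \<Longrightarrow> (f +\<^sub>C g) +\<^sub>C h = f +\<^sub>C (g +\<^sub>C h)"
  using add_assoc[of "src f" "tgt f" f g h] by (simp add: hom_iff)

lemma a_commute: "parallel f g \<Longrightarrow> f +\<^sub>C g = g +\<^sub>C f"
  using add_commute[of "src f" "tgt f" f g] by (simp add: hom_iff)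

lemma a_zero [simp]:
  "\<lbrakk>arr f; src f = a; tgt f = b\<rbrakk> \<Longrightarrow> f +\<^sub>C zero_mor C a b = f"
  "\<lbrakk>arr f; src f = a; tgt f = b\<rbrakk> \<Longrightarrow> zero_mor C a b +\<^sub>C f = f"
  using add_zero[of a b f] a_commute[of f "zero_mor C a b"] by (simp_all add: hom_iff)

lemma diff_self [simp]: "arr f \<Longrightarrow> f -\<^sub>C f = zero_mor C (src f) (tgt f)"
  using add_neg[of "src f" "tgt f" f] by (simp add: hom_iff)

lemma s_one [simp]: "arr f \<Longrightarrow> 1 *\<^sub>C f = f"
  using scale_one[of "src f" "tgt f" f] by (simp add: hom_iff)

lemma s_scale: "arr f \<Longrightarrow> x *\<^sub>C (y *\<^sub>C f) = (x * y) *\<^sub>C f"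
  using scale_scale[of "src f" "tgt f" f] by (simp add: hom_iff)

lemma s_add: "parallel f g \<Longrightarrow> x *\<^sub>C (f +\<^sub>C g) = x *\<^sub>C f +\<^sub>C x *\<^sub>C g"
  using scale_add_right[of "src f" "tgt f" f g] by (simp add: hom_iff)

lemma s_plus: "arr f \<Longrightarrow> (x + y) *\<^sub>C f = x *\<^sub>C f +\<^sub>C y *\<^sub>C f"
  using scale_add_left[of "src f" "tgt f" f] by (simp add: hom_iff)

text \<open>No axiom mentions the scalar 0. The multiple \<open>g\<close> of \<open>f\<close> by 0
  satisfies \<open>g + g = g\<close>, and subtracting \<open>g\<close> gives the claim.\<close>

lemma s_zero [simp]: "arr f \<Longrightarrow> 0 *\<^sub>C f = zero_mor C (src f) (tgt f)"
proof -
  assume f: "arr f"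
  let ?g = "0 *\<^sub>C f"
  have "(?g +\<^sub>C ?g) -\<^sub>C ?g = ?g -\<^sub>C ?g"
    using f by (simp flip: s_plus)
  then show ?thesis using f by (simp add: a_assoc)
qed

lemma s_zero_mor [simp]: "x *\<^sub>C zero_mor C a b = zero_mor C a b"
  using s_scale[of "zero_mor C a b" x 0] by simp

lemma c_add_left:
  "\<lbrakk>parallel g g'; arr f; tgt f = src g\<rbrakk> \<Longrightarrow> (g +\<^sub>C g') \<cdot> f = g \<cdot> f +\<^sub>C g' \<cdot> f"
  using comp_add_left[of "src f" "src g" "tgt g" f g g'] by (simp add: hom_iff)

lemma c_add_right:
  "\<lbrakk>parallel f f'; arr g; tgt f = src g\<rbrakk> \<Longrightarrow> g \<cdot> (f +\<^sub>C f') = g \<cdot> f +\<^sub>C g \<cdot> f'"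
  using comp_add_right[of "src f" "src g" "tgt g" f f' g] by (simp add: hom_iff)

lemma c_scale_left: "\<lbrakk>arr g; arr f; tgt f = src g\<rbrakk> \<Longrightarrow> (x *\<^sub>C g) \<cdot> f = x *\<^sub>C (g \<cdot> f)"
  using comp_scale_left[of "src f" "src g" "tgt g" f g x] by (simp add: hom_iff)

lemma c_scale_right: "\<lbrakk>arr g; arr f; tgt f = src g\<rbrakk> \<Longrightarrow> g \<cdot> (x *\<^sub>C f) = x *\<^sub>C (g \<cdot> f)"
  using comp_scale_right[of "src f" "src g" "tgt g" f g x] by (simp add: hom_iff)

lemma t_add_left: "\<lbrakk>parallel f g; arr h\<rbrakk> \<Longrightarrow> (f +\<^sub>C g) \<star> h = f \<star> h +\<^sub>C g \<star> h"
  using tens_add_left[of "src f" "tgt f" "src h" "tgt h" f g h] by (simp add: hom_iff)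

lemma t_add_right: "\<lbrakk>parallel f g; arr h\<rbrakk> \<Longrightarrow> h \<star> (f +\<^sub>C g) = h \<star> f +\<^sub>C h \<star> g"
  using tens_add_right[of "src h" "tgt h" "src f" "tgt f" h f g] by (simp add: hom_iff)

lemma t_scale_left: "\<lbrakk>arr f; arr g\<rbrakk> \<Longrightarrow> (x *\<^sub>C f) \<star> g = x *\<^sub>C (f \<star> g)"
  using tens_scale_left[of "src f" "tgt f" "src g" "tgt g" f g x] by (simp add: hom_iff)

lemma t_scale_right: "\<lbrakk>arr f; arr g\<rbrakk> \<Longrightarrow> f \<star> (x *\<^sub>C g) = x *\<^sub>C (f \<star> g)"
  using tens_scale_right[of "src f" "tgt f" "src g" "tgt g" f g x] by (simp add: hom_iff)

lemma c_zero [simp]: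
  "\<lbrakk>arr g; src g = b\<rbrakk> \<Longrightarrow> g \<cdot> zero_mor C a b = zero_mor C a (tgt g)"
  "\<lbrakk>arr f; tgt f = b\<rbrakk> \<Longrightarrow> zero_mor C b c \<cdot> f = zero_mor C (src f) c"
  using c_scale_right[of g "zero_mor C a b" 0] c_scale_left[of "zero_mor C b c" f 0] by simp_all

lemma t_zero [simp]:
  "arr f \<Longrightarrow> zero_mor C a b \<star> f = zero_mor C (a @ src f) (b @ tgt f)"
  "arr f \<Longrightarrow> f \<star> zero_mor C a b = zero_mor C (src f @ a) (tgt f @ b)"
  using t_scale_left[of "zero_mor C a b" f 0] t_scale_right[of f "zero_mor C a b" 0] by simp_all

end

locale interpretation_moncat = word_moncat C
  for C :: "('o list, 'm, 'k::field) lmcat" +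
  fixes gdom gcod :: "'g \<Rightarrow> 'o list" and gen :: "'g \<Rightarrow> 'm"
  assumes gen_hom: "gen x \<in> hom C (gdom x) (gcod x)"
begin

fun ev :: "('o, 'g, 'k) tm \<Rightarrow> 'm" where
  "ev (Gen x) = gen x"
| "ev (Ident a) = \<iota> a"
| "ev (Zero a b) = zero_mor C a b"
| "ev (Comp g f) = ev g \<cdot> ev f"
| "ev (Tens f g) = ev f \<star> ev g"
| "ev (Add f g) = ev f +\<^sub>C ev g"
| "ev (Scale x f) = x *\<^sub>C ev f"

lemma gen_arr [simp]: "arr (gen x)" "src (gen x) = gdom x" "tgt (gen x) = gcod x"
  using gen_hom[of x] by (simp_all add: hom_iff)

lemma ev_arr:
  "tm_wf gdom gcod t \<Longrightarrow> arr (ev t) \<and> src (ev t) = tm_dom gdom t \<and> tgt (ev t) = tm_cod gcod t"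
  by (induction t) auto

lemmas ev_simps [simp] =
  ev_arr[THEN conjunct1] ev_arr[THEN conjunct2, THEN conjunct1] ev_arr[THEN conjunct2, THEN conjunct2]

lemma ev_tm_eq:
  assumes "tm_eq gdom gcod R a b t s"
    and "\<And>t s. (t, s) \<in> R \<Longrightarrow> ev t = ev s"
  shows "ev t = ev s"
  using assms(1)
proof (induction rule: tm_eq.induct)
  case (rel t s a b)
  then show ?case using assms(2) by blast
next
  case (add_commute f g a b)
  then show ?case by (simp add: tm_typed_def a_commute[of "ev f" "ev g"])
qed (auto simp: tm_typed_def c_assoc t_assoc t_ident t_comp a_assoc s_scale s_add s_plus
    c_add_left c_add_right c_scale_left c_scale_right t_add_left t_add_right t_scale_left
    t_scale_right)

text \<open>A layer of a string diagram: \<open>t\<close> with identity strands \<open>l\<close> and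
  \<open>r\<close> beside it, composed after \<open>y\<close>. With diagrams written as iterated
  layers acting on one morphism, a relation becomes an equation between successive layers that can
  be used anywhere in a diagram, without rebracketing composites or tensor products.\<close>

definition act :: "'o list \<Rightarrow> ('o, 'g, 'k) tm \<Rightarrow> 'o list \<Rightarrow> 'm \<Rightarrow> 'm" where
  "act l t r y = (\<iota> l \<star> ev t \<star> \<iota> r) \<cdot> y"

context
  fixes l r :: "'o list" and t :: "('o, 'g, 'k) tm" and y :: 'm
  assumes t: "tm_wf gdom gcod t" and y: "arr y" "tgt y = l @ tm_dom gdom t @ r"
begin

lemma act_arr [simp]:
  "arr (act l t r y)" "src (act l t r y) = src y" "tgt (act l t r y) = l @ tm_cod gcod t @ r"
  using t y by (simp_all add: act_def)

lemma act_comp_right: "\<lbrakk>arr x; tgt x = src y\<rbrakk> \<Longrightarrow> act l t r y \<cdot> x = act l t r (y \<cdot> x)"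
  using t y by (simp add: act_def c_assoc)

lemma act_scale: "act l t r (x *\<^sub>C y) = x *\<^sub>C act l t r y"
  using t y by (simp add: act_def c_scale_right)

lemma act_add: "\<lbrakk>arr y'; src y' = src y; tgt y' = tgt y\<rbrakk>
    \<Longrightarrow> act l t r (y +\<^sub>C y') = act l t r y +\<^sub>C act l t r y'"
  using t y by (simp add: act_def c_add_right)

end

lemma act_zero [simp]:
  "\<lbrakk>tm_wf gdom gcod t; b = l @ tm_dom gdom t @ r\<rbrakk>
    \<Longrightarrow> act l t r (zero_mor C a b) = zero_mor C a (l @ tm_cod gcod t @ r)"
  by (simp add: act_def)

lemma act_Ident: "\<lbrakk>arr y; tgt y = l @ a @ r\<rbrakk> \<Longrightarrow> act l (Ident a) r y = y"
  by (simp add: act_def t_ident)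

lemma act_Zero: "\<lbrakk>arr y; tgt y = l @ a @ r\<rbrakk> \<Longrightarrow> act l (Zero a b) r y = zero_mor C (src y) (l @ b @ r)"
  by (simp add: act_def)

lemma act_Comp:
  "\<lbrakk>tm_wf gdom gcod (g \<odot> f); arr y; tgt y = l @ tm_dom gdom f @ r\<rbrakk>
    \<Longrightarrow> act l (g \<odot> f) r y = act l g r (act l f r y)"
  by (simp add: act_def t_comp flip: c_assoc)

text \<open>The interchange law allows either factor to act first. The second form serves for
  relations that are wanted with the left factor acting first.\<close>

lemma act_Tens:
  assumes "tm_wf gdom gcod (f \<otimes> g)" "arr y" "tgt y = l @ tm_dom gdom f @ tm_dom gdom g @ r"
  shows "act l (f \<otimes> g) r y = act l f (tm_cod gcod g @ r) (act (l @ tm_dom gdom f) g r y)"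
    and "act l (f \<otimes> g) r y = act (l @ tm_cod gcod f) g r (act l f (tm_dom gdom g @ r) y)"
proof -
  have 1: "\<iota> l \<star> ev (f \<otimes> g) \<star> \<iota> r =
      (\<iota> l \<star> ev f \<star> \<iota> (tm_cod gcod g @ r)) \<cdot> (\<iota> (l @ tm_dom gdom f) \<star> ev g \<star> \<iota> r)"
    using assms unfolding t_ident[symmetric] by (simp add: t_comp t_assoc)
  have 2: "\<iota> l \<star> ev (f \<otimes> g) \<star> \<iota> r =
      (\<iota> (l @ tm_cod gcod f) \<star> ev g \<star> \<iota> r) \<cdot> (\<iota> l \<star> ev f \<star> \<iota> (tm_dom gdom g @ r))"
    using assms unfolding t_ident[symmetric] by (simp add: t_comp t_assoc)
  show "act l (f \<otimes> g) r y = act l f (tm_cod gcod g @ r) (act (l @ tm_dom gdom f) g r y)"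
    unfolding act_def 1 using assms by (simp add: c_assoc)
  show "act l (f \<otimes> g) r y = act (l @ tm_cod gcod f) g r (act l f (tm_dom gdom g @ r) y)"
    unfolding act_def 2 using assms by (simp add: c_assoc)
qed

lemma act_Add:
  "\<lbrakk>tm_wf gdom gcod (f \<oplus> g); arr y; tgt y = l @ tm_dom gdom f @ r\<rbrakk>
    \<Longrightarrow> act l (f \<oplus> g) r y = act l f r y +\<^sub>C act l g r y"
  by (simp add: act_def t_add_left t_add_right c_add_left)

lemma act_Scale:
  "\<lbrakk>tm_wf gdom gcod f; arr y; tgt y = l @ tm_dom gdom f @ r\<rbrakk>
    \<Longrightarrow> act l (Scale x f) r y = x *\<^sub>C act l f r y"
  by (simp add: act_def t_scale_left t_scale_right c_scale_left)

text \<open>Layers on disjoint strands commute: both sides evaluate the tensor product of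
  \<open>f\<close>, the strands \<open>m\<close> and \<open>g\<close>, in the two orders of the
  interchange law.\<close>

lemma act_commute:
  "\<lbrakk>tm_wf gdom gcod f; tm_wf gdom gcod g; arr y;
    tgt y = l @ tm_dom gdom f @ m @ tm_dom gdom g @ r\<rbrakk>
    \<Longrightarrow> act l f (m @ tm_cod gcod g @ r) (act (l @ tm_dom gdom f @ m) g r y) =
      act (l @ tm_cod gcod f @ m) g r (act l f (m @ tm_dom gdom g @ r) y)"
  using act_Tens[of f "Ident m \<otimes> g" y l r]
  by (simp add: act_Tens(1)[of "Ident m"] act_Ident)

end

section \<open>Consequences of the relations\<close>

lemma op_ix_neq [simp]: "op_ix i \<noteq> i" "i \<noteq> op_ix i"
  by (cases i; simp)+

lemma neq_op_ix: "x \<noteq> y \<Longrightarrow> y = op_ix x"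
  by (cases x; cases y) auto

text \<open>\<open>dn x y\<close> and \<open>up x y\<close> project onto and embed the component of \<open>B\<^sub>x \<otimes> B\<^sub>y\<close> other than the top one,
  which is the word \<open>lo x y\<close>.\<close>

definition dn :: "ix \<Rightarrow> ix \<Rightarrow> sym" where "dn x y = (if x = y then Sym_m x else Sym_c x)"
definition up :: "ix \<Rightarrow> ix \<Rightarrow> sym" where "up x y = (if x = y then Sym_s x else Sym_u x)"
definition lo :: "ix \<Rightarrow> ix \<Rightarrow> ix list" where "lo x y = (if x = y then [op_ix x] else [])"

lemma dn_up_dom_cod [simp]:
  "sym_dom (dn x y) = [x, y]" "sym_cod (dn x y) = lo x y"
  "sym_cod (up x y) = [x, y]" "sym_dom (up x y) = lo x y"
  using neq_op_ix[of x y] by (auto simp: dn_def up_def lo_def)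

text \<open>The reflections permute all ten symbols, so all ten are interpreted. Crystals and the
  presented category are both instances; the projections \<open>top_proj\<close> below are then one
  formula in both, which the functor preserves.\<close>

locale sl3_category = interpretation_moncat C sym_dom sym_cod g
  for C :: "(ix list, 'm, 'k::field) lmcat" and g +
  assumes relations:
    "\<lbrakk>sl3_rel t t'; \<rho> \<in> {id, vrefl, hrefl, vrefl \<circ> hrefl}\<rbrakk> \<Longrightarrow> ev (\<rho> t) = ev (\<rho> t')"
begin

abbreviation ap :: "ix list \<Rightarrow> sym \<Rightarrow> ix list \<Rightarrow> 'm \<Rightarrow> 'm" where "ap l s r \<equiv> act l (Gen s) r"

lemma act_rel:
  assumes "sl3_rel t t'"
  shows "act l t r y = act l t' r y" "act l (vrefl t) r y = act l (vrefl t') r y"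
    "act l (hrefl t) r y = act l (hrefl t') r y"
    "act l (vrefl (hrefl t)) r y = act l (vrefl (hrefl t')) r y"
  using relations[OF assms, of id] relations[OF assms, of vrefl] relations[OF assms, of hrefl]
    relations[OF assms, of "vrefl \<circ> hrefl"]
  by (simp_all add: act_def)

lemmas act_simps = act_Ident act_Zero act_Comp act_Tens(1) act_Add act_Scale

section \<open>The relations as equations between layers\<close>

context
  fixes v :: 'm and l r :: "ix list"
  assumes v: "arr v"
begin

text \<open>In the following names a prime marks a horizontal reflection
  (\<open>merge_split_left\<close> is that of \<open>merge_split_right\<close>). The vertical
  reflection exchanges cap with cup and merge with split and reverses the order of the words in a
  name.\<close>

lemma beta_beta: "tgt v = l @ i # op_ix i # r \<Longrightarrow> ap l (Sym_b (op_ix i)) r (ap l (Sym_b i) r v) = v"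
  using act_rel(1)[OF SL3_1[OF HOL.refl, of i], of l r v] v by (simp add: act_simps)

lemma cap_beta:
  "tgt v = l @ op_ix i # i # r \<Longrightarrow> ap l (Sym_c (op_ix i)) r v = ap l (Sym_c i) r (ap l (Sym_b (op_ix i)) r v)"
  using act_rel(1)[OF SL3_0b[OF HOL.refl, of i], of l r v] v by (simp add: act_simps)

lemma beta_cup: "tgt v = l @ r \<Longrightarrow> ap l (Sym_b i) r (ap l (Sym_u i) r v) = ap l (Sym_u (op_ix i)) r v"
  using act_rel(2)[OF SL3_0b[OF HOL.refl, of i], of l r v] v by (simp add: act_simps)

lemma cap_cup: "tgt v = l @ r \<Longrightarrow> ap l (Sym_c i) r (ap l (Sym_u i) r v) = v"
  using act_rel(1)[OF SL3_2, of l i r v] v by (simp add: act_simps)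

lemma merge_split: "tgt v = l @ op_ix i # r \<Longrightarrow> ap l (Sym_m i) r (ap l (Sym_s i) r v) = v"
  using act_rel(1)[OF SL3_3[OF HOL.refl], of l i r v] v by (simp add: act_simps)

lemma dn_up: "tgt v = l @ lo x y @ r \<Longrightarrow> ap l (dn x y) r (ap l (up x y) r v) = v"
  using cap_cup merge_split neq_op_ix[of x y] by (auto simp: dn_def up_def lo_def split: if_splits)

lemma cap_split: "tgt v = l @ op_ix i # op_ix i # r \<Longrightarrow>
    ap (l @ [i]) (Sym_c i) r (ap l (Sym_s i) (op_ix i # r) v) = zero_mor C (src v) (l @ i # r)"
  using act_rel(1)[OF SL3_4a[OF HOL.refl], of l i r v] v by (simp add: act_simps)

lemma merge_cup: "tgt v = l @ i # r \<Longrightarrow>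
    ap l (Sym_m i) (op_ix i # r) (ap (l @ [i]) (Sym_u i) r v) =
    zero_mor C (src v) (l @ op_ix i # op_ix i # r)"
  using act_rel(2)[OF SL3_4a[OF HOL.refl], of l i r v] v by (simp add: act_simps)

lemma cap_split': "tgt v = l @ op_ix i # op_ix i # r \<Longrightarrow>
    ap l (Sym_c (op_ix i)) (i # r) (ap (l @ [op_ix i]) (Sym_s i) r v) = zero_mor C (src v) (l @ i # r)"
  using act_rel(3)[OF SL3_4a[OF HOL.refl], of l i r v] v by (simp add: act_simps)

lemma merge_cup': "tgt v = l @ i # r \<Longrightarrow>
    ap (l @ [op_ix i]) (Sym_m i) r (ap l (Sym_u (op_ix i)) (i # r) v) =
    zero_mor C (src v) (l @ op_ix i # op_ix i # r)"
  using act_rel(4)[OF SL3_4a[OF HOL.refl], of l i r v] v by (simp add: act_simps)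

lemma cap_cup_zigzag: "tgt v = l @ i # r \<Longrightarrow>
    ap (l @ [i]) (Sym_c (op_ix i)) r (ap l (Sym_u i) (i # r) v) = zero_mor C (src v) (l @ i # r)"
  using act_rel(1)[OF SL3_4b[OF HOL.refl], of l i r v] v by (simp add: act_simps)

lemma cap_cup_zigzag': "tgt v = l @ i # r \<Longrightarrow>
    ap l (Sym_c i) (i # r) (ap (l @ [i]) (Sym_u (op_ix i)) r v) = zero_mor C (src v) (l @ i # r)"
  using act_rel(3)[OF SL3_4b[OF HOL.refl], of l i r v] v by (simp add: act_simps)

lemma merge_split_right: "tgt v = l @ op_ix i # i # r \<Longrightarrow>
    ap (l @ [i]) (Sym_m i) r (ap l (Sym_s i) (i # r) v) =
    ap l (Sym_u i) r (ap l (Sym_c (op_ix i)) r v)"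
  using act_rel(1)[OF SL3_5[OF HOL.refl], of l i r v] v by (simp add: act_simps)

lemma merge_split_left: "tgt v = l @ i # op_ix i # r \<Longrightarrow>
    ap l (Sym_m i) (i # r) (ap (l @ [i]) (Sym_s i) r v) =
    ap l (Sym_u (op_ix i)) r (ap l (Sym_c i) r v)"
  using act_rel(3)[OF SL3_5[OF HOL.refl], of l i r v] v by (simp add: act_simps)

lemma cap_merge: "tgt v = l @ i # i # i # r \<Longrightarrow>
    ap l (Sym_c i) r (ap (l @ [i]) (Sym_m i) r v) =
    ap l (Sym_c (op_ix i)) r (ap l (Sym_m i) (i # r) v)"
  using act_rel(1)[OF SL3_6[OF HOL.refl], of l i r v] v by (simp add: act_simps)

lemma split_cup: "tgt v = l @ r \<Longrightarrow>
    ap (l @ [i]) (Sym_s i) r (ap l (Sym_u i) r v) =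
    ap l (Sym_s i) (i # r) (ap l (Sym_u (op_ix i)) r v)"
  using act_rel(2)[OF SL3_6[OF HOL.refl], of l i r v] v by (simp add: act_simps)

lemma merge_beta_beta: "tgt v = l @ i # i # op_ix i # r \<Longrightarrow>
    ap (l @ [op_ix i]) (Sym_m i) r (ap l (Sym_b i) (i # r) (ap (l @ [i]) (Sym_b i) r v)) =
    ap l (Sym_m i) (op_ix i # r) v +\<^sub>C ap l (Sym_s (op_ix i)) r (ap (l @ [i]) (Sym_c i) r v)
      -\<^sub>C ap l (Sym_s (op_ix i)) r (ap l (Sym_m (op_ix i)) r (ap l (Sym_m i) (op_ix i # r) v))"
  using act_rel(1)[OF SL3_7[OF HOL.refl], of l i r v] v by (simp add: act_simps)

lemma merge_beta_beta': "tgt v = l @ op_ix i # i # i # r \<Longrightarrow>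
    ap l (Sym_m i) (op_ix i # r) (ap (l @ [i]) (Sym_b (op_ix i)) r (ap l (Sym_b (op_ix i)) (i # r) v)) =
    ap (l @ [op_ix i]) (Sym_m i) r v +\<^sub>C ap l (Sym_s (op_ix i)) r (ap l (Sym_c (op_ix i)) (i # r) v)
      -\<^sub>C ap l (Sym_s (op_ix i)) r (ap l (Sym_m (op_ix i)) r (ap (l @ [op_ix i]) (Sym_m i) r v))"
  using act_rel(3)[OF SL3_7[OF HOL.refl], of l i r v] v
  by (simp add: act_Ident act_Zero act_Comp act_Tens(2) act_Add act_Scale)

lemma beta_beta_split: "tgt v = l @ op_ix i # op_ix i # r \<Longrightarrow>
    ap (l @ [i]) (Sym_b (op_ix i)) r (ap l (Sym_b (op_ix i)) (i # r) (ap (l @ [op_ix i]) (Sym_s i) r v)) =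
    ap l (Sym_s i) (op_ix i # r) v +\<^sub>C ap (l @ [i]) (Sym_u i) r (ap l (Sym_m (op_ix i)) r v)
      -\<^sub>C ap l (Sym_s i) (op_ix i # r) (ap l (Sym_s (op_ix i)) r (ap l (Sym_m (op_ix i)) r v))"
  using act_rel(2)[OF SL3_7[OF HOL.refl], of l i r v] v
  by (simp add: act_Ident act_Zero act_Comp act_Tens(2) act_Add act_Scale)

lemma beta_beta_split': "tgt v = l @ op_ix i # op_ix i # r \<Longrightarrow>
    ap l (Sym_b i) (i # r) (ap (l @ [i]) (Sym_b i) r (ap l (Sym_s i) (op_ix i # r) v)) =
    ap (l @ [op_ix i]) (Sym_s i) r v +\<^sub>C ap l (Sym_u (op_ix i)) (i # r) (ap l (Sym_m (op_ix i)) r v)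
      -\<^sub>C ap (l @ [op_ix i]) (Sym_s i) r (ap l (Sym_s (op_ix i)) r (ap l (Sym_m (op_ix i)) r v))"
  using act_rel(4)[OF SL3_7[OF HOL.refl], of l i r v] v by (simp add: act_simps)

lemma cap_far: "tgt v = l @ i # i # op_ix i # r \<Longrightarrow>
    ap l (Sym_c i) (i # r) (ap (l @ [i]) (Sym_b i) r v) =
    ap l (Sym_m (op_ix i)) r (ap l (Sym_m i) (op_ix i # r) v)"
  using act_rel(1)[OF SL3_8[OF HOL.refl], of l i r v] v by (simp add: act_simps)

lemma cap_far': "tgt v = l @ op_ix i # i # i # r \<Longrightarrow>
    ap (l @ [i]) (Sym_c (op_ix i)) r (ap l (Sym_b (op_ix i)) (i # r) v) =
    ap l (Sym_m (op_ix i)) r (ap (l @ [op_ix i]) (Sym_m i) r v)"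
  using act_rel(3)[OF SL3_8[OF HOL.refl], of l i r v] v by (simp add: act_simps)

lemma cup_far: "tgt v = l @ i # r \<Longrightarrow>
    ap (l @ [i]) (Sym_b (op_ix i)) r (ap l (Sym_u i) (i # r) v) =
    ap l (Sym_s i) (op_ix i # r) (ap l (Sym_s (op_ix i)) r v)"
  using act_rel(2)[OF SL3_8[OF HOL.refl], of l i r v] v by (simp add: act_simps)

lemma cup_far': "tgt v = l @ i # r \<Longrightarrow>
    ap l (Sym_b i) (i # r) (ap (l @ [i]) (Sym_u (op_ix i)) r v) =
    ap (l @ [op_ix i]) (Sym_s i) r (ap l (Sym_s (op_ix i)) r v)"
  using act_rel(4)[OF SL3_8[OF HOL.refl], of l i r v] v by (simp add: act_simps)

lemma ap_commute: "tgt v = l @ sym_dom f @ m @ sym_dom h @ r \<Longrightarrow>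
    ap l f (m @ sym_cod h @ r) (ap (l @ sym_dom f @ m) h r v) =
    ap (l @ sym_cod f @ m) h r (ap l f (m @ sym_dom h @ r) v)"
  using act_commute[of "Gen f" "Gen h" v l m r] v by simp

end

text \<open>Three letters form four patterns. Those with unequal neighbours vanish by (SL3.4), and
  three equal letters are (SL3.5). In contrast to a Temperley-Lieb algebra, a zigzag is never
  straightened to an identity.\<close>

lemma dn_up_right:
  assumes "arr v" "tgt v = l @ lo x y @ z # r"
  shows "ap (l @ [x]) (dn y z) r (ap l (up x y) (z # r) v) =
    (if x = y \<and> y = z then ap l (Sym_u x) r (ap l (Sym_c (op_ix x)) r v)
     else zero_mor C (src v) (l @ x # lo y z @ r))"
  using assms cap_split[of v l x r] merge_cup'[of v l y r] cap_cup_zigzag[of v l x r]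
    merge_split_right[of v l x r]
  by (cases x; cases y; cases z; simp add: dn_def up_def lo_def)

lemma dn_up_left:
  assumes "arr v" "tgt v = l @ x # lo y z @ r"
  shows "ap l (dn x y) (z # r) (ap (l @ [x]) (up y z) r v) =
    (if x = y \<and> y = z then ap l (Sym_u (op_ix x)) r (ap l (Sym_c x) r v)
     else zero_mor C (src v) (l @ lo x y @ z # r))"
  using assms cap_split'[of v l y r] merge_cup[of v l x r] cap_cup_zigzag'[of v l x r]
    merge_split_left[of v l x r]
  by (cases x; cases y; cases z; simp add: dn_def up_def lo_def)

end

section \<open>Normal forms\<close>

text \<open>The analysis of critical pairs for operations on two neighbouring letters. The case
  names give the position of the pair \<open>a b\<close> relative to the pair
  \<open>c d\<close>.\<close>

lemma pair_overlap_cases: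
  assumes "l @ a # b # r = l' @ c # d # r'"
  obtains (before) m where "r = m @ c # d # r'" "l' = l @ a # b # m"
  | (left) "l' = l @ [a]" "c = b" "r = d # r'"
  | (same) "l' = l" "r' = r" "c = a" "d = b"
  | (right) "l = l' @ [c]" "d = a" "r' = b # r"
  | (after) m where "l = l' @ c # d # m" "r' = m @ a # b # r"
proof -
  from assms consider (1) u where "l = l' @ u" "u @ a # b # r = c # d # r'"
    | (2) u where "l' = l @ u" "u @ c # d # r' = a # b # r"
    by (auto simp: append_eq_append_conv2)
  then show ?thesis
  proof cases
    case 1
    then show ?thesis using that by (cases u; cases "tl u") auto
  next
    case 2
    then show ?thesis using that by (cases u; cases "tl u") auto
  qed
qed

definition sorted_word :: "ix list \<Rightarrow> bool" where
  "sorted_word w \<longleftrightarrow> (\<forall>l r. w \<noteq> l @ I2 # I1 # r)"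

fun inversions :: "ix list \<Rightarrow> nat" where
  "inversions [] = 0"
| "inversions (I1 # w) = inversions w"
| "inversions (I2 # w) = inversions w + count_list w I1"

lemma inversions_swap [simp]:
  "inversions (l @ I2 # I1 # r) = Suc (inversions (l @ I1 # I2 # r))"
proof (induction l)
  case (Cons a l)
  then show ?case by (cases a) auto
qed simp

text \<open>The model is \<open>e0 = top_proj w0\<close>. Only its annihilation by every
  \<open>dn\<close> is kept, the analogue of being a highest weight vector.\<close>

locale highest_vector = sl3_category C g
  for C :: "(ix list, 'm, 'k::field) lmcat" and g +
  fixes w0 :: "ix list" and e0 :: 'm
  assumes e0_arr: "arr e0" "tgt e0 = w0"
    and w0_sorted: "sorted_word w0"
    and e0_kill: "w0 = l @ x # y # r \<Longrightarrow> ap l (dn x y) r e0 = zero_mor C (src e0) (l @ lo x y @ r)"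
begin

inductive S :: "ix list \<Rightarrow> 'm \<Rightarrow> bool" where
  S_base: "S w0 e0"
| S_zero: "S w (zero_mor C (src e0) w)"
| S_add: "S w y \<Longrightarrow> S w y' \<Longrightarrow> S w (y +\<^sub>C y')"
| S_scale: "S w y \<Longrightarrow> S w (c *\<^sub>C y)"
| S_up: "S (l @ lo x y @ r) v \<Longrightarrow> S (l @ x # y # r) (ap l (up x y) r v)"
| S_beta: "S (l @ i # op_ix i # r) v \<Longrightarrow> S (l @ op_ix i # i # r) (ap l (Sym_b i) r v)"

lemma S_arr: "S w y \<Longrightarrow> arr y \<and> src y = src e0 \<and> tgt y = w"
  by (induction rule: S.induct) (use e0_arr in auto)

lemmas S_simps = S_arr[THEN conjunct1] S_arr[THEN conjunct2, THEN conjunct1]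
  S_arr[THEN conjunct2, THEN conjunct2]

lemma S_diff: "S w y \<Longrightarrow> S w y' \<Longrightarrow> S w (y -\<^sub>C y')"
  by (intro S_add S_scale)

lemma S_beta1: "S (l @ I1 # I2 # r) v \<Longrightarrow> S (l @ I2 # I1 # r) (ap l (Sym_b I1) r v)"
  using S_beta[of l I1 r v] by simp

lemma S_beta2: "S (l @ I2 # I1 # r) v \<Longrightarrow> S (l @ I1 # I2 # r) (ap l (Sym_b I2) r v)"
  using S_beta[of l I2 r v] by simp

text \<open>Stated word by word, so that it can be assumed on all shorter words while it is proved
  on a given one.\<close>

definition closed_down :: "ix list \<Rightarrow> bool" where
  "closed_down w \<longleftrightarrow> (\<forall>l x y r v. w = l @ x # y # r \<longrightarrow> S w v \<longrightarrow> S (l @ lo x y @ r) (ap l (dn x y) r v))"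

lemma closed_downD: "closed_down (l @ x # y # r) \<Longrightarrow> S (l @ x # y # r) v \<Longrightarrow>
    S (l @ lo x y @ r) (ap l (dn x y) r v)"
  by (auto simp: closed_down_def)

lemma closed_down_merge: "closed_down (l @ i # i # r) \<Longrightarrow> S (l @ i # i # r) v \<Longrightarrow>
    S (l @ op_ix i # r) (ap l (Sym_m i) r v)"
  using closed_downD[of l i i r v] by (simp add: dn_def lo_def)

lemma closed_down_cap: "closed_down (l @ i # op_ix i # r) \<Longrightarrow> S (l @ i # op_ix i # r) v \<Longrightarrow>
    S (l @ r) (ap l (Sym_c i) r v)"
  using closed_downD[of l i "op_ix i" r v] by (simp add: dn_def lo_def)

text \<open>On sorted words, \<open>N\<close> turns out to be all of \<open>S\<close>, so that \<open>S\<close> is spanned by \<open>e\<^sub>0\<close> and by morphisms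
  whose last layer is an \<open>up\<close>.\<close>

inductive N :: "ix list \<Rightarrow> 'm \<Rightarrow> bool" where
  N_base: "N w0 e0"
| N_zero: "N w (zero_mor C (src e0) w)"
| N_add: "N w y \<Longrightarrow> N w y' \<Longrightarrow> N w (y +\<^sub>C y')"
| N_scale: "N w y \<Longrightarrow> N w (c *\<^sub>C y)"
| N_up: "S (l @ lo x y @ r) v \<Longrightarrow> N (l @ x # y # r) (ap l (up x y) r v)"

lemma N_arr: "N w y \<Longrightarrow> arr y \<and> src y = src e0 \<and> tgt y = w"
  by (induction rule: N.induct) (use e0_arr S_simps in auto)

text \<open>Sorting a word by removing inversions is confluent because distinct inversions of a word do not
  overlap; this is why all of them may be demanded at once.\<close>

inductive Z :: "ix list \<Rightarrow> 'm \<Rightarrow> bool" where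
  Z_intro: "\<lbrakk>arr y; src y = src e0; tgt y = w; sorted_word w \<Longrightarrow> N w y;
     \<And>l r. w = l @ I2 # I1 # r \<Longrightarrow> Z (l @ I1 # I2 # r) (ap l (Sym_b I2) r y)\<rbrakk> \<Longrightarrow> Z w y"

lemma Z_arr: "Z w y \<Longrightarrow> arr y \<and> src y = src e0 \<and> tgt y = w"
  by (induction rule: Z.induct) auto

lemmas Z_simps = Z_arr[THEN conjunct1] Z_arr[THEN conjunct2, THEN conjunct1]
  Z_arr[THEN conjunct2, THEN conjunct2]

lemma Z_sorted: "Z w y \<Longrightarrow> sorted_word w \<Longrightarrow> N w y"
  by (erule Z.cases) auto

lemma Z_beta2: "Z (l @ I2 # I1 # r) y \<Longrightarrow> Z (l @ I1 # I2 # r) (ap l (Sym_b I2) r y)"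
  by (erule Z.cases) auto

lemma Z_zero: "Z w (zero_mor C (src e0) w)"
proof (induction "inversions w" arbitrary: w rule: less_induct)
  case less
  show ?case
  proof (rule Z_intro)
    fix l r assume w: "w = l @ I2 # I1 # r"
    then show "Z (l @ I1 # I2 # r) (ap l (Sym_b I2) r (zero_mor C (src e0) w))"
      using less[of "l @ I1 # I2 # r"] by simp
  qed (auto intro: N_zero)
qed

lemma Z_scale: "Z w y \<Longrightarrow> Z w (c *\<^sub>C y)"
proof (induction rule: Z.induct)
  case (Z_intro y w)
  show ?case
  proof (rule Z.Z_intro)
    fix l r assume w: "w = l @ I2 # I1 # r"
    then show "Z (l @ I1 # I2 # r) (ap l (Sym_b I2) r (c *\<^sub>C y))"
      using Z_intro.IH[of l r] Z_intro.hyps by (simp add: act_scale)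
  qed (use Z_intro.hyps in \<open>auto intro: N_scale\<close>)
qed

lemma Z_add: "Z w y \<Longrightarrow> Z w y' \<Longrightarrow> Z w (y +\<^sub>C y')"
proof (induction arbitrary: y' rule: Z.induct)
  case (Z_intro y w)
  show ?case
  proof (rule Z.Z_intro)
    fix l r assume w: "w = l @ I2 # I1 # r"
    then show "Z (l @ I1 # I2 # r) (ap l (Sym_b I2) r (y +\<^sub>C y'))"
      using Z_intro.IH[of l r] Z_beta2[of l r y'] Z_simps[OF Z_intro.prems] Z_intro.hyps Z_intro.prems
      by (simp add: act_add)
  qed (use Z_intro.hyps Z_simps[OF Z_intro.prems] Z_sorted[OF Z_intro.prems] in \<open>auto intro: N_add\<close>)
qed

lemma Z_diff: "Z w y \<Longrightarrow> Z w y' \<Longrightarrow> Z w (y -\<^sub>C y')"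
  by (intro Z_add Z_scale)

text \<open>This beta creates one inversion. Removing it again gives back \<open>y\<close> by
  (SL3.1). Any other inversion of the new word is disjoint from it, since 21 does not overlap
  itself, and can be removed before the beta, where induction applies.\<close>

lemma Z_beta1: "Z w y \<Longrightarrow> w = l @ I1 # I2 # r \<Longrightarrow> Z (l @ I2 # I1 # r) (ap l (Sym_b I1) r y)"
proof (induction arbitrary: l r rule: Z.induct)
  case (Z_intro y w)
  have Zy: "Z w y"
    by (rule Z.Z_intro) (use Z_intro.hyps in blast)+
  note y = Z_simps[OF Zy] Z_intro.prems
  show ?case
  proof (rule Z.Z_intro)
    show "sorted_word (l @ I2 # I1 # r) \<Longrightarrow> N (l @ I2 # I1 # r) (ap l (Sym_b I1) r y)"
      by (auto simp: sorted_word_def)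
  next
    fix l' r' assume "l @ I2 # I1 # r = l' @ I2 # I1 # r'"
    then show "Z (l' @ I1 # I2 # r') (ap l' (Sym_b I2) r' (ap l (Sym_b I1) r y))"
    proof (cases rule: pair_overlap_cases)
      case (before m)
      have "ap l (Sym_b I1) (m @ I1 # I2 # r') (ap (l @ I1 # I2 # m) (Sym_b I2) r' y) =
        ap l' (Sym_b I2) r' (ap l (Sym_b I1) r y)"
        using ap_commute[of y l "Sym_b I1" m "Sym_b I2" r'] y before by simp
      then show ?thesis
        using Z_intro.IH[of "l @ I1 # I2 # m" r' l "m @ I1 # I2 # r'"] y before by simp
    next
      case (after m)
      have "ap l' (Sym_b I2) (m @ I2 # I1 # r) (ap (l' @ I2 # I1 # m) (Sym_b I1) r y) =
        ap (l' @ I1 # I2 # m) (Sym_b I1) r (ap l' (Sym_b I2) (m @ I1 # I2 # r) y)"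
        using ap_commute[of y l' "Sym_b I2" m "Sym_b I1" r] y after by simp
      then show ?thesis
        using Z_intro.IH[of l' "m @ I1 # I2 # r" "l' @ I1 # I2 # m" r] y after by simp
    next
      case same
      then show ?thesis using beta_beta[of y l I1 r] y Zy by simp
    qed auto
  qed (use y in auto)
qed

text \<open>An \<open>up\<close> followed by the removal of an inversion has to become a combination
  of terms that end in an \<open>up\<close> again, on words with fewer inversions. Disjoint layers
  commute, and a cup on the inverted pair absorbs the beta. Overlaps need (SL3.7) and (SL3.8); the
  corrections in (SL3.7) contain an \<open>m\<close> on a shorter word, which is where the closure
  hypothesis enters.\<close>

lemma Z_up:
  assumes "\<And>w'. length w' < length (l @ x # y # r) \<Longrightarrow> closed_down w'"
    and "S (l @ lo x y @ r) v"
  shows "Z (l @ x # y # r) (ap l (up x y) r v)"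
  using assms
proof (induction "inversions (l @ x # y # r)" arbitrary: l x y r v rule: less_induct)
  case less
  note cd = less.prems(1) and Sv = less.prems(2)
  note v = S_simps[OF Sv]
  have IH: "Z (l' @ x' # y' # r') (ap l' (up x' y') r' v')"
    if "inversions (l' @ x' # y' # r') < inversions (l @ x # y # r)"
      "S (l' @ lo x' y' @ r') v'" "length (l' @ x' # y' # r') = length (l @ x # y # r)" for l' x' y' r' v'
    using less.hyps[OF that(1)] cd that by simp
  show ?case
  proof (rule Z_intro)
    fix a b assume "l @ x # y # r = a @ I2 # I1 # b"
    then show "Z (a @ I1 # I2 # b) (ap a (Sym_b I2) b (ap l (up x y) r v))"
    proof (cases rule: pair_overlap_cases)
      case (before m)
      have "ap l (up x y) (m @ I1 # I2 # b) (ap (l @ lo x y @ m) (Sym_b I2) b v) =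
          ap a (Sym_b I2) b (ap l (up x y) r v)"
        using ap_commute[of v l "up x y" m "Sym_b I2" b] v before by simp
      moreover have "S (l @ lo x y @ m @ I1 # I2 # b) (ap (l @ lo x y @ m) (Sym_b I2) b v)"
        using S_beta2[of "l @ lo x y @ m" b v] Sv before by simp
      ultimately show ?thesis
        using IH[of l x y "m @ I1 # I2 # b" "ap (l @ lo x y @ m) (Sym_b I2) b v"] before
          inversions_swap[of "l @ x # y # m" b] by simp
    next
      case left
      show ?thesis
      proof (cases x)
        case I1
        \<comment> \<open>By the reflected (SL3.8) the cup followed by the beta is a double split,
          whose last layer is an \<open>up\<close> on 1 1.\<close>
        have "S (l @ I2 # I2 # b) (ap l (Sym_s I2) b v)"
          using S_up[of l I2 I2 b v] Sv left I1 by (simp add: lo_def up_def)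
        then show ?thesis
          using IH[of l I1 I1 "I2 # b" "ap l (Sym_s I2) b v"] cup_far[of v l I1 b] v left I1
          by (simp add: up_def lo_def inversions_swap[of "l @ [I1]", simplified])
      next
        case I2
        \<comment> \<open>Removing the inversion of 2 2 1 gives \<open>?y\<close> on 2 1 2, but the
          reflected (SL3.7) describes only its further image on 1 2 2. That image is shown to lie in
          \<open>Z\<close> and is carried back to \<open>?y\<close> with
          \<open>Z_beta1\<close>.\<close>
        let ?y = "ap (l @ [I2]) (Sym_b I2) b (ap l (Sym_s I2) (I1 # b) v)"
        let ?m = "ap l (Sym_m I1) b v"
        have Sv': "S (l @ I1 # I1 # b) v"
          using Sv left I2 by (simp add: lo_def)
        have Sm: "S (l @ I2 # b) ?m"
          using closed_down_merge[of l I1 b v] cd[of "l @ I1 # I1 # b"] Sv' left by simp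
        have inv: "inversions (l @ I1 # I2 # I2 # b) < inversions (l @ x # y # r)"
          using inversions_swap[of "l @ [I2]" b] left I2 by simp
        have "Z (l @ I1 # I2 # I2 # b) (ap (l @ [I1]) (Sym_s I2) b v)"
          using IH[of "l @ [I1]" I2 I2 b v] Sv' inv left by (simp add: up_def lo_def)
        moreover have "Z (l @ I1 # I2 # I2 # b) (ap l (Sym_u I1) (I2 # b) ?m)"
          using IH[of l I1 I2 "I2 # b" ?m] Sm inv left by (simp add: up_def lo_def)
        moreover have "Z (l @ I1 # I2 # I2 # b) (ap (l @ [I1]) (Sym_s I2) b (ap l (Sym_s I1) b ?m))"
          using IH[of "l @ [I1]" I2 I2 b "ap l (Sym_s I1) b ?m"] S_up[of l I1 I1 b ?m] Sm inv left
          by (simp add: up_def lo_def)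
        ultimately have "Z (l @ I1 # I2 # I2 # b) (ap l (Sym_b I2) (I2 # b) ?y)"
          using beta_beta_split'[of v l I2 b] S_simps[OF Sv'] by (simp add: Z_add Z_diff)
        then have "Z (l @ I2 # I1 # I2 # b) (ap l (Sym_b I1) (I2 # b) (ap l (Sym_b I2) (I2 # b) ?y))"
          by (rule Z_beta1) simp
        then have "Z (l @ I2 # I1 # I2 # b) ?y"
          using beta_beta[of ?y l I2 "I2 # b"] S_simps[OF Sv'] by simp
        then show ?thesis
          using left I2 by (simp add: up_def)
      qed
    next
      case same
      then show ?thesis
        using IH[of l I1 I2 r v] Sv v beta_cup[of v l r I2] by (simp add: up_def lo_def)
    next
      case right
      show ?thesis
      proof (cases y)
        case I2
        have "S (a @ I1 # I1 # r) (ap a (Sym_s I1) r v)"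
          using S_up[of a I1 I1 r v] Sv right I2 by (simp add: lo_def up_def)
        then show ?thesis
          using IH[of "a @ [I1]" I2 I2 r "ap a (Sym_s I1) r v"] cup_far'[of v a I2 r] v right I2
          by (simp add: up_def lo_def)
      next
        case I1
        \<comment> \<open>The mirror image: 2 1 1 gives \<open>?y\<close> on 1 2 1, and the
          reflected (SL3.7) describes its further image on 1 1 2.\<close>
        let ?y = "ap a (Sym_b I2) (I1 # r) (ap (a @ [I2]) (Sym_s I1) r v)"
        let ?m = "ap a (Sym_m I2) r v"
        have Sv': "S (a @ I2 # I2 # r) v"
          using Sv right I1 by (simp add: lo_def)
        have Sm: "S (a @ I1 # r) ?m"
          using closed_down_merge[of a I2 r v] cd[of "a @ I2 # I2 # r"] Sv' right by simp
        have inv: "inversions (a @ I1 # I1 # I2 # r) < inversions (l @ x # y # r)"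
          using inversions_swap[of "a @ [I1]" r] right I1 by simp
        have "Z (a @ I1 # I1 # I2 # r) (ap a (Sym_s I1) (I2 # r) v)"
          using IH[of a I1 I1 "I2 # r" v] Sv' inv right by (simp add: up_def lo_def)
        moreover have "Z (a @ I1 # I1 # I2 # r) (ap (a @ [I1]) (Sym_u I1) r ?m)"
          using IH[of "a @ [I1]" I1 I2 r ?m] Sm inv right by (simp add: up_def lo_def)
        moreover have "Z (a @ I1 # I1 # I2 # r) (ap a (Sym_s I1) (I2 # r) (ap a (Sym_s I2) r ?m))"
          using IH[of a I1 I1 "I2 # r" "ap a (Sym_s I2) r ?m"] S_up[of a I2 I2 r ?m] Sm inv right
          by (simp add: up_def lo_def)
        ultimately have "Z (a @ I1 # I1 # I2 # r) (ap (a @ [I1]) (Sym_b I2) r ?y)"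
          using beta_beta_split[of v a I1 r] S_simps[OF Sv'] by (simp add: Z_add Z_diff)
        then have "Z ((a @ [I1]) @ I2 # I1 # r)
            (ap (a @ [I1]) (Sym_b I1) r (ap (a @ [I1]) (Sym_b I2) r ?y))"
          by (rule Z_beta1) simp
        then have "Z (a @ I1 # I2 # I1 # r) ?y"
          using beta_beta[of ?y "a @ [I1]" I2 r] S_simps[OF Sv'] by simp
        then show ?thesis
          using right I1 by (simp add: up_def)
      qed
    next
      case (after m)
      have "ap a (Sym_b I2) (m @ x # y # r) (ap (a @ I2 # I1 # m) (up x y) r v) =
          ap (a @ I1 # I2 # m) (up x y) r (ap a (Sym_b I2) (m @ lo x y @ r) v)"
        using ap_commute[of v a "Sym_b I2" m "up x y" r] v after by simp
      moreover have "S (a @ I1 # I2 # m @ lo x y @ r) (ap a (Sym_b I2) (m @ lo x y @ r) v)"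
        using S_beta2[of a "m @ lo x y @ r" v] Sv after by simp
      ultimately show ?thesis
        using IH[of "a @ I1 # I2 # m" x y r "ap a (Sym_b I2) (m @ lo x y @ r) v"] after
          inversions_swap[of a "m @ x # y # r"] by simp
    qed
  qed (use v Sv in \<open>auto intro: N_up\<close>)
qed

text \<open>Every way of building \<open>S\<close> preserves \<open>Z\<close>. Hence removing all
  inversions from an element of \<open>S\<close>, in any order, ends in \<open>N\<close>.\<close>

lemma S_imp_Z:
  "S w y \<Longrightarrow> (\<And>w'. length w' < length w \<Longrightarrow> closed_down w') \<Longrightarrow> Z w y"
proof (induction rule: S.induct)
  case S_base
  show ?case
  proof (rule Z_intro)
    fix l r assume "w0 = l @ I2 # I1 # r"
    then show "Z (l @ I1 # I2 # r) (ap l (Sym_b I2) r e0)"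
      using w0_sorted unfolding sorted_word_def by blast
  qed (simp_all add: e0_arr N_base)
next
  case (S_beta l i r v)
  show ?case
  proof (cases i)
    case I1
    then show ?thesis using Z_beta1[of "l @ I1 # I2 # r" v l r] S_beta by simp
  next
    case I2
    then show ?thesis using Z_beta2[of l r v] S_beta by simp
  qed
next
  case (S_up l x y r v)
  then show ?case by (intro Z_up) auto
qed (blast intro: Z_zero Z_add Z_scale)+

text \<open>The generator \<open>e0\<close> is annihilated, so the point is a \<open>dn\<close> that
  meets a last layer \<open>up\<close>. If disjoint from it, the \<open>dn\<close> slides inside to
  a shorter word, where closure is assumed. If it overlaps in one letter, the result is 0 or a cup
  after a cap, the cap again acting on a shorter word. On the same two letters the layers
  cancel.\<close>

lemma N_down:
  assumes "N w v" "\<And>w'. length w' < length w \<Longrightarrow> closed_down w'" "w = l @ x # y # r"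
  shows "S (l @ lo x y @ r) (ap l (dn x y) r v)"
  using assms
proof (induction arbitrary: l x y r rule: N.induct)
  case N_base
  then show ?case using e0_kill S_zero by simp
next
  case (N_zero w)
  then show ?case using S_zero by simp
next
  case (N_add w v v')
  then show ?case
    using N_arr[OF N_add.hyps(1)] N_arr[OF N_add.hyps(2)] by (simp add: act_add S_add)
next
  case (N_scale w v c)
  then show ?case
    using N_arr[OF N_scale.hyps(1)] by (simp add: act_scale S_scale)
next
  case (N_up a p q b v)
  note v = S_simps[OF N_up.hyps(1)] and Sv = N_up.hyps(1)
  note cd = N_up.prems(1)
  show ?case
    using N_up.prems(2)
  proof (cases rule: pair_overlap_cases)
    case (before m)
    have "ap a (up p q) (m @ lo x y @ r) (ap (a @ lo p q @ m) (dn x y) r v) =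
        ap l (dn x y) r (ap a (up p q) b v)"
      using ap_commute[of v a "up p q" m "dn x y" r] v before by simp
    moreover have "S (a @ lo p q @ m @ lo x y @ r) (ap (a @ lo p q @ m) (dn x y) r v)"
      using closed_downD[of "a @ lo p q @ m" x y r v] Sv before
        cd[of "a @ lo p q @ m @ x # y # r"] by (simp add: lo_def)
    ultimately show ?thesis
      using S_up[of a p q "m @ lo x y @ r" "ap (a @ lo p q @ m) (dn x y) r v"] before by simp
  next
    case left
    have "S (a @ p # lo q y @ r) (ap (a @ [p]) (dn q y) r (ap a (up p q) (y # r) v))"
    proof (cases "p = q \<and> q = y")
      case True
      have "S (a @ r) (ap a (Sym_c (op_ix p)) r v)"
        using closed_down_cap[of a "op_ix p" r v] cd[of "a @ op_ix p # p # r"] Sv left True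
        by (simp add: lo_def)
      then show ?thesis
        using S_up[of a p "op_ix p" r] v left True dn_up_right[of v a p q y r]
        by (simp add: up_def lo_def)
    next
      case False
      then show ?thesis using dn_up_right[of v a p q y r] v left S_zero by auto
    qed
    then show ?thesis using left by simp
  next
    case same
    then show ?thesis using dn_up[of v a p q b] v Sv by simp
  next
    case right
    have "S (l @ lo x p @ q # b) (ap l (dn x p) (q # b) (ap (l @ [x]) (up p q) b v))"
    proof (cases "x = p \<and> p = q")
      case True
      have "S (l @ b) (ap l (Sym_c x) b v)"
        using closed_down_cap[of l x b v] cd[of "l @ x # op_ix x # b"] Sv right True
        by (simp add: lo_def)
      then show ?thesis
        using S_up[of l "op_ix x" x b] v right True dn_up_left[of v l x p q b]
        by (simp add: up_def lo_def)
    next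
      case False
      then show ?thesis using dn_up_left[of v l x p q b] v right S_zero by auto
    qed
    then show ?thesis using right by simp
  next
    case (after m)
    have "ap l (dn x y) (m @ p # q # b) (ap (l @ x # y # m) (up p q) b v) =
        ap (l @ lo x y @ m) (up p q) b (ap l (dn x y) (m @ lo p q @ b) v)"
      using ap_commute[of v l "dn x y" m "up p q" b] v after by simp
    moreover have "S (l @ lo x y @ m @ lo p q @ b) (ap l (dn x y) (m @ lo p q @ b) v)"
      using closed_downD[of l x y "m @ lo p q @ b" v] Sv after
        cd[of "l @ x # y # m @ lo p q @ b"] by (simp add: lo_def)
    ultimately show ?thesis
      using S_up[of "l @ lo x y @ m" p q b "ap l (dn x y) (m @ lo p q @ b) v"] after by simp
  qed
qed

text \<open>On an unsorted word \<open>v\<close> is a beta after some \<open>z\<close> on a word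
  with fewer inversions, and the \<open>dn\<close> is moved past this beta by commutation, (SL3.0),
  (SL3.7) or (SL3.8), according to the overlap. Every \<open>dn\<close> that results acts on a word
  with fewer inversions or on a shorter word.\<close>

lemma Z_down:
  assumes "Z w v" "\<And>w'. length w' < length w \<Longrightarrow> closed_down w'" "w = l @ x # y # r"
  shows "S (l @ lo x y @ r) (ap l (dn x y) r v)"
  using assms
proof (induction "inversions w" arbitrary: w l x y r v rule: less_induct)
  case less
  note Zv = less.prems(1) and cd = less.prems(2)
  note v = Z_simps[OF Zv] less.prems(3)
  have IH: "S (l' @ lo x' y' @ r') (ap l' (dn x' y') r' v')"
    if "inversions (l' @ x' # y' # r') < inversions w"
      "Z (l' @ x' # y' # r') v'" "length (l' @ x' # y' # r') = length w" for l' x' y' r' v'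
    using less.hyps[OF that(1,2) _ HOL.refl] cd that(3) by simp
  have IH_merge: "S (l' @ op_ix i # r') (ap l' (Sym_m i) r' v')"
    if "inversions (l' @ i # i # r') < inversions w"
      "Z (l' @ i # i # r') v'" "length (l' @ i # i # r') = length w" for l' i r' v'
    using IH[OF that] by (simp add: dn_def lo_def)
  have IH_cap: "S (l' @ r') (ap l' (Sym_c i) r' v')"
    if "inversions (l' @ i # op_ix i # r') < inversions w"
      "Z (l' @ i # op_ix i # r') v'" "length (l' @ i # op_ix i # r') = length w" for l' i r' v'
    using IH[OF that] by (simp add: dn_def lo_def)
  show ?case
  proof (cases "sorted_word w")
    case True
    then show ?thesis using N_down Z_sorted less.prems by blast
  next
    case False
    then obtain a b where w: "w = a @ I2 # I1 # b"
      by (auto simp: sorted_word_def)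
    define z where "z = ap a (Sym_b I2) b v"
    have Zz: "Z (a @ I1 # I2 # b) z"
      using Z_beta2 Zv w z_def by simp
    note z = Z_simps[OF Zz]
    have vz: "v = ap a (Sym_b I1) b z"
      using beta_beta[of v a I2 b] v w z_def by simp
    have inv: "inversions (a @ I1 # I2 # b) < inversions w"
      using w by simp
    have "l @ x # y # r = a @ I2 # I1 # b" using w v by simp
    then show ?thesis
    proof (cases rule: pair_overlap_cases)
      case (before m)
      have "ap l (dn x y) (m @ I2 # I1 # b) (ap (l @ x # y # m) (Sym_b I1) b z) =
          ap (l @ lo x y @ m) (Sym_b I1) b (ap l (dn x y) (m @ I1 # I2 # b) z)"
        using ap_commute[of z l "dn x y" m "Sym_b I1" b] z before by simp
      then show ?thesis
        using S_beta1[of "l @ lo x y @ m" b "ap l (dn x y) (m @ I1 # I2 # b) z"] IH[of l x y "m @ I1 # I2 # b" z] Zz inv before w vz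
        by simp
    next
      case (after m)
      have "ap a (Sym_b I1) (m @ lo x y @ r) (ap (a @ I1 # I2 # m) (dn x y) r z) =
          ap (a @ I2 # I1 # m) (dn x y) r (ap a (Sym_b I1) (m @ x # y # r) z)"
        using ap_commute[of z a "Sym_b I1" m "dn x y" r] z after by simp
      then show ?thesis
        using S_beta1[of a "m @ lo x y @ r" "ap (a @ I1 # I2 # m) (dn x y) r z"] IH[of "a @ I1 # I2 # m" x y r z] Zz inv after w vz
        by simp
    next
      case same
      have "ap l (Sym_c I2) r v = ap l (Sym_c I1) r z"
        using cap_beta[of v l I1 r] v same z_def by simp
      then show ?thesis
        using IH_cap[of a I1 b z] Zz inv same w by (simp add: dn_def lo_def)
    next
      case right
      show ?thesis
      proof (cases y)
        case I1
        \<comment> \<open>To apply \<open>m\<close> to the last two letters of 2 1 1, two betas are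
          undone: (SL3.7) expresses \<open>m\<close> after both of them by layers acting on 1 1
          2.\<close>
        define z' where "z' = ap (a @ [I1]) (Sym_b I2) r z"
        have Zz': "Z (a @ I1 # I1 # I2 # r) z'"
          using Z_beta2[of "a @ [I1]" r z] Zz right I1 z'_def by simp
        have inv': "inversions (a @ I1 # I1 # I2 # r) < inversions w"
          using inversions_swap[of "a @ [I1]" r] inv right I1 by simp
        have zz': "z = ap (a @ [I1]) (Sym_b I1) r z'"
          using beta_beta[of z "a @ [I1]" I2 r] z right I1 z'_def by simp
        let ?m = "ap a (Sym_m I1) (I2 # r) z'"
        have Sm: "S (a @ I2 # I2 # r) ?m"
          using IH_merge[of a I1 "I2 # r" z'] Zz' inv' w right by simp
        have "S (a @ I2 # I2 # r) (ap a (Sym_s I2) r (ap (a @ [I1]) (Sym_c I1) r z'))"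
          using S_up[of a I2 I2 r] IH_cap[of "a @ [I1]" I1 r z'] Zz' inv' w right
          by (simp add: up_def lo_def)
        moreover have "S (a @ I2 # I2 # r) (ap a (Sym_s I2) r (ap a (Sym_m I2) r ?m))"
          using S_up[of a I2 I2 r] closed_down_merge[of a I2 r ?m] cd[of "a @ I2 # I2 # r"] Sm w right
          by (simp add: up_def lo_def)
        ultimately have "S (a @ I2 # I2 # r) (ap (a @ [I2]) (Sym_m I1) r v)"
          using Sm merge_beta_beta[of z' a I1 r] Z_simps[OF Zz'] vz zz' right I1
          by (simp add: S_add S_diff)
        then show ?thesis
          using right I1 by (simp add: dn_def lo_def)
      next
        case I2
        \<comment> \<open>Here a single beta suffices: by (SL3.8) the cap after it is a double
          merge, the first one on a word with fewer inversions and the second one on a shorter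
          word.\<close>
        have "S (a @ I1 # I1 # r) (ap (a @ [I1]) (Sym_m I2) r z)"
          using IH_merge[of "a @ [I1]" I2 r z] Zz inv right I2 w by simp
        then have "S (a @ I2 # r) (ap a (Sym_m I1) r (ap (a @ [I1]) (Sym_m I2) r z))"
          using closed_down_merge[of a I1 r] cd[of "a @ I1 # I1 # r"] w right by simp
        then show ?thesis
          using cap_far'[of z a I2 r] z vz right I2 by (simp add: dn_def lo_def)
      qed
    next
      case left
      show ?thesis
      proof (cases x)
        case I2
        define z' where "z' = ap l (Sym_b I2) (I2 # b) z"
        have Zz': "Z (l @ I1 # I2 # I2 # b) z'"
          using Z_beta2[of l "I2 # b" z] Zz left I2 z'_def by simp
        have inv': "inversions (l @ I1 # I2 # I2 # b) < inversions w"
          using inversions_swap[of l "I2 # b"] inv left I2 by simp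
        have zz': "z = ap l (Sym_b I1) (I2 # b) z'"
          using beta_beta[of z l I2 "I2 # b"] z left I2 z'_def by simp
        let ?m = "ap (l @ [I1]) (Sym_m I2) b z'"
        have Sm: "S (l @ I1 # I1 # b) ?m"
          using IH_merge[of "l @ [I1]" I2 b z'] Zz' inv' w left by simp
        have "S (l @ I1 # I1 # b) (ap l (Sym_s I1) b (ap l (Sym_c I1) (I2 # b) z'))"
          using S_up[of l I1 I1 b] IH_cap[of l I1 "I2 # b" z'] Zz' inv' w left
          by (simp add: up_def lo_def)
        moreover have "S (l @ I1 # I1 # b) (ap l (Sym_s I1) b (ap l (Sym_m I1) b ?m))"
          using S_up[of l I1 I1 b] closed_down_merge[of l I1 b ?m] cd[of "l @ I1 # I1 # b"] Sm w left
          by (simp add: up_def lo_def)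
        ultimately have "S (l @ I1 # I1 # b) (ap l (Sym_m I2) (I1 # b) v)"
          using Sm merge_beta_beta'[of z' l I2 b] Z_simps[OF Zz'] vz zz' left I2
          by (simp add: S_add S_diff)
        then show ?thesis
          using left I2 by (simp add: dn_def lo_def)
      next
        case I1
        have "S (l @ I2 # I2 # b) (ap l (Sym_m I1) (I2 # b) z)"
          using IH_merge[of l I1 "I2 # b" z] Zz inv left I1 w by simp
        then have "S (l @ I1 # b) (ap l (Sym_m I2) b (ap l (Sym_m I1) (I2 # b) z))"
          using closed_down_merge[of l I2 b] cd[of "l @ I2 # I2 # b"] w left by simp
        then show ?thesis
          using cap_far[of z l I1 b] z vz left I1 by (simp add: dn_def lo_def)
      qed
    qed
  qed
qed

text \<open>The circle closes by induction on the length: closure on shorter words puts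
  \<open>S\<close> inside \<open>Z\<close>, and every \<open>dn\<close> carries \<open>Z\<close>
  into \<open>S\<close>.\<close>

theorem S_closed_down: "closed_down w"
proof (induction "length w" arbitrary: w rule: less_induct)
  case less
  show ?case
    unfolding closed_down_def using Z_down S_imp_Z less by blast
qed

end

lemma (in word_moncat) diff_add:
  assumes "parallel f g" shows "f -\<^sub>C g +\<^sub>C g = f"
  using assms a_assoc[of f "(-1) *\<^sub>C g" g] a_commute[of "(-1) *\<^sub>C g" g] by simp

section \<open>The projections onto the top components\<close>

context sl3_category
begin

abbreviation Q :: "ix list \<Rightarrow> ix \<Rightarrow> ix \<Rightarrow> ix list \<Rightarrow> 'm \<Rightarrow> 'm" where
  "Q l x y r v \<equiv> ap l (up x y) r (ap l (dn x y) r v)"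

text \<open>The two orders of the product of the \<open>1 - Q\<^sub>k\<close>: with the first it is easy to see that \<open>dn\<close> kills the
  product on the left, with the second that \<open>up\<close> kills it on the right. Using both avoids showing
  that the \<open>Q\<^sub>k\<close> commute.\<close>

fun kill_dn :: "ix list \<Rightarrow> ix list \<Rightarrow> 'm \<Rightarrow> 'm" where
  "kill_dn l (x # y # u) v = (let v' = kill_dn (l @ [x]) (y # u) v in v' -\<^sub>C Q l x y u v')"
| "kill_dn l u v = v"

fun kill_up :: "ix list \<Rightarrow> ix list \<Rightarrow> 'm \<Rightarrow> 'm" where
  "kill_up l (x # y # u) v = kill_up (l @ [x]) (y # u) (v -\<^sub>C Q l x y u v)"
| "kill_up l u v = v"

lemma kill_dn_arr:
  "\<lbrakk>arr v; tgt v = l @ u\<rbrakk> \<Longrightarrow>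
    arr (kill_dn l u v) \<and> src (kill_dn l u v) = src v \<and> tgt (kill_dn l u v) = l @ u"
  by (induction l u v rule: kill_dn.induct) (auto simp: Let_def)

lemma kill_up_arr:
  "\<lbrakk>arr v; tgt v = l @ u\<rbrakk> \<Longrightarrow>
    arr (kill_up l u v) \<and> src (kill_up l u v) = src v \<and> tgt (kill_up l u v) = l @ u"
  by (induction l u v rule: kill_up.induct) auto

lemma kill_dn_comp_right:
  "\<lbrakk>arr v; tgt v = l @ u; arr f; tgt f = src v\<rbrakk> \<Longrightarrow> kill_dn l u v \<cdot> f = kill_dn l u (v \<cdot> f)"
  by (induction l u v rule: kill_dn.induct)
    (auto simp: Let_def kill_dn_arr c_add_left c_scale_left act_comp_right)

lemma kill_up_comp_right:
  "\<lbrakk>arr v; tgt v = l @ u; arr f; tgt f = src v\<rbrakk> \<Longrightarrow> kill_up l u v \<cdot> f = kill_up l u (v \<cdot> f)"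
  by (induction l u v rule: kill_up.induct)
    (auto simp: kill_up_arr c_add_left c_scale_left act_comp_right)

lemma act_diff:
  assumes "tm_wf sym_dom sym_cod t" "arr y" "tgt y = l @ tm_dom sym_dom t @ r" "arr y'" "src y' = src y"
    "tgt y' = tgt y"
  shows "act l t r (y -\<^sub>C y') = act l t r y -\<^sub>C act l t r y'"
  using assms by (simp add: act_add act_scale)

lemma kill_dn_fixed:
  assumes "arr v" "tgt v = l @ u"
    "\<And>a x y b. u = a @ x # y # b \<Longrightarrow> ap (l @ a) (dn x y) b v = zero_mor C (src v) (l @ a @ lo x y @ b)"
  shows "kill_dn l u v = v"
  using assms
proof (induction l u v rule: kill_dn.induct)
  case (1 l x y u v)
  have "kill_dn (l @ [x]) (y # u) v = v"
    using "1.prems" "1.prems"(3)[of "x # _"] by (intro "1.IH") auto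
  then show ?case
    using "1.prems"(1,2) "1.prems"(3)[of "[]" x y u] by (simp add: Let_def)
qed auto

lemma kill_up_fixed:
  assumes "arr v" "tgt v = l @ u"
    "\<And>a x y b. u = a @ x # y # b \<Longrightarrow> ap (l @ a) (dn x y) b v = zero_mor C (src v) (l @ a @ lo x y @ b)"
  shows "kill_up l u v = v"
  using assms
proof (induction l u v rule: kill_up.induct)
  case (1 l x y u v)
  have "v -\<^sub>C Q l x y u v = v"
    using "1.prems"(1,2) "1.prems"(3)[of "[]" x y u] by simp
  moreover have "kill_up (l @ [x]) (y # u) v = v"
    using "1.prems" "1.prems"(3)[of "x # _"] "1.IH" calculation by simp
  ultimately show ?case by simp
qed auto

text \<open>If all three letters agree, \<open>dn\<close> after \<open>Q\<close> is a cup after a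
  cap after a merge, and (SL3.6) moves the merge to the two letters where \<open>v\<close> is
  annihilated. Otherwise \<open>dn\<close> after \<open>up\<close> vanishes already.\<close>

lemma dn_Q_adjacent:
  assumes "arr v" "tgt v = l @ x # y # z # r"
    "ap (l @ [x]) (dn y z) r v = zero_mor C (src v) (l @ x # lo y z @ r)"
  shows "ap (l @ [x]) (dn y z) r (Q l x y (z # r) v) = zero_mor C (src v) (l @ x # lo y z @ r)"
proof (cases "x = y \<and> y = z")
  case True
  then have "ap l (Sym_c (op_ix x)) r (ap l (Sym_m x) (x # r) v) = zero_mor C (src v) (l @ r)"
    using cap_merge[of v l x r] assms by (simp add: dn_def lo_def)
  then show ?thesis
    using dn_up_right[of "ap l (dn x y) (z # r) v" l x y z r] assms True
    by (simp add: dn_def lo_def)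
next
  case False
  then show ?thesis
    using dn_up_right[of "ap l (dn x y) (z # r) v" l x y z r] assms by auto
qed

text \<open>The factor applied last belongs to the first pair of letters. It is annihilated by the
  \<open>dn\<close> of that pair, and it preserves the annihilation by the later ones, which is
  known by induction.\<close>

lemma dn_kill_dn:
  assumes "arr v" "tgt v = l @ u" "u = a @ x # y # b"
  shows "ap (l @ a) (dn x y) b (kill_dn l u v) = zero_mor C (src v) (l @ a @ lo x y @ b)"
  using assms
proof (induction l u v arbitrary: a rule: kill_dn.induct)
  case (1 l p q u v)
  define v' where "v' = kill_dn (l @ [p]) (q # u) v"
  have v': "arr v'" "src v' = src v" "tgt v' = l @ p # q # u"
    using kill_dn_arr[of v "l @ [p]" "q # u"] 1 v'_def by auto
  have k: "kill_dn l (p # q # u) v = v' -\<^sub>C Q l p q u v'"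
    by (simp add: v'_def Let_def)
  show ?case
  proof (cases a)
    case Nil
    then have "p = x" "q = y" "u = b" using 1 by auto
    then show ?thesis
      using v' Nil k dn_up[of "ap l (dn p q) u v'" l p q u] by (simp add: act_diff del: kill_dn.simps)
  next
    case (Cons p' a')
    have a: "a = p # a'" "q # u = a' @ x # y # b" using 1 Cons by auto
    have 0: "ap (l @ a) (dn x y) b v' = zero_mor C (src v) (l @ a @ lo x y @ b)"
      using "1.IH"[of a'] 1 a by (simp add: v'_def)
    have "ap (l @ a) (dn x y) b (Q l p q u v') = zero_mor C (src v) (l @ a @ lo x y @ b)"
    proof (cases a')
      case Nil
      then show ?thesis using dn_Q_adjacent[of v' l p q y b] v' 0 a by auto
    next
      case (Cons q' m)
      then have m: "a = p # q # m" "u = m @ x # y # b" using a by auto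
      have "ap (l @ a) (dn x y) b (Q l p q u v') =
          ap l (up p q) (m @ lo x y @ b) (ap (l @ lo p q @ m) (dn x y) b (ap l (dn p q) u v'))"
        using ap_commute[of "ap l (dn p q) u v'" l "up p q" m "dn x y" b] v' m by simp
      also have "ap (l @ lo p q @ m) (dn x y) b (ap l (dn p q) u v') =
          ap l (dn p q) (m @ lo x y @ b) (ap (l @ a) (dn x y) b v')"
        using ap_commute[of v' l "dn p q" m "dn x y" b] v' m by simp
      finally show ?thesis using 0 m by simp
    qed
    then show ?thesis
      unfolding k using 0 v' a by (simp add: act_diff)
  qed
qed auto

text \<open>Consequently \<open>1 - Q\<close> maps the image of the neighbouring \<open>up\<close>
  into itself. For equal letters the reflected (SL3.6) moves the split of a cup from one strand to
  the other.\<close>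

lemma Q_up_adjacent:
  assumes "arr v" "tgt v = l @ x # lo y z @ r"
  obtains v' where "arr v'" "src v' = src v" "tgt v' = tgt v"
    "Q l x y (z # r) (ap (l @ [x]) (up y z) r v) = ap (l @ [x]) (up y z) r v'"
proof (cases "x = y \<and> y = z")
  case True
  show ?thesis
  proof (rule that)
    show "Q l x y (z # r) (ap (l @ [x]) (up y z) r v) =
        ap (l @ [x]) (up y z) r (ap l (Sym_u x) r (ap l (Sym_c x) r v))"
      using dn_up_left[of v l x y z r] split_cup[of "ap l (Sym_c x) r v" l r x] assms True
      by (simp add: up_def lo_def)
  qed (use assms True in \<open>simp_all add: lo_def\<close>)
next
  case False
  show ?thesis
  proof (rule that)
    show "Q l x y (z # r) (ap (l @ [x]) (up y z) r v) =
        ap (l @ [x]) (up y z) r (zero_mor C (src v) (l @ x # lo y z @ r))"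
      using dn_up_left[of v l x y z r] assms False by auto
  qed (use assms in simp_all)
qed

lemma kill_up_zero: "b = l @ u \<Longrightarrow> kill_up l u (zero_mor C a b) = zero_mor C a b"
  by (induction l u "zero_mor C a b" rule: kill_up.induct) auto

text \<open>The factors applied before that of the pair \<open>x y\<close> keep the morphism in the
  image of \<open>up x y\<close>; that factor then sends it to 0.\<close>

lemma kill_up_up:
  assumes "arr v" "tgt v = l @ a @ lo x y @ b" "u = a @ x # y # b"
  shows "kill_up l u (ap (l @ a) (up x y) b v) = zero_mor C (src v) (l @ u)"
  using assms
proof (induction u arbitrary: l a v)
  case (Cons p u)
  show ?case
  proof (cases a)
    case Nil
    then show ?thesis
      using Cons dn_up[of v l x y b] by (simp add: kill_up_zero)
  next
    case (Cons p' a')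
    have a: "a = p # a'" "u = a' @ x # y # b" using Cons.prems Cons by auto
    then obtain q u' where u: "u = q # u'" by (cases a') auto
    have "\<exists>v'. arr v' \<and> src v' = src v \<and> tgt v' = tgt v \<and>
        Q l p q u' (ap (l @ a) (up x y) b v) = ap (l @ a) (up x y) b v'"
    proof (cases a')
      case Nil
      then show ?thesis
        using Q_up_adjacent[of v l p x y b] Cons.prems a u by auto
    next
      case (Cons q' m)
      then have m: "a = p # q # m" "u' = m @ x # y # b" using a u by auto
      have "Q l p q u' (ap (l @ a) (up x y) b v) =
          ap l (up p q) u' (ap (l @ lo p q @ m) (up x y) b (ap l (dn p q) (m @ lo x y @ b) v))"
        using ap_commute[of v l "dn p q" m "up x y" b] Cons.prems m by simp
      also have "\<dots> = ap (l @ a) (up x y) b (Q l p q (m @ lo x y @ b) v)"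
        using ap_commute[of "ap l (dn p q) (m @ lo x y @ b) v" l "up p q" m "up x y" b] Cons.prems m
        by simp
      finally show ?thesis
        using Cons.prems m by (intro exI[of _ "Q l p q (m @ lo x y @ b) v"]) simp
    qed
    then obtain v' where v': "arr v'" "src v' = src v" "tgt v' = tgt v"
      "Q l p q u' (ap (l @ a) (up x y) b v) = ap (l @ a) (up x y) b v'" by blast
    have diff: "ap (l @ a) (up x y) b v -\<^sub>C ap (l @ a) (up x y) b v' = ap (l @ a) (up x y) b (v -\<^sub>C v')"
      using v' Cons.prems a by (simp add: act_diff)
    have "kill_up l (p # q # u') (ap (l @ a) (up x y) b v) =
        kill_up (l @ [p]) (q # u') (ap (l @ a) (up x y) b (v -\<^sub>C v'))"
      by (simp only: kill_up.simps v'(4) diff)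
    also have "\<dots> = zero_mor C (src v) (l @ p # u)"
      using Cons.IH[of "v -\<^sub>C v'" "l @ [p]" a'] v' Cons.prems a unfolding u[symmetric] by simp
    finally show ?thesis
      unfolding u[symmetric] .
  qed
qed auto

lemma kill_dn_zero: "b = l @ u \<Longrightarrow> kill_dn l u (zero_mor C a b) = zero_mor C a b"
  by (rule kill_dn_fixed) auto

definition top_proj :: "ix list \<Rightarrow> 'm" where
  "top_proj w = kill_dn [] w (kill_up [] w (\<iota> w))"

lemma top_proj_arr [simp]: "arr (top_proj w)" "src (top_proj w) = w" "tgt (top_proj w) = w"
  using kill_up_arr[of "\<iota> w" "[]" w] kill_dn_arr[of "kill_up [] w (\<iota> w)" "[]" w]
  by (simp_all add: top_proj_def)

lemma top_proj_comp:
  "\<lbrakk>arr v; tgt v = w\<rbrakk> \<Longrightarrow> top_proj w \<cdot> v = kill_dn [] w (kill_up [] w v)"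
  using kill_up_arr[of "\<iota> w" "[]" w] by (simp add: top_proj_def kill_dn_comp_right kill_up_comp_right)

lemma dn_top_proj:
  "w = l @ x # y # r \<Longrightarrow> ap l (dn x y) r (top_proj w) = zero_mor C w (l @ lo x y @ r)"
  using dn_kill_dn[of "kill_up [] w (\<iota> w)" "[]" w l x y r] kill_up_arr[of "\<iota> w" "[]" w]
  by (simp add: top_proj_def)

lemma top_proj_up:
  "\<lbrakk>arr v; tgt v = l @ lo x y @ r\<rbrakk> \<Longrightarrow>
    top_proj (l @ x # y # r) \<cdot> ap l (up x y) r v = zero_mor C (src v) (l @ x # y # r)"
  using kill_up_up[of v "[]" l x y r "l @ x # y # r"] by (simp add: top_proj_comp kill_dn_zero)

text \<open>Each \<open>Q\<close> begins with a \<open>dn\<close>, so every factor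
  \<open>1 - Q\<close> acts as the identity on such a \<open>v\<close>.\<close>

lemma top_proj_fixed:
  assumes "arr v" "tgt v = w"
    "\<And>l x y r. w = l @ x # y # r \<Longrightarrow> ap l (dn x y) r v = zero_mor C (src v) (l @ lo x y @ r)"
  shows "top_proj w \<cdot> v = v"
  using kill_up_fixed[of v "[]" w] kill_dn_fixed[of v "[]" w] assms by (simp add: top_proj_comp)

end

section \<open>Schur's lemma in the presented category\<close>

context highest_vector
begin

lemma S_symbol:
  assumes "S (l @ sym_dom s @ r) v"
  shows "S (l @ sym_cod s @ r) (ap l s r v)"
proof (cases s)
  case (Sym_m i)
  then show ?thesis using closed_down_merge[OF S_closed_down, of l i r v] assms by simp
next
  case (Sym_s i)
  then show ?thesis using S_up[of l i i r v] assms by (simp add: up_def lo_def)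
next
  case (Sym_c i)
  then show ?thesis using closed_down_cap[OF S_closed_down, of l i r v] assms by simp
next
  case (Sym_u i)
  then show ?thesis using S_up[of l i "op_ix i" r v] assms by (simp add: up_def lo_def)
next
  case (Sym_b i)
  then show ?thesis using S_beta[of l i r v] assms by simp
qed

lemma S_act:
  "\<lbrakk>tm_wf sym_dom sym_cod t; S (l @ tm_dom sym_dom t @ r) v\<rbrakk>
    \<Longrightarrow> S (l @ tm_cod sym_cod t @ r) (act l t r v)"
proof (induction t arbitrary: l r v)
  case (Gen s)
  then show ?case using S_symbol by simp
next
  case (Comp t1 t2)
  then show ?case using S_simps[OF Comp.prems(2)] by (simp add: act_Comp)
next
  case (Tens t1 t2)
  have "S (l @ tm_dom sym_dom t1 @ tm_cod sym_cod t2 @ r) (act (l @ tm_dom sym_dom t1) t2 r v)"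
    using Tens.IH(2)[of "l @ tm_dom sym_dom t1" r v] Tens.prems by simp
  then show ?case
    using Tens.IH(1)[of l "tm_cod sym_cod t2 @ r"] Tens.prems S_simps[OF Tens.prems(2)]
    by (simp add: act_Tens(1))
next
  case (Add t1 t2)
  then show ?case using S_simps[OF Add.prems(2)] by (auto simp: act_Add intro: S_add)
next
  case (Scale x t)
  then show ?case using S_simps[OF Scale.prems(2)] by (auto simp: act_Scale intro: S_scale)
next
  case (Ident a)
  then show ?case using S_simps[OF Ident.prems(2)] by (simp add: act_Ident)
next
  case (Zero a b)
  then show ?case using S_simps[OF Zero.prems(2)] S_zero by (simp add: act_Zero)
qed

lemma S_N: "S w y \<Longrightarrow> sorted_word w \<Longrightarrow> N w y"
  using S_imp_Z S_closed_down Z_sorted by blast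

text \<open>A last layer \<open>up\<close> is killed by \<open>top_proj\<close>, so only the
  multiples of \<open>e0\<close> survive, and these live over \<open>w0\<close>.\<close>

lemma top_proj_N:
  "N w y \<Longrightarrow> if w = w0 then \<exists>c. top_proj w \<cdot> y = c *\<^sub>C e0 else top_proj w \<cdot> y = zero_mor C (src e0) w"
proof (induction rule: N.induct)
  case N_base
  have "top_proj w0 \<cdot> e0 = e0"
    using e0_arr e0_kill by (intro top_proj_fixed) auto
  then show ?case using e0_arr by (auto intro!: exI[of _ 1])
next
  case (N_zero w)
  then show ?case using e0_arr by (auto intro!: exI[of _ 0])
next
  case (N_add w y y')
  note y = N_arr[OF N_add.hyps(1)] N_arr[OF N_add.hyps(2)]
  show ?case
  proof (cases "w = w0")
    case True
    then obtain c c' where "top_proj w \<cdot> y = c *\<^sub>C e0" "top_proj w \<cdot> y' = c' *\<^sub>C e0"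
      using N_add.IH by auto
    then show ?thesis
      using y True e0_arr by (auto simp: c_add_right simp flip: s_plus)
  next
    case False
    then show ?thesis using y N_add.IH by (simp add: c_add_right)
  qed
next
  case (N_scale w y c)
  note y = N_arr[OF N_scale.hyps(1)]
  show ?case
  proof (cases "w = w0")
    case True
    then obtain c' where "top_proj w \<cdot> y = c' *\<^sub>C e0"
      using N_scale.IH by auto
    then show ?thesis
      using y True e0_arr by (auto simp: c_scale_right s_scale)
  next
    case False
    then show ?thesis using y N_scale.IH by (simp add: c_scale_right)
  qed
next
  case (N_up l x y r v)
  then show ?case
    using top_proj_up[of v l x y r] S_simps[OF N_up.hyps(1)] e0_arr
    by (auto intro!: exI[of _ 0])
qed

end

text \<open>Closure of \<open>S\<close> under the ten symbols is a statement about all morphisms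
  only if these are expressions in the symbols.\<close>

locale sl3_generated = sl3_category C g
  for C :: "(ix list, 'm, 'k::field) lmcat" and g +
  assumes generated: "arr f \<Longrightarrow> \<exists>t. tm_wf sym_dom sym_cod t \<and> f = ev t"
begin

lemma highest_vector_top_proj:
  assumes "sorted_word w" shows "highest_vector C g w (top_proj w)"
  using assms by unfold_locales (simp_all add: dn_top_proj)

text \<open>With \<open>e0 = top_proj v\<close> the composite of \<open>f\<close> and
  \<open>e0\<close> lies in \<open>S\<close>, hence in \<open>N\<close> over the sorted word
  \<open>w\<close>, where the effect of \<open>top_proj w\<close> is known.\<close>

theorem schur:
  assumes "sorted_word v" "sorted_word w" "arr f" "src f = v" "tgt f = w"
  shows "if w = v then \<exists>c. top_proj w \<cdot> (f \<cdot> top_proj v) = c *\<^sub>C top_proj v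
    else top_proj w \<cdot> (f \<cdot> top_proj v) = zero_mor C v w"
proof -
  interpret highest_vector C g v "top_proj v"
    using assms by (intro highest_vector_top_proj)
  obtain t where t: "tm_wf sym_dom sym_cod t" "f = ev t"
    using generated assms by blast
  have "S ([] @ tm_cod sym_cod t @ []) (act [] t [] (top_proj v))"
    using S_base t assms by (intro S_act) auto
  then have "S w (f \<cdot> top_proj v)"
    using t assms by (simp add: act_def)
  then show ?thesis
    using top_proj_N[OF S_N] assms by (auto split: if_splits)
qed

section \<open>Factoring all morphisms through top projections\<close>

inductive J :: "'m \<Rightarrow> bool" where
  J_base: "\<lbrakk>sorted_word w; arr f; arr h; src f = w; tgt h = w\<rbrakk> \<Longrightarrow> J (f \<cdot> (top_proj w \<cdot> h))"
| J_zero: "J (zero_mor C a b)"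
| J_add: "\<lbrakk>J y; J y'; src y' = src y; tgt y' = tgt y\<rbrakk> \<Longrightarrow> J (y +\<^sub>C y')"

lemma J_arr: "J y \<Longrightarrow> arr y"
  by (induction rule: J.induct) auto

lemma J_comp: "\<lbrakk>J y; arr f; src f = tgt y\<rbrakk> \<Longrightarrow> J (f \<cdot> y)"
proof (induction rule: J.induct)
  case (J_base w f' h)
  then show ?case
    using J.J_base[of w "f \<cdot> f'" h] by (simp add: c_assoc)
next
  case (J_add y y')
  then show ?case
    using J.J_add[of "f \<cdot> y" "f \<cdot> y'"] by (simp add: J_arr c_add_right)
qed (auto intro: J.J_zero)

text \<open>Undoing the factors \<open>1 - Q\<close> one at a time adds back terms that end in an
  \<open>up\<close>, so it is enough that those lie in \<open>J\<close>.\<close>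

lemma J_kill_dn:
  assumes "arr v" "tgt v = l @ u" "J (kill_dn l u v)"
    "\<And>a x y b z. \<lbrakk>u = a @ x # y # b; arr z; tgt z = l @ a @ lo x y @ b\<rbrakk> \<Longrightarrow> J (ap (l @ a) (up x y) b z)"
  shows "J v"
  using assms
proof (induction l u v rule: kill_dn.induct)
  case (1 l x y u v)
  define v' where "v' = kill_dn (l @ [x]) (y # u) v"
  have v': "arr v'" "src v' = src v" "tgt v' = l @ x # y # u"
    using kill_dn_arr[of v "l @ [x]" "y # u"] "1.prems"(1,2) v'_def by simp_all
  have "J (v' -\<^sub>C Q l x y u v')"
    using "1.prems"(3) by (simp add: v'_def Let_def)
  moreover have "J (Q l x y u v')"
    using "1.prems"(4)[of "[]" x y u "ap l (dn x y) u v'"] v' by simp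
  ultimately have "J (v' -\<^sub>C Q l x y u v' +\<^sub>C Q l x y u v')"
    by (rule J_add) (simp_all add: v')
  then have "J (kill_dn (l @ [x]) (y # u) v)"
    using v' diff_add[of v' "Q l x y u v'"] by (simp add: v'_def)
  then show ?case
  proof (rule "1.IH"[rotated 2])
    fix a x' y' b z
    assume "y # u = a @ x' # y' # b" "arr z" "tgt z = (l @ [x]) @ a @ lo x' y' @ b"
    then show "J (ap ((l @ [x]) @ a) (up x' y') b z)"
      using "1.prems"(4)[of "x # a" x' y' b z] by simp
  qed (use "1.prems"(1,2) in simp_all)
qed simp_all

lemma J_kill_up:
  assumes "arr v" "tgt v = l @ u" "J (kill_up l u v)"
    "\<And>a x y b z. \<lbrakk>u = a @ x # y # b; arr z; tgt z = l @ a @ lo x y @ b\<rbrakk> \<Longrightarrow> J (ap (l @ a) (up x y) b z)"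
  shows "J v"
  using assms
proof (induction l u v rule: kill_up.induct)
  case (1 l x y u v)
  let ?v = "v -\<^sub>C Q l x y u v"
  note v = "1.prems"(1,2)
  have "J ?v"
  proof (rule "1.IH")
    fix a x' y' b z
    assume "y # u = a @ x' # y' # b" "arr z" "tgt z = (l @ [x]) @ a @ lo x' y' @ b"
    then show "J (ap ((l @ [x]) @ a) (up x' y') b z)"
      using "1.prems"(4)[of "x # a" x' y' b z] by simp
  qed (use "1.prems"(1-3) in simp_all)
  moreover have "J (Q l x y u v)"
    using "1.prems"(4)[of "[]" x y u "ap l (dn x y) u v"] v by simp
  ultimately have "J (?v +\<^sub>C Q l x y u v)"
    by (rule J_add) (simp_all add: v)
  then show ?case
    using v diff_add[of v "Q l x y u v"] by simp
qed simp_all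

lemma J_ap:
  assumes "J z" "tgt z = l @ sym_dom s @ r"
  shows "J (ap l s r z)"
  using J_comp[OF assms(1), of "\<iota> l \<star> ev (Gen s) \<star> \<iota> r"] assms by (simp add: act_def)

theorem J_all: "arr y \<Longrightarrow> J y"
proof (induction "length (tgt y)" arbitrary: y rule: less_induct)
  case less
  note short = less.hyps and y = less.prems
  have "J z" if "arr z" "length (tgt z) = length (tgt y)" for z
    using that
  proof (induction "inversions (tgt z)" arbitrary: z rule: less_induct)
    case less
    show ?case
    proof (cases "sorted_word (tgt z)")
      case True
      have "J (kill_dn [] (tgt z) (kill_up [] (tgt z) z))"
        using J_base[OF True, of "\<iota> (tgt z)" z] less.prems kill_up_arr[of z "[]" "tgt z"]
          kill_dn_arr[of "kill_up [] (tgt z) z" "[]" "tgt z"] by (simp add: top_proj_comp)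
      then have "J (kill_up [] (tgt z) z)"
      proof (rule J_kill_dn[rotated 2])
        fix a x y b z'
        assume "tgt z = a @ x # y # b" "arr z'" "tgt z' = [] @ a @ lo x y @ b"
        then show "J (ap ([] @ a) (up x y) b z')"
          using less.prems by (intro J_ap short) (simp_all add: lo_def)
      qed (use kill_up_arr[of z "[]" "tgt z"] less.prems in simp_all)
      then show ?thesis
      proof (rule J_kill_up[rotated 2])
        fix a x y b z'
        assume "tgt z = a @ x # y # b" "arr z'" "tgt z' = [] @ a @ lo x y @ b"
        then show "J (ap ([] @ a) (up x y) b z')"
          using less.prems by (intro J_ap short) (simp_all add: lo_def)
      qed (use less.prems in simp_all)
    next
      case False
      then obtain a b where ab: "tgt z = a @ I2 # I1 # b"
        by (auto simp: sorted_word_def)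
      have "J (ap a (Sym_b I2) b z)"
        using less.prems ab by (intro less.hyps) simp_all
      then have "J (ap a (Sym_b I1) b (ap a (Sym_b I2) b z))"
        by (rule J_ap) (use less.prems ab in simp)
      then show ?thesis
        using beta_beta[of z a I2 b] less.prems ab by simp
    qed
  qed
  then show ?case using y by blast
qed

end

section \<open>Crystals of words\<close>

text \<open>\<open>E\<close> and \<open>P\<close> are candidates for \<open>eps\<close> and \<open>phi\<close>, which they then equal on \<open>elts B\<close>.\<close>

definition string_data :: "'b crystal \<Rightarrow> (ix \<Rightarrow> 'b \<Rightarrow> nat) \<Rightarrow> (ix \<Rightarrow> 'b \<Rightarrow> nat) \<Rightarrow> bool" where
  "string_data B E P \<longleftrightarrow> (\<forall>i. \<forall>b\<in>elts B.
     (case ke B i b of None \<Rightarrow> E i b = 0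
      | Some b' \<Rightarrow> b' \<in> elts B \<and> kf B i b' = Some b \<and> E i b = Suc (E i b') \<and> P i b' = Suc (P i b)) \<and>
     (case kf B i b of None \<Rightarrow> P i b = 0
      | Some b' \<Rightarrow> b' \<in> elts B \<and> ke B i b' = Some b))"

text \<open>How an \<open>f\<close> arrow changes \<open>E\<close> and \<open>P\<close> is read off
  at the other end of the arrow, from the clause about \<open>e\<close>.\<close>

lemma string_dataD:
  assumes "string_data B E P" "b \<in> elts B"
  shows "ke B i b = None \<longleftrightarrow> E i b = 0"
    and "ke B i b = Some b' \<Longrightarrow> b' \<in> elts B \<and> kf B i b' = Some b \<and> E i b = Suc (E i b') \<and> P i b' = Suc (P i b)"
    and "kf B i b = None \<longleftrightarrow> P i b = 0"
    and "kf B i b = Some b' \<Longrightarrow> b' \<in> elts B \<and> ke B i b' = Some b \<and> E i b' = Suc (E i b) \<and> P i b = Suc (P i b')"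
proof -
  have *: "case ke B i b of None \<Rightarrow> E i b = 0
      | Some b' \<Rightarrow> b' \<in> elts B \<and> kf B i b' = Some b \<and> E i b = Suc (E i b') \<and> P i b' = Suc (P i b)"
    "case kf B i b of None \<Rightarrow> P i b = 0 | Some b' \<Rightarrow> b' \<in> elts B \<and> ke B i b' = Some b"
    if "b \<in> elts B" for b
    using assms(1) that unfolding string_data_def by blast+
  show "ke B i b = None \<longleftrightarrow> E i b = 0" using *(1)[OF assms(2)] by (cases "ke B i b") auto
  show "ke B i b = Some b' \<Longrightarrow> b' \<in> elts B \<and> kf B i b' = Some b \<and> E i b = Suc (E i b') \<and> P i b' = Suc (P i b)"
    using *(1)[OF assms(2)] by simp
  show f: "kf B i b = Some b' \<Longrightarrow> b' \<in> elts B \<and> ke B i b' = Some b \<and> E i b' = Suc (E i b) \<and> P i b = Suc (P i b')"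
    for b' using *(2)[OF assms(2)] *(1)[of b'] by simp
  show "kf B i b = None \<longleftrightarrow> P i b = 0"
    using *(2)[OF assms(2)] f by (cases "kf B i b") auto
qed

lemma string_data_cases:
  assumes "string_data B E P" "b \<in> elts B"
  shows "case ke B i b of None \<Rightarrow> E i b = 0
      | Some b' \<Rightarrow> b' \<in> elts B \<and> kf B i b' = Some b \<and> E i b = Suc (E i b') \<and> P i b' = Suc (P i b)"
    and "case kf B i b of None \<Rightarrow> P i b = 0
      | Some b' \<Rightarrow> b' \<in> elts B \<and> ke B i b' = Some b \<and> E i b' = Suc (E i b) \<and> P i b = Suc (P i b')"
  using string_dataD(1,2)[OF assms] string_dataD(3,4)[OF assms]
  by (auto split: option.split)

lemma funpow_bind_None:
  fixes g :: "'a \<Rightarrow> 'a option"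
  shows "((\<lambda>x. Option.bind x g) ^^ m) None = None"
  by (induction m) simp_all

text \<open>Induction along the string shows that \<open>e\<close> can be applied exactly
  \<open>E i b\<close> times, so the set whose maximum defines \<open>eps\<close> is an initial
  segment of the naturals; likewise for \<open>phi\<close>.\<close>

lemma string_data_unique:
  assumes "string_data B E P" "b \<in> elts B"
  shows "eps B i b = E i b" "phi B i b = P i b"
proof -
  have e: "((\<lambda>x. Option.bind x (ke B i)) ^^ m) (Some b) \<noteq> None \<longleftrightarrow> m \<le> E i b" if "b \<in> elts B" for m b
    using that
  proof (induction m arbitrary: b)
    case (Suc m)
    then show ?case
      using string_data_cases(1)[OF assms(1) Suc.prems, of i]
      by (cases "ke B i b") (auto simp: funpow_swap1 funpow_bind_None simp del: funpow.simps(2)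
          simp: funpow_Suc_right)
  qed simp
  have f: "((\<lambda>x. Option.bind x (kf B i)) ^^ m) (Some b) \<noteq> None \<longleftrightarrow> m \<le> P i b" if "b \<in> elts B" for m b
    using that
  proof (induction m arbitrary: b)
    case (Suc m)
    then show ?case
      using string_data_cases(2)[OF assms(1) Suc.prems, of i]
      by (cases "kf B i b") (auto simp: funpow_swap1 funpow_bind_None simp del: funpow.simps(2)
          simp: funpow_Suc_right)
  qed simp
  have "Max {m. m \<le> n} = n" for n :: nat
    by (rule Max_eqI) auto
  then show "eps B i b = E i b" "phi B i b = P i b"
    using e[OF assms(2)] f[OF assms(2)] by (simp_all add: eps_def phi_def)
qed

definition string_crystal :: "'b crystal \<Rightarrow> bool" where
  "string_crystal B \<longleftrightarrow> string_data B (eps B) (phi B)"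

lemma string_crystalI: "string_data B E P \<Longrightarrow> string_crystal B"
proof -
  assume *: "string_data B E P"
  note u = string_data_unique[OF *]
  show ?thesis
    unfolding string_crystal_def string_data_def
  proof (intro allI ballI)
    fix i b assume b: "b \<in> elts B"
    show "(case ke B i b of None \<Rightarrow> eps B i b = 0
        | Some b' \<Rightarrow> b' \<in> elts B \<and> kf B i b' = Some b \<and> eps B i b = Suc (eps B i b') \<and>
            phi B i b' = Suc (phi B i b)) \<and>
      (case kf B i b of None \<Rightarrow> phi B i b = 0 | Some b' \<Rightarrow> b' \<in> elts B \<and> ke B i b' = Some b)"
      using string_data_cases[OF * b, of i] u[OF b, of i] u
      by (cases "ke B i b"; cases "kf B i b") simp_all
  qed
qed

lemmas string_crystalD = string_dataD[OF string_crystal_def[THEN iffD1]]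
lemmas string_crystal_cases = string_data_cases[OF string_crystal_def[THEN iffD1]]

lemma cons_crystal_simps:
  "elts (cons_crystal A B) = {a # xs | a xs. a \<in> elts A \<and> xs \<in> elts B}"
  "wt (cons_crystal A B) (a # xs) k = wt A a k + wt B xs k"
  "ke (cons_crystal A B) i (a # xs) = (if phi A i a \<ge> eps B i xs
     then map_option (\<lambda>a'. a' # xs) (ke A i a) else map_option (\<lambda>xs'. a # xs') (ke B i xs))"
  "kf (cons_crystal A B) i (a # xs) = (if phi A i a > eps B i xs
     then map_option (\<lambda>a'. a' # xs) (kf A i a) else map_option (\<lambda>xs'. a # xs') (kf B i xs))"
  by (auto simp: cons_crystal_def Let_def crystal_tensor_def option.map_comp comp_def)

text \<open>The classical formulas for \<open>eps\<close> and \<open>phi\<close> of a tensor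
  product, where truncated subtraction of naturals stands for the maximum of 0 and a
  difference.\<close>

lemma string_cons:
  assumes "string_crystal A" "string_crystal B"
  shows "string_data (cons_crystal A B)
    (\<lambda>i bs. eps A i (hd bs) + (eps B i (tl bs) - phi A i (hd bs)))
    (\<lambda>i bs. phi B i (tl bs) + (phi A i (hd bs) - eps B i (tl bs)))"
    (is "string_data ?C ?E ?P")
proof -
  note A = string_crystal_cases[OF assms(1)] and B = string_crystal_cases[OF assms(2)]
  show ?thesis
    unfolding string_data_def
  proof (intro allI ballI)
    fix i x assume "x \<in> elts ?C"
    then obtain b c where x: "x = b # c" "b \<in> elts A" "c \<in> elts B"
      by (auto simp: cons_crystal_simps)
    show "(case ke ?C i x of None \<Rightarrow> ?E i x = 0
      | Some x' \<Rightarrow> x' \<in> elts ?C \<and> kf ?C i x' = Some x \<and> ?E i x = Suc (?E i x') \<and> ?P i x' = Suc (?P i x)) \<and>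
      (case kf ?C i x of None \<Rightarrow> ?P i x = 0 | Some x' \<Rightarrow> x' \<in> elts ?C \<and> ke ?C i x' = Some x)"
      using A[OF x(2), of i] B[OF x(3), of i] x
      by (cases "ke A i b"; cases "ke B i c"; cases "kf A i b"; cases "kf B i c")
        (auto simp: cons_crystal_simps)
  qed
qed

lemma eps_phi_cons:
  assumes "string_crystal A" "string_crystal B" "a \<in> elts A" "xs \<in> elts B"
  shows "eps (cons_crystal A B) i (a # xs) = eps A i a + (eps B i xs - phi A i a)"
    and "phi (cons_crystal A B) i (a # xs) = phi B i xs + (phi A i a - eps B i xs)"
  using string_data_unique[OF string_cons[OF assms(1,2)], of "a # xs" i] assms(3,4)
  by (auto simp: cons_crystal_simps)

lemma string_fund:
  "string_data (fund_crystal i)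
    (\<lambda>k b. case b of Top \<Rightarrow> 0 | Mid \<Rightarrow> if k = i then 1 else 0 | Bot \<Rightarrow> if k = op_ix i then 1 else 0)
    (\<lambda>k b. case b of Top \<Rightarrow> if k = i then 1 else 0 | Mid \<Rightarrow> if k = op_ix i then 1 else 0 | Bot \<Rightarrow> 0)"
  unfolding string_data_def
  by (intro allI ballI; rename_tac k b; cases i; case_tac k; case_tac b)
    (auto simp: fund_crystal_def)

lemma eps_phi_fund:
  "eps (fund_crystal i) k b =
    (case b of Top \<Rightarrow> 0 | Mid \<Rightarrow> if k = i then 1 else 0 | Bot \<Rightarrow> if k = op_ix i then 1 else 0)"
  "phi (fund_crystal i) k b =
    (case b of Top \<Rightarrow> if k = i then 1 else 0 | Mid \<Rightarrow> if k = op_ix i then 1 else 0 | Bot \<Rightarrow> 0)"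
  using string_data_unique[OF string_fund, of b i k] by (simp_all add: fund_crystal_def)

lemma string_unit: "string_data unit_crystal (\<lambda>_ _. 0) (\<lambda>_ _. 0)"
  by (simp add: string_data_def unit_crystal_def)

lemma eps_phi_unit: "eps unit_crystal i [] = 0" "phi unit_crystal i [] = 0"
  using string_data_unique[OF string_unit, of "[]" i] by (simp_all add: unit_crystal_def)

lemma elts_fund [simp]: "elts (fund_crystal i) = UNIV"
  by (simp add: fund_crystal_def)

abbreviation "wke v \<equiv> ke (word_crystal v)"
abbreviation "wkf v \<equiv> kf (word_crystal v)"
abbreviation "weps v \<equiv> eps (word_crystal v)"
abbreviation "wphi v \<equiv> phi (word_crystal v)"
abbreviation "wwt v \<equiv> wt (word_crystal v)"
abbreviation "word_strict v w \<equiv> strict_morphism (word_crystal v) (word_crystal w)"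
abbreviation "word_matrix v \<equiv> crystal_matrix (word_crystal v)"

lemma string_word [simp]: "string_crystal (word_crystal w)"
  by (induction w) (auto intro: string_crystalI string_unit string_fund string_cons)

lemma elts_word [simp]: "elts (word_crystal w) = {b. length b = length w}"
  by (induction w) (auto simp: unit_crystal_def cons_crystal_simps length_Suc_conv)

lemma finite_elts_word: "finite (elts (word_crystal w))"
proof -
  have "finite (UNIV :: node set)"
    by (rule finite_subset[of _ "{Top, Mid, Bot}"]) (auto intro: node.exhaust)
  then show ?thesis
    using finite_lists_length_eq[of UNIV "length w"] by simp
qed

lemmas string_fund' = string_crystalI[OF string_fund]

lemma word_Cons:
  assumes "length xs = length w"
  shows "weps (j # w) i (a # xs) =
      eps (fund_crystal j) i a + (weps w i xs - phi (fund_crystal j) i a)"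
    and "wphi (j # w) i (a # xs) =
      wphi w i xs + (phi (fund_crystal j) i a - weps w i xs)"
  using eps_phi_cons[OF string_fund' string_word, of a j xs w i] assms by simp_all

text \<open>Words are bracketed to the right by definition. This is associativity of the tensor
  product of crystals, and it makes concatenation a tensor product of words. All five functions are
  treated together because the branches of \<open>ke\<close> and \<open>kf\<close> compare values of
  \<open>eps\<close> and \<open>phi\<close>.\<close>

lemma word_append_all:
  assumes "length b = length v" "length c = length w"
  shows "wwt (v @ w) (b @ c) k = wwt v b k + wwt w c k \<and>
    weps (v @ w) i (b @ c) =
      weps v i b + (weps w i c - wphi v i b) \<and>
    wphi (v @ w) i (b @ c) =
      wphi w i c + (wphi v i b - weps w i c) \<and>
    wke (v @ w) i (b @ c) =
      (if wphi v i b \<ge> weps w i c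
       then map_option (\<lambda>b'. b' @ c) (wke v i b)
       else map_option (\<lambda>c'. b @ c') (wke w i c)) \<and>
    wkf (v @ w) i (b @ c) =
      (if wphi v i b > weps w i c
       then map_option (\<lambda>b'. b' @ c) (wkf v i b)
       else map_option (\<lambda>c'. b @ c') (wkf w i c))"
  using assms(1)
proof (induction v arbitrary: b)
  case Nil
  \<comment> \<open>For an empty left word and \<open>eps\<close> equal to 0 the tensor rule selects
    the left factor, where \<open>e\<close> is undefined; it is then undefined on \<open>c\<close>
    as well.\<close>
  have "wke w i c = None \<longleftrightarrow> weps w i c = 0"
    using string_crystalD(1)[OF string_word, of c w i] assms(2) by simp
  then show ?case
    using Nil eps_phi_unit[of i]
    by (cases "wke w i c"; cases "wkf w i c")
      (simp_all add: unit_crystal_def)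
next
  case (Cons j v)
  then obtain a b' where b: "b = a # b'" "length b' = length v"
    by (auto simp: length_Suc_conv)
  have l: "length (b' @ c) = length (v @ w)" using b assms by simp
  let ?Ej = "eps (fund_crystal j) i a" and ?Pj = "phi (fund_crystal j) i a"
  let ?Ev = "weps v i b'" and ?Pv = "wphi v i b'"
  let ?Ew = "weps w i c" and ?Pw = "wphi w i c"
  note IH = Cons.IH[OF b(2)]
  have "weps (j # v @ w) i (a # b' @ c) = ?Ej + (?Ev + (?Ew - ?Pv) - ?Pj)"
    "wphi (j # v @ w) i (a # b' @ c) =
      ?Pw + (?Pv - ?Ew) + (?Pj - (?Ev + (?Ew - ?Pv)))"
    using word_Cons[OF l, of j i a] IH by simp_all
  moreover have "wke (j # v @ w) i (a # b' @ c) =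
    (if ?Pj \<ge> ?Ev + (?Ew - ?Pv) then map_option (\<lambda>a'. a' # b' @ c) (ke (fund_crystal j) i a)
     else if ?Pv \<ge> ?Ew then map_option (\<lambda>b'. a # b' @ c) (wke v i b')
     else map_option (\<lambda>c'. a # b' @ c') (wke w i c))"
    using IH by (simp add: cons_crystal_simps option.map_comp comp_def)
  moreover have "wkf (j # v @ w) i (a # b' @ c) =
    (if ?Pj > ?Ev + (?Ew - ?Pv) then map_option (\<lambda>a'. a' # b' @ c) (kf (fund_crystal j) i a)
     else if ?Pv > ?Ew then map_option (\<lambda>b'. a # b' @ c) (wkf v i b')
     else map_option (\<lambda>c'. a # b' @ c') (wkf w i c))"
    using IH by (simp add: cons_crystal_simps option.map_comp comp_def)
  moreover have "wwt (j # v @ w) (a # b' @ c) k =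
      wt (fund_crystal j) a k + wwt v b' k + wwt w c k"
    using IH by (simp add: cons_crystal_simps)
  moreover have "wwt (j # v) (a # b') k = wt (fund_crystal j) a k + wwt v b' k"
    by (simp add: cons_crystal_simps)
  moreover have "map_option (\<lambda>b'. b' @ c) (wke (j # v) i (a # b')) =
    (if ?Pj \<ge> ?Ev then map_option (\<lambda>a'. a' # b' @ c) (ke (fund_crystal j) i a)
     else map_option (\<lambda>b'. a # b' @ c) (wke v i b'))"
    by (simp add: cons_crystal_simps option.map_comp comp_def)
  moreover have "map_option (\<lambda>b'. b' @ c) (wkf (j # v) i (a # b')) =
    (if ?Pj > ?Ev then map_option (\<lambda>a'. a' # b' @ c) (kf (fund_crystal j) i a)
     else map_option (\<lambda>b'. a # b' @ c) (wkf v i b'))"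
    by (simp add: cons_crystal_simps option.map_comp comp_def)
  ultimately show ?case
    unfolding b append_Cons word_Cons[OF b(2)]
    by (cases "?Ev \<le> ?Pj"; cases "?Ew \<le> ?Pv") (simp_all del: word_crystal.simps, (auto simp del: word_crystal.simps)?)
qed

lemmas word_append = word_append_all[THEN conjunct1]
  word_append_all[THEN conjunct2, THEN conjunct1]
  word_append_all[THEN conjunct2, THEN conjunct2, THEN conjunct1]
  word_append_all[THEN conjunct2, THEN conjunct2, THEN conjunct2, THEN conjunct1]
  word_append_all[THEN conjunct2, THEN conjunct2, THEN conjunct2, THEN conjunct2]

section \<open>Strict morphisms\<close>

lemma strict_morphismD:
  assumes "strict_morphism B C \<psi>" "b \<in> elts B"
  shows "\<psi> b = Some c \<Longrightarrow> c \<in> elts C" "\<psi> b = Some c \<Longrightarrow> wt C c = wt B b"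
    "Option.bind (ke B i b) \<psi> = Option.bind (\<psi> b) (ke C i)"
    "Option.bind (kf B i b) \<psi> = Option.bind (\<psi> b) (kf C i)"
  using assms unfolding strict_morphism_def by blast+

text \<open>A strict morphism cannot cut a string: if \<open>b\<close> is not sent to 0 and
  \<open>e\<close> takes \<open>b\<close> to \<open>b'\<close>, then \<open>f\<close> takes the
  image of \<open>b'\<close> to that of \<open>b\<close>, so \<open>b'\<close> is not sent to 0
  either. The claim follows by induction along the string.\<close>

lemma strict_eps_phi:
  assumes "string_crystal B" "string_crystal C" "strict_morphism B C \<psi>"
    and "b \<in> elts B" "\<psi> b = Some c"
  shows "eps C i c = eps B i b" "phi C i c = phi B i b"
proof -
  note B = string_crystalD[OF assms(1)] and C = string_crystalD[OF assms(2)]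
    and S = strict_morphismD[OF assms(3)]
  show "eps C i c = eps B i b"
    using assms(4,5)
  proof (induction "eps B i b" arbitrary: b c)
    case 0
    then show ?case
      using B(1)[of b i] S(1)[of b c] S(3)[of b i] C(1)[of c i] by auto
  next
    case (Suc n)
    then obtain b' where b': "ke B i b = Some b'"
      using B(1)[of b i] by (cases "ke B i b") auto
    note b'' = B(2)[OF Suc.prems(1) b']
    then have "Option.bind (\<psi> b') (kf C i) = Some c"
      using S(4)[of b' i] Suc.prems by simp
    then obtain c' where c': "\<psi> b' = Some c'" by (cases "\<psi> b'") auto
    then have "ke C i c = Some c'"
      using S(3)[OF Suc.prems(1), of i] b' Suc.prems by simp
    then have "eps C i c = Suc (eps C i c')"
      using C(2)[of c i c'] S(1)[OF Suc.prems] by simp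
    then show ?case using Suc.hyps(1)[of b' c'] Suc.hyps(2) b'' c' by simp
  qed
  show "phi C i c = phi B i b"
    using assms(4,5)
  proof (induction "phi B i b" arbitrary: b c)
    case 0
    then show ?case
      using B(3)[of b i] S(1)[of b c] S(4)[of b i] C(3)[of c i] by auto
  next
    case (Suc n)
    then obtain b' where b': "kf B i b = Some b'"
      using B(3)[of b i] by (cases "kf B i b") auto
    note b'' = B(4)[OF Suc.prems(1) b']
    then have "Option.bind (\<psi> b') (ke C i) = Some c"
      using S(3)[of b' i] Suc.prems by simp
    then obtain c' where c': "\<psi> b' = Some c'" by (cases "\<psi> b'") auto
    then have "kf C i c = Some c'"
      using S(4)[OF Suc.prems(1), of i] b' Suc.prems by simp
    then have "phi C i c = Suc (phi C i c')"
      using C(4)[of c i c'] S(1)[OF Suc.prems] by simp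
    then show ?case using Suc.hyps(1)[of b' c'] Suc.hyps(2) b'' c' by simp
  qed
qed

lemma strict_morphism_comp:
  assumes "strict_morphism A B \<psi>" "strict_morphism B C \<chi>"
    and "string_crystal A"
  shows "strict_morphism A C (\<lambda>b. Option.bind (\<psi> b) \<chi>)"
proof -
  note S = strict_morphismD[OF assms(1)] and T = strict_morphismD[OF assms(2)]
  show ?thesis
    unfolding strict_morphism_def
  proof (intro conjI ballI allI impI)
    fix b c assume "b \<in> elts A" "Option.bind (\<psi> b) \<chi> = Some c"
    then show "c \<in> elts C" "wt C c = wt A b"
      using S(1,2)[of b] T(1,2) by (auto simp: bind_eq_Some_conv)
  next
    fix b i assume b: "b \<in> elts A"
    have "Option.bind (ke A i b) (\<lambda>b. Option.bind (\<psi> b) \<chi>) = Option.bind (Option.bind (ke A i b) \<psi>) \<chi>"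
      by (cases "ke A i b") auto
    also have "\<dots> = Option.bind (Option.bind (\<psi> b) \<chi>) (ke C i)"
      unfolding S(3)[OF b] using S(1)[OF b] T(3) by (cases "\<psi> b") auto
    finally show "Option.bind (ke A i b) (\<lambda>b. Option.bind (\<psi> b) \<chi>) =
      Option.bind (Option.bind (\<psi> b) \<chi>) (ke C i)" .
    have "Option.bind (kf A i b) (\<lambda>b. Option.bind (\<psi> b) \<chi>) = Option.bind (Option.bind (kf A i b) \<psi>) \<chi>"
      by (cases "kf A i b") auto
    also have "\<dots> = Option.bind (Option.bind (\<psi> b) \<chi>) (kf C i)"
      unfolding S(4)[OF b] using S(1)[OF b] T(4) by (cases "\<psi> b") auto
    finally show "Option.bind (kf A i b) (\<lambda>b. Option.bind (\<psi> b) \<chi>) =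
      Option.bind (Option.bind (\<psi> b) \<chi>) (kf C i)" .
  qed
qed

definition map_tensor ::
  "nat \<Rightarrow> (node list \<Rightarrow> node list option) \<Rightarrow> (node list \<Rightarrow> node list option) \<Rightarrow> node list \<Rightarrow> node list option"
  where "map_tensor n \<psi> \<chi> b =
    Option.bind (\<psi> (take n b)) (\<lambda>c. map_option (\<lambda>d. c @ d) (\<chi> (drop n b)))"

text \<open>The tensor rule chooses its factor by comparing \<open>phi\<close> with
  \<open>eps\<close>, and strict morphisms preserve both on elements not sent to 0. If a factor is
  sent to 0, so are its images under \<open>e\<close> and \<open>f\<close>.\<close>

lemma strict_morphism_tensor:
  assumes "word_strict v w \<psi>"
    and "word_strict v' w' \<chi>"
  shows "word_strict (v @ v') (w @ w') (map_tensor (length v) \<psi> \<chi>)"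
proof -
  note S = strict_morphismD[OF assms(1)] and T = strict_morphismD[OF assms(2)]
  let ?\<xi> = "map_tensor (length v) \<psi> \<chi>"
  have \<xi>: "?\<xi> (b @ b') = Option.bind (\<psi> b) (\<lambda>c. map_option (\<lambda>d. c @ d) (\<chi> b'))" if "length b = length v" for b b'
    using that by (simp add: map_tensor_def)
  have split: "\<exists>c c'. b = c @ c' \<and> length c = length v \<and> length c' = length v'"
    if "b \<in> elts (word_crystal (v @ v'))" for b
    using that by (intro exI[of _ "take (length v) b"] exI[of _ "drop (length v) b"]) simp
  show ?thesis
    unfolding strict_morphism_def
  proof (intro conjI ballI allI impI)
    fix b c assume "b \<in> elts (word_crystal (v @ v'))" "?\<xi> b = Some c"
    then obtain b1 b2 c1 c2 where *: "b = b1 @ b2" "length b1 = length v" "length b2 = length v'"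
      "\<psi> b1 = Some c1" "\<chi> b2 = Some c2" "c = c1 @ c2"
      using split[of b] by (auto simp: \<xi> bind_eq_Some_conv)
    then have l: "length c1 = length w" "length c2 = length w'"
      using S(1)[of b1 c1] T(1)[of b2 c2] by auto
    then show "c \<in> elts (word_crystal (w @ w'))" using * by simp
    show "wwt (w @ w') c = wwt (v @ v') b"
      using S(2)[of b1 c1] T(2)[of b2 c2] * l by (auto simp: word_append)
  next
    fix b i assume "b \<in> elts (word_crystal (v @ v'))"
    then obtain b1 b2 where b: "b = b1 @ b2" "length b1 = length v" "length b2 = length v'"
      using split by blast
    note S' = S(3,4)[of b1 i] and T' = T(3,4)[of b2 i]
    have ke_l: "length x = length v" if "wke v i b1 = Some x" for x
      using string_crystalD(2)[OF string_word, of b1 v i x] b that by simp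
    have kf_l: "length x = length v" if "wkf v i b1 = Some x" for x
      using string_crystalD(4)[OF string_word, of b1 v i x] b that by simp
    have "Option.bind (wke (v @ v') i b) ?\<xi> = Option.bind (?\<xi> b) (wke (w @ w') i)
      \<and> Option.bind (wkf (v @ v') i b) ?\<xi> = Option.bind (?\<xi> b) (wkf (w @ w') i)"
    proof (cases "\<psi> b1 = None \<or> \<chi> b2 = None")
      case True
      then show ?thesis
        using S' T' b ke_l kf_l
        by (cases "wke v i b1"; cases "wke v' i b2";
            cases "wkf v i b1"; cases "wkf v' i b2";
            cases "\<psi> b1") (auto simp: \<xi> word_append)
    next
      case False
      then obtain c1 c2 where c: "\<psi> b1 = Some c1" "\<chi> b2 = Some c2" by auto
      then have l: "length c1 = length w" "length c2 = length w'"
        using S(1)[of b1 c1] T(1)[of b2 c2] b by auto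
      have e: "weps w' i c2 = weps v' i b2"
        "wphi w i c1 = wphi v i b1"
        using strict_eps_phi[OF string_word string_word assms(1), of b1 c1 i]
          strict_eps_phi[OF string_word string_word assms(2), of b2 c2 i] b c by auto
      have k: "wke w i c1 = Option.bind (wke v i b1) \<psi>"
        "wke w' i c2 = Option.bind (wke v' i b2) \<chi>"
        "wkf w i c1 = Option.bind (wkf v i b1) \<psi>"
        "wkf w' i c2 = Option.bind (wkf v' i b2) \<chi>"
        using S' T' b c by simp_all
      have "Option.bind (?\<xi> b) h = h (c1 @ c2)" for h :: "node list \<Rightarrow> node list option"
        using b c by (simp add: \<xi>)
      moreover have "Option.bind (map_option (\<lambda>b'. b' @ b2) y) ?\<xi> =
          map_option (\<lambda>b'. b' @ c2) (Option.bind y \<psi>)"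
        if "\<And>x. y = Some x \<Longrightarrow> length x = length v" for y
        using that c by (cases y; cases "\<psi> (the y)") (simp_all add: \<xi>)
      moreover have "Option.bind (map_option (\<lambda>b'. b1 @ b') y) ?\<xi> =
          map_option (\<lambda>b'. c1 @ b') (Option.bind y \<chi>)" for y
        using b c by (cases y) (simp_all add: \<xi>)
      ultimately show ?thesis
        unfolding b(1) word_append[OF b(2,3)] using ke_l kf_l by (simp add: word_append[OF l] k e)
    qed
    then show "Option.bind (wke (v @ v') i b) ?\<xi> = Option.bind (?\<xi> b) (wke (w @ w') i)"
      "Option.bind (wkf (v @ v') i b) ?\<xi> = Option.bind (?\<xi> b) (wkf (w @ w') i)"
      by blast+
  qed
qed

section \<open>The category of tensor words\<close>

lemma crystal_hom_zero: "(\<lambda>c b. 0) \<in> crystal_hom B C"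
  unfolding crystal_hom_def by (rule CollectI, rule exI[of _ "{}"]) simp

lemma crystal_hom_matrix:
  assumes "strict_morphism B C \<psi>"
  shows "crystal_matrix B \<psi> \<in> crystal_hom B C"
  unfolding crystal_hom_def
  by (rule CollectI, rule exI[of _ "{\<psi>}"], rule exI[of _ "\<lambda>_. 1"]) (use assms in simp)

lemma crystal_hom_add:
  assumes "M \<in> crystal_hom B C" "N \<in> crystal_hom B C"
  shows "(\<lambda>c b. M c b + N c b) \<in> crystal_hom B C"
proof -
  obtain S x T y where S: "finite S" "\<forall>\<psi>\<in>S. strict_morphism B C \<psi>"
      "M = (\<lambda>c b. \<Sum>\<psi>\<in>S. x \<psi> * crystal_matrix B \<psi> c b)"
    and T: "finite T" "\<forall>\<psi>\<in>T. strict_morphism B C \<psi>"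
      "N = (\<lambda>c b. \<Sum>\<psi>\<in>T. y \<psi> * crystal_matrix B \<psi> c b)"
    using assms unfolding crystal_hom_def by blast
  let ?z = "\<lambda>\<psi>. (if \<psi> \<in> S then x \<psi> else 0) + (if \<psi> \<in> T then y \<psi> else 0)"
  have "(\<Sum>\<psi>\<in>S \<union> T. ?z \<psi> * crystal_matrix B \<psi> c b) = M c b + N c b" for c b
  proof -
    have "(\<Sum>\<psi>\<in>S \<union> T. (if \<psi> \<in> S then x \<psi> else 0) * crystal_matrix B \<psi> c b) = M c b"
      unfolding S(3) by (rule sum.mono_neutral_cong_right) (use S(1) T(1) in auto)
    moreover have "(\<Sum>\<psi>\<in>S \<union> T. (if \<psi> \<in> T then y \<psi> else 0) * crystal_matrix B \<psi> c b) = N c b"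
      unfolding T(3) by (rule sum.mono_neutral_cong_right) (use S(1) T(1) in auto)
    ultimately show ?thesis by (simp only: distrib_right sum.distrib)
  qed
  then show ?thesis
    unfolding crystal_hom_def using S(1,2) T(1,2)
    by (intro CollectI exI[of _ "S \<union> T"] exI[of _ ?z]) auto
qed

lemma crystal_hom_scale:
  assumes "M \<in> crystal_hom B C"
  shows "(\<lambda>c b. a * M c b) \<in> crystal_hom B C"
proof -
  obtain S x where S: "finite S" "\<forall>\<psi>\<in>S. strict_morphism B C \<psi>"
      "M = (\<lambda>c b. \<Sum>\<psi>\<in>S. x \<psi> * crystal_matrix B \<psi> c b)"
    using assms unfolding crystal_hom_def by blast
  then show ?thesis
    unfolding crystal_hom_def
    by (intro CollectI exI[of _ S] exI[of _ "\<lambda>\<psi>. a * x \<psi>"]) (simp add: sum_distrib_left mult.assoc)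
qed

text \<open>By linearity, claims about all homs reduce to the matrices of strict morphisms, which
  are peeled off the combination one at a time.\<close>

lemma crystal_hom_induct [consumes 1, case_names zero add]:
  assumes "M \<in> crystal_hom B C" "P (\<lambda>c b. 0)"
    "\<And>\<psi> x M. \<lbrakk>strict_morphism B C \<psi>; M \<in> crystal_hom B C; P M\<rbrakk>
      \<Longrightarrow> P (\<lambda>c b. x * crystal_matrix B \<psi> c b + M c b)"
  shows "P M"
proof -
  obtain S x where S: "finite S" "\<forall>\<psi>\<in>S. strict_morphism B C \<psi>"
      "M = (\<lambda>c b. \<Sum>\<psi>\<in>S. x \<psi> * crystal_matrix B \<psi> c b)"
    using assms(1) unfolding crystal_hom_def by blast
  have "P (\<lambda>c b. \<Sum>\<psi>\<in>S. x \<psi> * crystal_matrix B \<psi> c b)"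
    using S(1,2)
  proof (induction S)
    case (insert \<psi> S)
    then have "(\<lambda>c b. \<Sum>\<psi>\<in>S. x \<psi> * crystal_matrix B \<psi> c b) \<in> crystal_hom B C"
      unfolding crystal_hom_def by blast
    then show ?case using assms(3)[of \<psi> _ "x \<psi>"] insert by simp
  qed (simp add: assms(2))
  then show ?thesis by (simp add: S(3))
qed

lemma crystal_hom_support:
  assumes "M \<in> crystal_hom B C" "b \<notin> elts B \<or> c \<notin> elts C"
  shows "M c b = 0"
  using assms(1)
proof (induction rule: crystal_hom_induct)
  case (add \<psi> x M)
  then show ?case using assms(2) strict_morphismD(1)[OF add.hyps(1), of b c]
    by (auto simp: crystal_matrix_def)
qed simp

abbreviation word_hom :: "ix list \<Rightarrow> ix list \<Rightarrow> (node list \<Rightarrow> node list \<Rightarrow> 'k::field) set" where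
  "word_hom v w \<equiv> crystal_hom (word_crystal v) (word_crystal w)"

definition mat_comp :: "ix list \<Rightarrow> (node list \<Rightarrow> node list \<Rightarrow> 'k::field) \<Rightarrow>
    (node list \<Rightarrow> node list \<Rightarrow> 'k) \<Rightarrow> node list \<Rightarrow> node list \<Rightarrow> 'k" where
  "mat_comp w N M = (\<lambda>d b. \<Sum>c\<in>elts (word_crystal w). N d c * M c b)"

definition mat_tens :: "ix list \<Rightarrow> ix list \<Rightarrow> (node list \<Rightarrow> node list \<Rightarrow> 'k::field) \<Rightarrow>
    (node list \<Rightarrow> node list \<Rightarrow> 'k) \<Rightarrow> node list \<Rightarrow> node list \<Rightarrow> 'k" where
  "mat_tens v w M M' = (\<lambda>c b. M (take (length w) c) (take (length v) b) *
     M' (drop (length w) c) (drop (length v) b))"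

lemma mat_comp_matrix:
  assumes "word_strict v w \<psi>"
  shows "mat_comp w (word_matrix w \<chi>) (word_matrix v \<psi>) =
    word_matrix v (\<lambda>b. Option.bind (\<psi> b) \<chi>)"
proof (intro ext)
  fix d b
  show "mat_comp w (word_matrix w \<chi>) (word_matrix v \<psi>) d b =
    word_matrix v (\<lambda>b. Option.bind (\<psi> b) \<chi>) d b"
  proof (cases "b \<in> elts (word_crystal v) \<and> \<psi> b \<noteq> None")
    case True
    then obtain c0 where c0: "\<psi> b = Some c0" by auto
    then have "c0 \<in> elts (word_crystal w)" using strict_morphismD(1)[OF assms] True by blast
    then have "mat_comp w (word_matrix w \<chi>) (word_matrix v \<psi>) d b =
      (\<Sum>c\<in>elts (word_crystal w). if c = c0 then (if \<chi> c0 = Some d then 1 else 0) else 0)"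
      using True c0 unfolding mat_comp_def crystal_matrix_def by (intro sum.cong) auto
    then show ?thesis
      using True c0 \<open>c0 \<in> elts (word_crystal w)\<close> finite_elts_word[of w]
      by (simp add: crystal_matrix_def del: elts_word)
  next
    case False
    then show ?thesis by (auto simp: mat_comp_def crystal_matrix_def)
  qed
qed

lemma mat_comp_hom:
  assumes "M \<in> word_hom u v" "N \<in> word_hom v w"
  shows "mat_comp v N M \<in> word_hom u w"
  using assms(1)
proof (induction rule: crystal_hom_induct)
  case zero
  then show ?case by (simp add: mat_comp_def crystal_hom_zero)
next
  case (add \<psi> x M)
  have "mat_comp v N (word_matrix u \<psi>) \<in> word_hom u w"
    using assms(2)
  proof (induction rule: crystal_hom_induct)
    case zero
    then show ?case by (simp add: mat_comp_def crystal_hom_zero)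
  next
    case (add \<chi> y N)
    have "mat_comp v (\<lambda>c b. y * word_matrix v \<chi> c b + N c b) (word_matrix u \<psi>) =
      (\<lambda>d b. y * word_matrix u (\<lambda>b. Option.bind (\<psi> b) \<chi>) d b +
        mat_comp v N (word_matrix u \<psi>) d b)"
      unfolding mat_comp_matrix[OF \<open>strict_morphism _ _ \<psi>\<close>, symmetric]
      by (simp add: mat_comp_def distrib_right sum.distrib sum_distrib_left mult.assoc)
    then show ?case
      using add \<open>strict_morphism _ _ \<psi>\<close>
      by (simp add: crystal_hom_add crystal_hom_scale crystal_hom_matrix strict_morphism_comp)
  qed
  moreover have "mat_comp v N (\<lambda>c b. x * word_matrix u \<psi> c b + M c b) =
    (\<lambda>d b. x * mat_comp v N (word_matrix u \<psi>) d b + mat_comp v N M d b)"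
    by (simp add: mat_comp_def distrib_left sum.distrib sum_distrib_left mult.left_commute)
  ultimately show ?case
    using add by (simp add: crystal_hom_add crystal_hom_scale)
qed

lemma mat_tens_matrix:
  assumes "word_strict v w \<psi>"
    "word_strict v' w' \<chi>"
  shows "mat_tens v w (word_matrix v \<psi>) (word_matrix v' \<chi>) =
    word_matrix (v @ v') (map_tensor (length v) \<psi> \<chi>)"
proof (intro ext)
  fix c b :: "node list"
  let ?b = "take (length v) b" and ?b' = "drop (length v) b"
  show "mat_tens v w (word_matrix v \<psi>) (word_matrix v' \<chi>) c b =
    word_matrix (v @ v') (map_tensor (length v) \<psi> \<chi>) c b"
  proof (cases "length b = length v + length v'")
    case True
    have "length x = length w" if "\<psi> ?b = Some x" for x
      using strict_morphismD(1)[OF assms(1), of ?b x] that True by simp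
    then have "map_tensor (length v) \<psi> \<chi> b = Some c \<longleftrightarrow>
        \<psi> ?b = Some (take (length w) c) \<and> \<chi> ?b' = Some (drop (length w) c)"
      by (cases "\<psi> ?b"; cases "\<chi> ?b'") (auto simp: map_tensor_def append_eq_conv_conj)
    then show ?thesis
      using True by (simp add: mat_tens_def crystal_matrix_def del: word_crystal.simps)
  next
    case False
    then have "length ?b \<noteq> length v \<or> length ?b' \<noteq> length v'" by auto
    then show ?thesis
      using False by (auto simp: mat_tens_def crystal_matrix_def)
  qed
qed

lemma mat_tens_hom:
  assumes "M \<in> word_hom v w" "M' \<in> word_hom v' w'"
  shows "mat_tens v w M M' \<in> word_hom (v @ v') (w @ w')"
  using assms(1)
proof (induction rule: crystal_hom_induct)
  case zero
  then show ?case by (simp add: mat_tens_def crystal_hom_zero)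
next
  case (add \<psi> x M)
  have "mat_tens v w (word_matrix v \<psi>) M' \<in> word_hom (v @ v') (w @ w')"
    using assms(2)
  proof (induction rule: crystal_hom_induct)
    case zero
    then show ?case by (simp add: mat_tens_def crystal_hom_zero)
  next
    case (add \<chi> y N)
    have "mat_tens v w (word_matrix v \<psi>) (\<lambda>c b. y * word_matrix v' \<chi> c b + N c b) =
      (\<lambda>d b. y * word_matrix (v @ v') (map_tensor (length v) \<psi> \<chi>) d b +
        mat_tens v w (word_matrix v \<psi>) N d b)"
      unfolding mat_tens_matrix[OF \<open>strict_morphism _ _ \<psi>\<close> add.hyps(1), symmetric]
      by (simp add: mat_tens_def distrib_left mult.left_commute)
    then show ?case
      using add.IH strict_morphism_tensor[OF \<open>strict_morphism _ _ \<psi>\<close> add.hyps(1)]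
      by (simp add: crystal_hom_add crystal_hom_scale crystal_hom_matrix)
  qed
  moreover have "mat_tens v w (\<lambda>c b. x * word_matrix v \<psi> c b + M c b) M' =
    (\<lambda>d b. x * mat_tens v w (word_matrix v \<psi>) M' d b + mat_tens v w M M' d b)"
    by (simp add: mat_tens_def distrib_right mult.assoc)
  ultimately show ?case
    using add by (simp add: crystal_hom_add crystal_hom_scale)
qed

lemma strict_Some: "strict_morphism B B Some"
  by (auto simp: strict_morphism_def split: option.split)

lemma mat_comp_ident:
  assumes "M \<in> word_hom v w"
  shows "mat_comp v M (word_matrix v Some) = M"
    and "mat_comp w (word_matrix w Some) M = M"
proof -
  show "mat_comp v M (word_matrix v Some) = M"
  proof (intro ext)
    fix d b
    have "mat_comp v M (word_matrix v Some) d b =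
      (\<Sum>c\<in>elts (word_crystal v). if c = b then M d b else 0)"
      unfolding mat_comp_def crystal_matrix_def by (intro sum.cong) auto
    then show "mat_comp v M (word_matrix v Some) d b = M d b"
      using finite_elts_word[of v] crystal_hom_support[OF assms, of b d] by (simp del: elts_word)
  qed
  show "mat_comp w (word_matrix w Some) M = M"
  proof (intro ext)
    fix d b
    have "mat_comp w (word_matrix w Some) M d b =
      (\<Sum>c\<in>elts (word_crystal w). if c = d then M d b else 0)"
      unfolding mat_comp_def crystal_matrix_def by (intro sum.cong) auto
    then show "mat_comp w (word_matrix w Some) M d b = M d b"
      using finite_elts_word[of w] crystal_hom_support[OF assms, of b d] by (simp del: elts_word)
  qed
qed

lemma mat_comp_assoc: "mat_comp w H (mat_comp v G F) = mat_comp v (mat_comp w H G) F"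
  unfolding mat_comp_def sum_distrib_left sum_distrib_right
  by (intro ext, subst sum.swap) (simp add: mult.assoc)

lemma sum_elts_append:
  "(\<Sum>c\<in>elts (word_crystal (v @ w)). h (take (length v) c) (drop (length v) c)) =
    (\<Sum>c\<in>elts (word_crystal v). \<Sum>d\<in>elts (word_crystal w). h c d)"
proof -
  have "(\<Sum>c\<in>elts (word_crystal v). \<Sum>d\<in>elts (word_crystal w). h c d) =
      (\<Sum>(c, d)\<in>elts (word_crystal v) \<times> elts (word_crystal w). h c d)"
    by (simp add: sum.cartesian_product)
  also have "\<dots> = (\<Sum>c\<in>elts (word_crystal (v @ w)). h (take (length v) c) (drop (length v) c))"
    by (rule sum.reindex_bij_witness[of _ "\<lambda>c. (take (length v) c, drop (length v) c)" "\<lambda>(c, d). c @ d"])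
      auto
  finally show ?thesis by simp
qed

lemma mat_interchange:
  "mat_comp (w @ w') (mat_tens w u N N') (mat_tens v w M M') =
    mat_tens v u (mat_comp w N M) (mat_comp w' N' M')"
proof (intro ext)
  fix d b :: "node list"
  let ?d1 = "take (length u) d" and ?d2 = "drop (length u) d"
  let ?b1 = "take (length v) b" and ?b2 = "drop (length v) b"
  have "mat_comp (w @ w') (mat_tens w u N N') (mat_tens v w M M') d b =
    (\<Sum>c\<in>elts (word_crystal (w @ w')). (\<lambda>x y. N ?d1 x * M x ?b1 * (N' ?d2 y * M' y ?b2))
      (take (length w) c) (drop (length w) c))"
    unfolding mat_comp_def mat_tens_def by (intro sum.cong HOL.refl) (simp add: mult_ac)
  also have "\<dots> = mat_tens v u (mat_comp w N M) (mat_comp w' N' M') d b"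
    unfolding mat_tens_def mat_comp_def sum_product by (rule sum_elts_append)
  finally show "mat_comp (w @ w') (mat_tens w u N N') (mat_tens v w M M') d b =
    mat_tens v u (mat_comp w N M) (mat_comp w' N' M') d b" .
qed

lemma mat_tens_assoc:
  "mat_tens (v @ v') (w @ w') (mat_tens v w M M') M'' = mat_tens v w M (mat_tens v' w' M' M'')"
  unfolding mat_tens_def by (intro ext) (simp add: take_drop add.commute mult.assoc)

lemma mat_tens_ident:
  "mat_tens v v (word_matrix v Some) (word_matrix w Some) =
    word_matrix (v @ w) Some"
proof -
  have "map_tensor (length v) Some Some = Some"
    by (auto simp: map_tensor_def)
  then show ?thesis using mat_tens_matrix[OF strict_Some strict_Some, of v w] by simp
qed

lemma mat_tens_unit:
  assumes "M \<in> word_hom v w"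
  shows "mat_tens [] [] (word_matrix [] Some) M = M"
    and "mat_tens v w M (word_matrix [] Some) = M"
proof -
  show "mat_tens [] [] (word_matrix [] Some) M = M"
    by (simp add: mat_tens_def crystal_matrix_def unit_crystal_def)
  show "mat_tens v w M (word_matrix [] Some) = M"
  proof (intro ext)
    fix c b :: "node list"
    show "mat_tens v w M (word_matrix [] Some) c b = M c b"
      \<comment> \<open>An index that is too long leaves a nonempty rest, on which the unit matrix
        is 0; \<open>M\<close> is 0 there too, because of its support.\<close>
      using crystal_hom_support[OF assms, of b c]
      by (cases "length b \<le> length v"; cases "length c \<le> length w")
        (auto simp: mat_tens_def crystal_matrix_def unit_crystal_def)
  qed
qed

lemma Fund_simps:
  "obj Fund = UNIV" "unit_obj Fund = []" "tens_obj Fund = (@)"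
  "f \<in> hom Fund v w \<longleftrightarrow> (\<exists>M. f = (v, w, M) \<and> M \<in> word_hom v w)"
  "ident Fund w = (w, w, word_matrix w Some)"
  "cmp Fund (v', w', N) (v, w, M) = (v, w', mat_comp w N M)"
  "tens_mor Fund (v, w, M) (v', w', N) = (v @ v', w @ w', mat_tens v w M N)"
  "zero_mor Fund v w = (v, w, \<lambda>c b. 0)"
  "add_mor Fund (v, w, M) (v', w', N) = (v, w, \<lambda>c b. M c b + N c b)"
  "scale_mor Fund x (v, w, M) = (v, w, \<lambda>c b. x * M c b)"
  by (auto simp: Fund_def fund_comp_def fund_tens_def mat_comp_def mat_tens_def)

lemma linear_moncat_Fund: "linear_moncat (Fund :: (ix list, 'k::field fund_mor, 'k) lmcat)"
  by unfold_locales
    (auto simp: Fund_simps crystal_hom_zero crystal_hom_add crystal_hom_scale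
      crystal_hom_matrix[OF strict_Some] mat_comp_hom mat_tens_hom mat_comp_ident mat_comp_assoc
      mat_interchange mat_tens_assoc mat_tens_ident mat_tens_unit add_ac mult.assoc
      simp del: word_crystal.simps,
      (auto simp: mat_comp_def mat_tens_def distrib_left distrib_right sum.distrib sum_distrib_left
        mult_ac)?)

interpretation Fund: word_moncat Fund
  using linear_moncat_Fund by (simp add: word_moncat_def word_moncat_axioms_def Fund_simps)

section \<open>The generating crystal morphisms\<close>

text \<open>The values come from the highest weight elements. On two equal letters Top Mid is
  annihilated by both \<open>e\<close> and lies on the path Top Mid, Top Bot, Mid Bot, a copy of the
  other fundamental crystal. On two different letters Top Bot is the trivial component; the beta
  follows the arrows below Top Top, which reach the other eight elements, and fixes Top Bot.\<close>

fun sym_map :: "sym \<Rightarrow> node list \<Rightarrow> node list option" where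
  "sym_map (Sym_m i) b =
    (if b = [Top, Mid] then Some [Top] else if b = [Top, Bot] then Some [Mid]
     else if b = [Mid, Bot] then Some [Bot] else None)"
| "sym_map (Sym_s i) b =
    (if b = [Top] then Some [Top, Mid] else if b = [Mid] then Some [Top, Bot]
     else if b = [Bot] then Some [Mid, Bot] else None)"
| "sym_map (Sym_c i) b = (if b = [Top, Bot] then Some [] else None)"
| "sym_map (Sym_u i) b = (if b = [] then Some [Top, Bot] else None)"
| "sym_map (Sym_b i) b =
    (if b = [Top, Mid] then Some [Mid, Top] else if b = [Mid, Top] then Some [Top, Mid]
     else if b = [Mid, Mid] then Some [Bot, Top] else if b = [Bot, Top] then Some [Mid, Mid]
     else if b = [Bot, Mid] then Some [Mid, Bot] else if b = [Mid, Bot] then Some [Bot, Mid]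
     else if b = [Top, Top] \<or> b = [Top, Bot] \<or> b = [Bot, Bot] then Some b else None)"

lemma all_node: "(\<forall>x. P x) \<longleftrightarrow> P Top \<and> P Mid \<and> P Bot"
  by (metis node.exhaust)

lemma all_ix: "(\<forall>x. P x) \<longleftrightarrow> P I1 \<and> P I2"
  by (metis ix.exhaust)

lemma all_length:
  "(\<forall>b. length b = 0 \<longrightarrow> P b) \<longleftrightarrow> P []"
  "(\<forall>b. length b = Suc n \<longrightarrow> P b) \<longleftrightarrow> (\<forall>x b. length b = n \<longrightarrow> P (x # b))"
  by (auto simp: length_Suc_conv)

lemma crystal_words_short:
  "wwt [] [] = (\<lambda>_. 0)" "wke [] k [] = None" "wkf [] k [] = None"
  "wwt [i] [a] = wt (fund_crystal i) a"
  "wke [i] k [a] = map_option (\<lambda>x. [x]) (ke (fund_crystal i) k a)"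
  "wkf [i] k [a] = map_option (\<lambda>x. [x]) (kf (fund_crystal i) k a)"
  "wwt [i, j] [a, b] = (\<lambda>k. wt (fund_crystal i) a k + wt (fund_crystal j) b k)"
  "wke [i, j] k [a, b] = (if phi (fund_crystal i) k a \<ge> eps (fund_crystal j) k b
     then map_option (\<lambda>x. [x, b]) (ke (fund_crystal i) k a)
     else map_option (\<lambda>x. [a, x]) (ke (fund_crystal j) k b))"
  "wkf [i, j] k [a, b] = (if phi (fund_crystal i) k a > eps (fund_crystal j) k b
     then map_option (\<lambda>x. [x, b]) (kf (fund_crystal i) k a)
     else map_option (\<lambda>x. [a, x]) (kf (fund_crystal j) k b))"
proof -
  show 0: "wwt [] [] = (\<lambda>_. 0)" "wke [] k [] = None" "wkf [] k [] = None"
    by (simp_all add: unit_crystal_def)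
  show 1: "wwt [i] [a] = wt (fund_crystal i) a" for i a
    by (rule ext) (simp add: cons_crystal_simps, simp add: unit_crystal_def)
  have e: "weps [i] k [a] = eps (fund_crystal i) k a" for i a
    using word_Cons(1)[of "[]" "[]" i k a] eps_phi_unit by simp
  show 2: "wke [i] k [a] = map_option (\<lambda>x. [x]) (ke (fund_crystal i) k a)"
     "wkf [i] k [a] = map_option (\<lambda>x. [x]) (kf (fund_crystal i) k a)" for i a
    using string_dataD(3)[OF string_fund, of a i k] eps_phi_unit[of k]
    by (cases "kf (fund_crystal i) k a"; simp add: cons_crystal_simps eps_phi_fund; simp add: unit_crystal_def)+
  show "wwt [i, j] [a, b] = (\<lambda>k. wt (fund_crystal i) a k + wt (fund_crystal j) b k)"
    using 1[of j b] by (intro ext) (simp add: cons_crystal_simps fun_eq_iff)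
  show "wke [i, j] k [a, b] = (if phi (fund_crystal i) k a \<ge> eps (fund_crystal j) k b
     then map_option (\<lambda>x. [x, b]) (ke (fund_crystal i) k a)
     else map_option (\<lambda>x. [a, x]) (ke (fund_crystal j) k b))"
    "wkf [i, j] k [a, b] = (if phi (fund_crystal i) k a > eps (fund_crystal j) k b
     then map_option (\<lambda>x. [x, b]) (kf (fund_crystal i) k a)
     else map_option (\<lambda>x. [a, x]) (kf (fund_crystal j) k b))"
    using e[of j b] 2[of j b] by (simp_all add: cons_crystal_simps(3,4) option.map_comp comp_def
       word_crystal.simps(2)[of i] del: word_crystal.simps)
qed

lemma fund_simps:
  "wt (fund_crystal i) Top k = (if k = i then 1 else 0)"
  "wt (fund_crystal i) Mid k = (if k = i then - 1 else 1)"
  "wt (fund_crystal i) Bot k = (if k = i then 0 else - 1)"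
  "ke (fund_crystal i) k Top = None"
  "ke (fund_crystal i) k Mid = (if k = i then Some Top else None)"
  "ke (fund_crystal i) k Bot = (if k = op_ix i then Some Mid else None)"
  "kf (fund_crystal i) k Top = (if k = i then Some Mid else None)"
  "kf (fund_crystal i) k Mid = (if k = op_ix i then Some Bot else None)"
  "kf (fund_crystal i) k Bot = None"
  by (simp_all add: fund_crystal_def)

lemmas short_simps = all_length all_node all_ix crystal_words_short eps_phi_fund fund_simps fun_eq_iff

text \<open>With the quantifier over \<open>c\<close> replaced by a case distinction on the value of
  the map, the condition on short words is a finite table that simplification can check.\<close>

lemma strict_morphism_iff:
  "strict_morphism B C \<psi> \<longleftrightarrow> (\<forall>b\<in>elts B.
     (case \<psi> b of None \<Rightarrow> True | Some c \<Rightarrow> c \<in> elts C \<and> wt C c = wt B b) \<and>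
     (\<forall>i. Option.bind (ke B i b) \<psi> = Option.bind (\<psi> b) (ke C i) \<and>
          Option.bind (kf B i b) \<psi> = Option.bind (\<psi> b) (kf C i)))"
proof -
  have "(case \<psi> b of None \<Rightarrow> True | Some c \<Rightarrow> c \<in> elts C \<and> wt C c = wt B b) \<longleftrightarrow>
      (\<forall>c. \<psi> b = Some c \<longrightarrow> c \<in> elts C \<and> wt C c = wt B b)" for b
    by (cases "\<psi> b") auto
  then show ?thesis unfolding strict_morphism_def by blast
qed

lemma strict_sym_map:
  "word_strict (sym_dom s) (sym_cod s) (sym_map s)"
proof -
  have "\<forall>b. length b = length (sym_dom s) \<longrightarrow>
      (case sym_map s b of None \<Rightarrow> True
       | Some c \<Rightarrow> length c = length (sym_cod s) \<and> wwt (sym_cod s) c = wwt (sym_dom s) b) \<and>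
      (\<forall>i. Option.bind (wke (sym_dom s) i b) (sym_map s) =
         Option.bind (sym_map s b) (wke (sym_cod s) i) \<and>
         Option.bind (wkf (sym_dom s) i b) (sym_map s) =
         Option.bind (sym_map s b) (wkf (sym_cod s) i))"
    by (cases s; rename_tac i; case_tac i; simp add: short_simps del: word_crystal.simps)
  then show ?thesis
    unfolding strict_morphism_iff elts_word Ball_def mem_Collect_eq by blast
qed

definition sym_mor :: "sym \<Rightarrow> 'k::field fund_mor" where
  "sym_mor s = (sym_dom s, sym_cod s, word_matrix (sym_dom s) (sym_map s))"

interpretation fund: interpretation_moncat Fund sym_dom sym_cod sym_mor
  by unfold_locales (auto simp: Fund_simps sym_mor_def crystal_hom_matrix strict_sym_map)

section \<open>Evaluation of expressions on basis elements\<close>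

fun tm_map :: "(ix, sym, 'k) tm \<Rightarrow> node list \<Rightarrow> node list option" where
  "tm_map (Gen s) b = sym_map s b"
| "tm_map (Ident a) b = Some b"
| "tm_map (Comp g f) b = Option.bind (tm_map f b) (tm_map g)"
| "tm_map (Tens f g) b = map_tensor (length (tm_dom sym_dom f)) (tm_map f) (tm_map g) b"
| "tm_map _ b = None"

text \<open>Without sums and scalars an expression evaluates to a partial map of basis elements, so
  composites are computed without matrix products. The default \<open>None\<close> in
  \<open>tm_map\<close> is the true value for \<open>Zero\<close> and a placeholder for sums and
  multiples, which \<open>polynomial\<close> admits only on the outside.\<close>

fun monomial :: "(ix, sym, 'k) tm \<Rightarrow> bool" where
  "monomial (Comp g f) \<longleftrightarrow> monomial g \<and> monomial f"
| "monomial (Tens f g) \<longleftrightarrow> monomial f \<and> monomial g"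
| "monomial (Add f g) \<longleftrightarrow> False"
| "monomial (Scale x f) \<longleftrightarrow> False"
| "monomial _ \<longleftrightarrow> True"

fun polynomial :: "(ix, sym, 'k) tm \<Rightarrow> bool" where
  "polynomial (Add f g) \<longleftrightarrow> polynomial f \<and> polynomial g"
| "polynomial (Scale x f) \<longleftrightarrow> polynomial f"
| "polynomial t \<longleftrightarrow> monomial t"

fun tm_coeff :: "(ix, sym, 'k::field) tm \<Rightarrow> node list \<Rightarrow> node list \<Rightarrow> 'k" where
  "tm_coeff (Add f g) c b = tm_coeff f c b + tm_coeff g c b"
| "tm_coeff (Scale x f) c b = x * tm_coeff f c b"
| "tm_coeff t c b = (if tm_map t b = Some c then 1 else 0)"

abbreviation sym_wf :: "(ix, sym, 'k) tm \<Rightarrow> bool" where "sym_wf \<equiv> tm_wf sym_dom sym_cod"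

lemma strict_None: "strict_morphism B C (\<lambda>_. None)"
  by (auto simp: strict_morphism_def split: option.split)

lemma ev_monomial:
  fixes t :: "(ix, sym, 'k::field) tm"
  assumes "sym_wf t" "monomial t"
  shows "word_strict (tm_dom sym_dom t) (tm_cod sym_cod t) (tm_map t) \<and>
    fund.ev t = (tm_dom sym_dom t, tm_cod sym_cod t, word_matrix (tm_dom sym_dom t) (tm_map t))"
  using assms
proof (induction t)
  case (Gen s)
  have "tm_map (Gen s) = sym_map s" by (rule ext) simp
  moreover have "fund.ev (Gen s) = (sym_dom s, sym_cod s, word_matrix (sym_dom s) (sym_map s))"
    unfolding fund.ev.simps by (rule sym_mor_def)
  ultimately show ?case using strict_sym_map[of s] by simp
next
  case (Ident a)
  have "tm_map (Ident a :: (ix, sym, 'k) tm) = Some" by (rule ext) simp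
  then show ?case by (simp add: strict_Some Fund_simps)
next
  case (Zero a b)
  have "tm_map (Zero a b :: (ix, sym, 'k) tm) = (\<lambda>_. None)" by (rule ext) simp
  then show ?case by (simp add: strict_None Fund_simps crystal_matrix_def)
next
  case (Comp g f)
  have "tm_map (Comp g f) = (\<lambda>b. Option.bind (tm_map f b) (tm_map g))" by (rule ext) simp
  then show ?case
    using Comp mat_comp_matrix[of "tm_dom sym_dom f" "tm_cod sym_cod f" "tm_map f" "tm_map g"]
      strict_morphism_comp[of "word_crystal (tm_dom sym_dom f)" "word_crystal (tm_cod sym_cod f)" "tm_map f"
        "word_crystal (tm_cod sym_cod g)" "tm_map g"]
    by (simp add: Fund_simps)
next
  case (Tens f g)
  have "tm_map (Tens f g) = map_tensor (length (tm_dom sym_dom f)) (tm_map f) (tm_map g)" by (rule ext) simp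
  then show ?case
    using Tens mat_tens_matrix[of "tm_dom sym_dom f" "tm_cod sym_cod f" "tm_map f"
        "tm_dom sym_dom g" "tm_cod sym_cod g" "tm_map g"]
      strict_morphism_tensor[of "tm_dom sym_dom f" "tm_cod sym_cod f" "tm_map f"
        "tm_dom sym_dom g" "tm_cod sym_cod g" "tm_map g"]
    by (simp add: Fund_simps)
qed auto

lemma tm_coeff_monomial: "monomial t \<Longrightarrow> tm_coeff t c b = (if tm_map t b = Some c then 1 else 0)"
  by (cases t) auto

lemma ev_monomial_coeff:
  fixes t :: "(ix, sym, 'k::field) tm"
  assumes "sym_wf t" "monomial t"
  shows "fund.ev t = (tm_dom sym_dom t, tm_cod sym_cod t,
    \<lambda>c b. if length b = length (tm_dom sym_dom t) then tm_coeff t c b else 0)"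
proof -
  have "word_matrix (tm_dom sym_dom t) (tm_map t) =
      (\<lambda>c b. if length b = length (tm_dom sym_dom t) then tm_coeff t c b else 0)"
    by (intro ext) (simp add: crystal_matrix_def tm_coeff_monomial[OF assms(2)])
  then show ?thesis using ev_monomial[OF assms] by simp
qed

lemma ev_polynomial:
  fixes t :: "(ix, sym, 'k::field) tm"
  assumes "sym_wf t" "polynomial t"
  shows "fund.ev t = (tm_dom sym_dom t, tm_cod sym_cod t,
    \<lambda>c b. if length b = length (tm_dom sym_dom t) then tm_coeff t c b else 0)"
  using assms
proof (induction t)
  case (Add f g)
  then show ?case by (auto simp: Fund_simps fun_eq_iff)
next
  case (Scale x f)
  then show ?case by (auto simp: Fund_simps fun_eq_iff)
qed (rule ev_monomial_coeff; simp)+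

lemma ev_eqI:
  fixes t s :: "(ix, sym, 'k::field) tm"
  assumes "sym_wf t \<and> sym_wf s \<and> polynomial t \<and> polynomial s \<and> tm_dom sym_dom t = tm_dom sym_dom s \<and>
      tm_cod sym_cod t = tm_cod sym_cod s"
    and "\<forall>b. length b = length (tm_dom sym_dom s) \<longrightarrow> (\<forall>c. tm_coeff t c b = tm_coeff s c b)"
  shows "fund.ev t = fund.ev s"
  using assms by (auto simp: ev_polynomial fun_eq_iff)

text \<open>All relations and their reflections start at words of at most three letters, so each is
  a comparison of coefficients on at most 27 basis elements.\<close>

lemma fund_relations:
  fixes t t' :: "(ix, sym, 'k::field) tm"
  assumes "sl3_rel t t'" "\<rho> \<in> {id, vrefl, hrefl, vrefl \<circ> hrefl}"
  shows "fund.ev (\<rho> t) = fund.ev (\<rho> t')"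
proof -
  have "\<rho> = id \<or> \<rho> = vrefl \<or> \<rho> = hrefl \<or> \<rho> = vrefl \<circ> hrefl" using assms(2) by blast
  with assms(1) show ?thesis
    by (induction rule: sl3_rel.induct; elim disjE; intro ev_eqI;
      simp add: all_length all_node map_tensor_def)
qed

section \<open>The presented category as an interpretation\<close>

interpretation pres: presentation gen_dom gen_cod sl3_relations .

interpretation pres: word_moncat "pres.Pr"
  using pres.linear_moncat_presented by (simp add: word_moncat_def word_moncat_axioms_def)

lemma gen_tm_typed:
  "tm_wf gen_dom gen_cod (sym_tm s)" "tm_dom gen_dom (sym_tm s) = sym_dom s"
  "tm_cod gen_cod (sym_tm s) = sym_cod s"
  by (induction s rule: sym_tm.induct; simp)+

lemma expand_typed:
  assumes "sym_wf t"
  shows "tm_wf gen_dom gen_cod (expand t) \<and> tm_dom gen_dom (expand t) = tm_dom sym_dom t \<and>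
    tm_cod gen_cod (expand t) = tm_cod sym_cod t"
  using assms by (induction t) (auto simp: gen_tm_typed)

interpretation pres: interpretation_moncat "pres.Pr" sym_dom sym_cod sym_class
proof unfold_locales
  show "sym_class s \<in> hom pres.Pr (sym_dom s) (sym_cod s)" for s
    unfolding sym_class_def pres.hom_Pr using gen_tm_typed by blast
qed

lemma ev_pres: "sym_wf t \<Longrightarrow> pres.ev t = pres.cls (expand t)"
  by (induction t) (auto simp: expand_typed pres.ops_Pr sym_class_def)

lemma sl3_rel_sym_wf:
  assumes "sl3_rel t t'" "\<rho> \<in> {id, vrefl, hrefl, vrefl \<circ> hrefl}"
  shows "sym_wf (\<rho> t) \<and> sym_wf (\<rho> t')"
proof -
  have "\<rho> = id \<or> \<rho> = vrefl \<or> \<rho> = hrefl \<or> \<rho> = vrefl \<circ> hrefl" using assms(2) by blast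
  with assms(1) show ?thesis
    by (induction rule: sl3_rel.induct; elim disjE; simp)
qed

text \<open>A section of \<open>expand\<close>. It exhibits every morphism of the presented category
  as the value of an expression in the ten symbols, and it links evaluation over six generators with
  evaluation over ten symbols.\<close>

definition gen_embed :: "(ix, gen, 'k) tm \<Rightarrow> (ix, sym, 'k) tm" where
  "gen_embed = map_tm id gen_sym id"

lemma gen_embed_simps [simp]:
  "gen_embed (Gen x) = Gen (gen_sym x)" "gen_embed (Ident a) = Ident a" "gen_embed (Zero a b) = Zero a b"
  "gen_embed (Comp g f) = Comp (gen_embed g) (gen_embed f)"
  "gen_embed (Tens f g) = Tens (gen_embed f) (gen_embed g)"
  "gen_embed (Add f g) = Add (gen_embed f) (gen_embed g)"
  "gen_embed (Scale c f) = Scale c (gen_embed f)"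
  by (simp_all add: gen_embed_def)

lemma expand_gen_embed [simp]: "expand (gen_embed t) = t"
proof (induction t)
  case (Gen x)
  then show ?case by (cases x) simp_all
qed simp_all

lemma gen_embed_typed:
  "tm_dom sym_dom (gen_embed t) = tm_dom gen_dom t" "tm_cod sym_cod (gen_embed t) = tm_cod gen_cod t"
  "sym_wf (gen_embed t) = tm_wf gen_dom gen_cod t"
proof -
  show 1: "tm_dom sym_dom (gen_embed t) = tm_dom gen_dom t" for t :: "(ix, gen, 'a) tm"
    by (induction t) simp_all
  show 2: "tm_cod sym_cod (gen_embed t) = tm_cod gen_cod t" for t :: "(ix, gen, 'a) tm"
    by (induction t) simp_all
  show "sym_wf (gen_embed t) = tm_wf gen_dom gen_cod t"
    by (induction t) (simp_all add: 1 2)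
qed

interpretation pres: sl3_generated
  "pres.Pr :: (ix list, (ix, gen, 'k::field) tm set, 'k) lmcat" sym_class
proof unfold_locales
  fix t t' :: "(ix, sym, 'k) tm" and \<rho> :: "(ix, sym, 'k) tm \<Rightarrow> (ix, sym, 'k) tm"
  assume r: "sl3_rel t t'" "\<rho> \<in> {id, vrefl, hrefl, vrefl \<circ> hrefl}"
  then have rel: "(expand (\<rho> t), expand (\<rho> t')) \<in> sl3_relations"
    unfolding sl3_relations_def by blast
  then obtain a b where "tm_typed gen_dom gen_cod (expand (\<rho> t)) a b"
      "tm_typed gen_dom gen_cod (expand (\<rho> t')) a b"
    using sl3_relations_typed by blast
  with rel have "pres.cls (expand (\<rho> t)) = pres.cls (expand (\<rho> t'))"
    by (intro pres.cls_eqI tm_eq.rel)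
  then show "pres.ev (\<rho> t) = pres.ev (\<rho> t')"
    using sl3_rel_sym_wf[OF r] by (simp add: ev_pres)
next
  fix f assume "pres.arr f"
  then obtain t where t: "f = pres.cls t" "tm_wf gen_dom gen_cod t"
    unfolding pres.arr_def pres.hom_Pr by blast
  then show "\<exists>t. sym_wf t \<and> f = pres.ev t"
    by (intro exI[of _ "gen_embed t"]) (simp add: gen_embed_typed ev_pres)
qed

interpretation fund: sl3_category Fund sym_mor
  by unfold_locales (rule fund_relations)

section \<open>The functor\<close>

interpretation fund_gen: interpretation_moncat Fund gen_dom gen_cod "\<lambda>x. sym_mor (gen_sym x)"
  by unfold_locales (rule fund.gen_hom)

lemma fund_gen_ev: "fund_gen.ev t = fund.ev (gen_embed t)"
  by (induction t) simp_all

text \<open>The content lies in the four abbreviated symbols: the partial maps written down for them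
  agree with the expressions in the generators that define them.\<close>

lemma fund_ev_sym_tm: "fund.ev (gen_embed (sym_tm s)) = sym_mor s"
proof -
  have "fund.ev (gen_embed (sym_tm s)) = fund.ev (Gen s)"
  proof (rule ev_eqI)
    show "sym_wf (gen_embed (sym_tm s)) \<and> sym_wf (Gen s) \<and> polynomial (gen_embed (sym_tm s)) \<and>
      polynomial (Gen s) \<and> tm_dom sym_dom (gen_embed (sym_tm s)) = tm_dom sym_dom (Gen s) \<and>
      tm_cod sym_cod (gen_embed (sym_tm s)) = tm_cod sym_cod (Gen s)"
      by (induction s rule: sym_tm.induct) simp_all
    show "\<forall>b. length b = length (tm_dom sym_dom (Gen s)) \<longrightarrow>
      (\<forall>c. tm_coeff (gen_embed (sym_tm s)) c b = tm_coeff (Gen s) c b)"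
      by (induction s rule: sym_tm.induct) (simp_all add: all_length all_node map_tensor_def)
  qed
  then show ?thesis by simp
qed

lemma fund_gen_ev_expand: "fund_gen.ev (expand t) = fund.ev t"
  by (induction t) (simp_all add: fund_gen_ev fund_ev_sym_tm)

lemma fund_gen_ev_eq:
  assumes "tm_eq gen_dom gen_cod sl3_relations a b t s"
  shows "fund_gen.ev t = fund_gen.ev s"
  using assms
proof (rule fund_gen.ev_tm_eq)
  fix t s :: "(ix, gen, 'a) tm" assume "(t, s) \<in> sl3_relations"
  then obtain \<rho> and u u' :: "(ix, sym, 'a) tm" where "t = expand (\<rho> u)" "s = expand (\<rho> u')"
      "sl3_rel u u'" "\<rho> \<in> {id, vrefl, hrefl, vrefl \<circ> hrefl}"
    unfolding sl3_relations_def by blast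
  then show "fund_gen.ev t = fund_gen.ev s"
    using fund_relations[of u u' \<rho>] by (simp only: fund_gen_ev_expand)
qed

text \<open>By \<open>fund_gen_ev_eq\<close> the value does not depend on the representative
  chosen.\<close>

definition realize :: "(ix, gen, 'k::field) tm set \<Rightarrow> 'k fund_mor" where
  "realize X = fund_gen.ev (SOME t. t \<in> X)"

lemma realize_cls:
  assumes "tm_wf gen_dom gen_cod t"
  shows "realize (pres.cls t) = fund_gen.ev t"
proof -
  have "(SOME s. s \<in> pres.cls t) \<in> pres.cls t"
    using pres.cls_self[OF assms] by (rule someI)
  then show ?thesis
    unfolding realize_def using fund_gen_ev_eq pres.cls_mem by metis
qed

lemma realize_ev: "sym_wf t \<Longrightarrow> realize (pres.ev t) = fund.ev t"
  by (simp add: ev_pres realize_cls expand_typed fund_gen_ev_expand)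

lemma realize_arr:
  assumes "pres.arr f"
  shows "Fund.arr (realize f)" "Fund.src (realize f) = pres.src f" "Fund.tgt (realize f) = pres.tgt f"
  using pres.generated[OF assms] by (auto simp: realize_ev)

lemma realize_comp:
  assumes "pres.arr f" "pres.arr g" "pres.tgt f = pres.src g"
  shows "realize (cmp pres.Pr g f) = cmp Fund (realize g) (realize f)"
proof -
  obtain t s where t: "sym_wf t" "f = pres.ev t" and s: "sym_wf s" "g = pres.ev s"
    using pres.generated assms by metis
  then show ?thesis
    using realize_ev[of "Comp s t"] assms by (simp add: realize_ev)
qed

lemma realize_tens:
  assumes "pres.arr f" "pres.arr g"
  shows "realize (tens_mor pres.Pr f g) = tens_mor Fund (realize f) (realize g)"
proof -
  obtain t s where t: "sym_wf t" "f = pres.ev t" and s: "sym_wf s" "g = pres.ev s"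
    using pres.generated assms by metis
  then show ?thesis
    using realize_ev[of "Tens t s"] by (simp add: realize_ev)
qed

lemma realize_add:
  assumes "pres.arr f" "pres.arr g" "pres.src g = pres.src f" "pres.tgt g = pres.tgt f"
  shows "realize (add_mor pres.Pr f g) = add_mor Fund (realize f) (realize g)"
proof -
  obtain t s where t: "sym_wf t" "f = pres.ev t" and s: "sym_wf s" "g = pres.ev s"
    using pres.generated assms by metis
  then show ?thesis
    using realize_ev[of "Add t s"] assms by (simp add: realize_ev)
qed

lemma realize_scale:
  assumes "pres.arr f"
  shows "realize (scale_mor pres.Pr x f) = scale_mor Fund x (realize f)"
proof -
  obtain t where t: "sym_wf t" "f = pres.ev t"
    using pres.generated assms by metis
  then show ?thesis
    using realize_ev[of "Scale x t"] by (simp add: realize_ev)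
qed

lemma realize_ident: "realize (ident pres.Pr a) = ident Fund a"
  using realize_ev[of "Ident a"] by simp

lemma realize_zero: "realize (zero_mor pres.Pr a b) = zero_mor Fund a b"
  using realize_ev[of "Zero a b"] by simp

lemma realize_sym: "realize (sym_class s) = sym_mor s"
  using realize_ev[of "Gen s"] by simp

lemma realize_act:
  assumes "sym_wf t" "pres.arr f" "pres.tgt f = l @ tm_dom sym_dom t @ r"
  shows "realize (pres.act l t r f) = fund.act l t r (realize f)"
  unfolding pres.act_def fund.act_def
  using assms by (simp add: realize_comp realize_tens realize_ident realize_ev)

lemma realize_kill_dn:
  "\<lbrakk>pres.arr f; pres.tgt f = l @ u\<rbrakk> \<Longrightarrow> realize (pres.kill_dn l u f) = fund.kill_dn l u (realize f)"
  by (induction l u f rule: pres.kill_dn.induct)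
    (simp_all add: Let_def realize_add realize_scale realize_act realize_arr pres.kill_dn_arr)

lemma realize_kill_up:
  "\<lbrakk>pres.arr f; pres.tgt f = l @ u\<rbrakk> \<Longrightarrow> realize (pres.kill_up l u f) = fund.kill_up l u (realize f)"
  by (induction l u f rule: pres.kill_up.induct)
    (simp_all add: realize_add realize_scale realize_act realize_arr)

lemma realize_top_proj: "realize (pres.top_proj w) = fund.top_proj w"
  unfolding pres.top_proj_def fund.top_proj_def
  by (subst realize_kill_dn; (subst realize_kill_up)?)
    (simp_all add: pres.kill_up_arr[of _ "[]", simplified] realize_ident)

section \<open>Schur's lemma for crystals\<close>

lemma fund_arr_iff: "Fund.arr (v, w, M) \<longleftrightarrow> M \<in> word_hom v w"
  unfolding Fund.arr_def Fund_simps(4) by auto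

lemma fund_src_tgt: "M \<in> word_hom v w \<Longrightarrow> Fund.src (v, w, M) = v \<and> Fund.tgt (v, w, M) = w"
  using Fund.hom_iff[of "(v, w, M)" v w] by (auto simp: Fund_simps(4))

lemma fund_arrE:
  assumes "Fund.arr f" "Fund.src f = v" "Fund.tgt f = w"
  obtains M where "f = (v, w, M)" "M \<in> word_hom v w"
proof -
  obtain v' w' M where "f = (v', w', M)" by (cases f) auto
  then show ?thesis using that assms fund_arr_iff fund_src_tgt by metis
qed

definition top_mat :: "ix list \<Rightarrow> node list \<Rightarrow> node list \<Rightarrow> 'k::field" where
  "top_mat w = snd (snd (fund.top_proj w))"

lemma top_mat:
  "(fund.top_proj w :: 'k::field fund_mor) = (w, w, top_mat w)"
  "(top_mat w :: node list \<Rightarrow> node list \<Rightarrow> 'k) \<in> word_hom w w"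
proof -
  let ?E = "fund.top_proj w :: 'k fund_mor"
  obtain M where "?E = (w, w, M)" "M \<in> word_hom w w"
    by (rule fund_arrE[OF fund.top_proj_arr])
  then show "?E = (w, w, top_mat w)" "(top_mat w :: node list \<Rightarrow> node list \<Rightarrow> 'k) \<in> word_hom w w"
    by (simp_all add: top_mat_def)
qed

text \<open>The partial map of a single layer. Scalars do not occur in it, and the scalar type
  \<open>unit\<close> keeps it independent of the field.\<close>

definition ctx_map :: "ix list \<Rightarrow> sym \<Rightarrow> ix list \<Rightarrow> node list \<Rightarrow> node list option" where
  "ctx_map l s r = tm_map (Tens (Ident l) (Tens (Gen s) (Ident r)) :: (ix, sym, unit) tm)"

lemma ctx_map_append:
  assumes "length c1 = length l" "length p = length (sym_dom s)"
  shows "ctx_map l s r (c1 @ p @ c2) = map_option (\<lambda>q. c1 @ q @ c2) (sym_map s p)"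
  using assms by (cases "sym_map s p") (simp_all add: ctx_map_def map_tensor_def)

lemma fund_ap:
  assumes "X \<in> word_hom z (l @ sym_dom s @ r)"
  shows "fund.ap l s r (z, l @ sym_dom s @ r, X) =
    (z, l @ sym_cod s @ r,
      mat_comp (l @ sym_dom s @ r) (word_matrix (l @ sym_dom s @ r) (ctx_map l s r)) X)"
proof -
  have m: "tm_map (Tens (Ident l) (Tens (Gen s) (Ident r)) :: (ix, sym, 'a) tm) = ctx_map l s r"
    by (rule ext) (simp add: ctx_map_def map_tensor_def)
  have "fund.ap l s r (z, l @ sym_dom s @ r, X) =
      cmp Fund (fund.ev (Tens (Ident l) (Tens (Gen s) (Ident r)))) (z, l @ sym_dom s @ r, X)"
    by (simp add: fund.act_def)
  then show ?thesis
    using ev_monomial[of "Tens (Ident l) (Tens (Gen s) (Ident r)) :: (ix, sym, 'a) tm"]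
    by (simp add: m Fund_simps del: fund.ev.simps)
qed

text \<open>The generating morphisms are partial permutation matrices, so that multiplying by a
  layer only relocates rows or columns.\<close>

lemma sym_map_inj: "sym_map s p = Some q \<Longrightarrow> sym_map s p' = Some q \<Longrightarrow> p = p'"
  by (cases s) (auto split: if_splits)

lemma sym_map_length: "sym_map s p = Some q \<Longrightarrow> length p = length (sym_dom s) \<and> length q = length (sym_cod s)"
  by (cases s) (auto split: if_splits)

lemma sym_map_dn_up: "sym_map (dn x y) p = Some q \<Longrightarrow> sym_map (up x y) q = Some p"
  by (auto simp: dn_def up_def split: if_splits)

text \<open>Top Top lies in the top component, whereas \<open>up\<close> embeds the other
  one.\<close>

lemma sym_map_up_Top: "sym_map (up x y) q \<noteq> Some [Top, Top]"
  by (auto simp: up_def)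

lemma ctx_map_SomeE:
  assumes "ctx_map l s r c = Some d" "length c = length (l @ sym_dom s @ r)"
  obtains c1 p q c2 where "c = c1 @ p @ c2" "d = c1 @ q @ c2" "length c1 = length l"
    "sym_map s p = Some q" "length c2 = length r"
proof -
  let ?c1 = "take (length l) c" and ?p = "take (length (sym_dom s)) (drop (length l) c)"
    and ?c2 = "drop (length (sym_dom s)) (drop (length l) c)"
  have c: "c = ?c1 @ ?p @ ?c2" by (simp only: append_take_drop_id)
  have l: "length ?c1 = length l" "length ?p = length (sym_dom s)" "length ?c2 = length r"
    using assms(2) by simp_all
  have "map_option (\<lambda>q. ?c1 @ q @ ?c2) (sym_map s ?p) = Some d"
    using ctx_map_append[OF l(1,2), of r ?c2] assms(1) c by metis
  then obtain q where "sym_map s ?p = Some q" "d = ?c1 @ q @ ?c2" by auto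
  then show ?thesis using that c l by blast
qed

lemma ctx_map_inj:
  assumes "ctx_map l s r c = Some d" "ctx_map l s r c' = Some d"
    "length c = length (l @ sym_dom s @ r)" "length c' = length (l @ sym_dom s @ r)"
  shows "c = c'"
proof -
  obtain c1 p q c2 where c: "c = c1 @ p @ c2" "d = c1 @ q @ c2" "length c1 = length l"
    "sym_map s p = Some q" "length c2 = length r"
    using ctx_map_SomeE[OF assms(1,3)] .
  obtain c1' p' q' c2' where c': "c' = c1' @ p' @ c2'" "d = c1' @ q' @ c2'" "length c1' = length l"
    "sym_map s p' = Some q'" "length c2' = length r"
    using ctx_map_SomeE[OF assms(2,4)] .
  have "c1 = c1'" "q = q'" "c2 = c2'"
    using c(2,3,5) c'(2,3,5) by auto
  then show ?thesis using c c' sym_map_inj[of s p q p'] by simp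
qed

lemma mat_comp_partial_row:
  assumes "c \<in> elts (word_crystal w)" "\<psi> c = Some d"
    "\<And>c'. c' \<in> elts (word_crystal w) \<Longrightarrow> \<psi> c' = Some d \<Longrightarrow> c' = c"
  shows "mat_comp w (word_matrix w \<psi>) X d b = X c b"
proof -
  have "mat_comp w (word_matrix w \<psi>) X d b =
      (\<Sum>c'\<in>elts (word_crystal w). if c' = c then X c b else 0)"
    unfolding mat_comp_def crystal_matrix_def
  proof (intro sum.cong HOL.refl)
    fix c' assume c': "c' \<in> elts (word_crystal w)"
    have "\<psi> c' = Some d \<longleftrightarrow> c' = c" using assms(2) assms(3)[OF c'] by blast
    then show "(if c' \<in> elts (word_crystal w) \<and> \<psi> c' = Some d then 1 else 0) * X c' b =
        (if c' = c then X c b else 0)"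
      using c' by (simp del: elts_word)
  qed
  then show ?thesis using assms(1) finite_elts_word[of w] by (simp del: elts_word)
qed

lemma mat_comp_partial_col:
  assumes "b \<in> elts (word_crystal v)" "\<psi> b = Some c" "c \<in> elts (word_crystal w)"
  shows "mat_comp w X (word_matrix v \<psi>) d b = X d c"
proof -
  have "mat_comp w X (word_matrix v \<psi>) d b =
      (\<Sum>c'\<in>elts (word_crystal w). if c' = c then X d c else 0)"
    unfolding mat_comp_def crystal_matrix_def
    by (intro sum.cong HOL.refl) (simp add: assms(1,2) del: elts_word)
  then show ?thesis using assms(3) finite_elts_word[of w] by (simp del: elts_word)
qed

text \<open>For \<open>c\<close> of the length of \<open>w\<close>, this describes the basis
  elements that every \<open>dn\<close> layer annihilates.\<close>

definition reduced :: "ix list \<Rightarrow> node list \<Rightarrow> bool" where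
  "reduced w c \<longleftrightarrow> (\<forall>l x y r c1 a b c2. w = l @ x # y # r \<longrightarrow> c = c1 @ a # b # c2 \<longrightarrow>
     length c1 = length l \<longrightarrow> sym_map (dn x y) [a, b] = None)"

text \<open>For rows: \<open>dn\<close> annihilates \<open>top_proj\<close> from the left, and as an
  injective partial map it moves row \<open>c\<close> unchanged to another place. For columns:
  \<open>c\<close> is the image of a basis element under \<open>up\<close>, and
  \<open>top_proj\<close> annihilates every \<open>up\<close>.\<close>

lemma top_mat_support:
  assumes "\<not> reduced w c" "length c = length w"
  shows "(top_mat w c b :: 'k::field) = 0" "(top_mat w b c :: 'k) = 0"
proof -
  obtain l x y r c1 p c2 q where w: "w = l @ x # y # r" and c: "c = c1 @ p @ c2"
    "length c1 = length l" "sym_map (dn x y) p = Some q"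
    using assms(1) unfolding reduced_def by (metis append_Cons append_Nil option.exhaust)
  have lp: "length p = 2" "length q = length (lo x y)"
    using sym_map_length[OF c(3)] by simp_all
  let ?T = "top_mat w :: node list \<Rightarrow> node list \<Rightarrow> 'k" and ?u = "l @ lo x y @ r"
  note T = top_mat[where ?'k = 'k, of w]
  let ?D = "mat_comp w (word_matrix w (ctx_map l (dn x y) r)) ?T"
  have "fund.ap l (dn x y) r (fund.top_proj w :: 'k fund_mor) = zero_mor Fund w ?u"
    by (rule fund.dn_top_proj[OF w])
  then have "(w, ?u, ?D) = zero_mor Fund w ?u"
    using fund_ap[of ?T w l "dn x y" r] T w by simp
  then have "?D d b = 0" for d b
    by (simp add: Fund_simps fun_eq_iff)
  moreover have "?D (c1 @ q @ c2) b = ?T c b"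
  proof (rule mat_comp_partial_row)
    show "c \<in> elts (word_crystal w)" using assms(2) by simp
    show c': "ctx_map l (dn x y) r c = Some (c1 @ q @ c2)"
      using ctx_map_append[of c1 l p "dn x y" r c2] c lp by simp
    show "c' = c" if "c' \<in> elts (word_crystal w)" "ctx_map l (dn x y) r c' = Some (c1 @ q @ c2)" for c'
      using ctx_map_inj[OF that(2) c'] that(1) assms(2) w by simp
  qed
  ultimately show "?T c b = 0" by simp
  let ?U = "word_matrix ?u (ctx_map l (up x y) r) :: node list \<Rightarrow> node list \<Rightarrow> 'k"
  \<comment> \<open>A layer acting on the identity is its own matrix, which turns
    \<open>top_proj_up\<close> into a statement about matrices.\<close>
  let ?I = "word_matrix ?u Some :: node list \<Rightarrow> node list \<Rightarrow> 'k"
  have "?I \<in> word_hom ?u ?u"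
    by (rule crystal_hom_matrix[OF strict_Some])
  moreover have "mat_comp ?u ?U ?I = ?U"
    by (subst mat_comp_matrix[OF strict_Some]) simp
  ultimately have "fund.ap l (up x y) r (ident Fund ?u) = (?u, w, ?U)"
    using fund_ap[of ?I ?u l "up x y" r] w by (simp add: Fund_simps)
  moreover have "cmp Fund (fund.top_proj (l @ x # y # r)) (fund.ap l (up x y) r (ident Fund ?u :: 'k fund_mor)) =
      zero_mor Fund (Fund.src (ident Fund ?u :: 'k fund_mor)) (l @ x # y # r)"
    by (rule fund.top_proj_up) simp_all
  ultimately have "cmp Fund (w, w, ?T) (?u, w, ?U) = zero_mor Fund ?u w"
    using T(1) w by simp
  then have "mat_comp w ?T ?U b (c1 @ q @ c2) = 0"
    by (simp add: Fund_simps fun_eq_iff)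
  moreover have "ctx_map l (up x y) r (c1 @ q @ c2) = Some c"
    using ctx_map_append[of c1 l q "up x y" r c2] c lp sym_map_dn_up[OF c(3)] by simp
  moreover have "length (c1 @ q @ c2) = length ?u"
    using assms(2) c w lp by simp
  ultimately show "?T b c = 0"
    using mat_comp_partial_col[of "c1 @ q @ c2" ?u "ctx_map l (up x y) r" c w ?T b] assms(2) by simp
qed

text \<open>No \<open>up\<close> layer reaches Top ... Top, so this row is unchanged by every factor
  \<open>1 - Q\<close>. In \<open>top_proj\<close> it is therefore the row of the identity, which
  shows that \<open>top_proj\<close> is nonzero over every field.\<close>

definition top_row :: "'k::field fund_mor \<Rightarrow> node list \<Rightarrow> 'k" where
  "top_row = (\<lambda>(v, w, M) b. M (replicate (length w) Top) b)"

lemma top_row_add: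
  assumes "Fund.arr f" "Fund.arr g" "Fund.src g = Fund.src f" "Fund.tgt g = Fund.tgt f"
  shows "top_row (add_mor Fund f g) b = top_row f b + top_row g b"
    and "top_row (scale_mor Fund x f) b = x * top_row f b"
proof -
  obtain v w where vw: "Fund.src f = v" "Fund.tgt f = w" by blast
  obtain M where f: "f = (v, w, M)" by (rule fund_arrE[OF assms(1) vw])
  obtain N where g: "g = (v, w, N)" by (rule fund_arrE[OF assms(2)]) (use assms vw in auto)
  show "top_row (add_mor Fund f g) b = top_row f b + top_row g b"
    "top_row (scale_mor Fund x f) b = x * top_row f b"
    by (simp_all add: f g top_row_def Fund_simps)
qed

lemma top_row_up:
  assumes "Fund.arr f" "Fund.tgt f = l @ lo x y @ r"
  shows "top_row (fund.ap l (up x y) r f) b = 0"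
proof -
  obtain z where z: "Fund.src f = z" by blast
  obtain X where f: "f = (z, l @ lo x y @ r, X)" and X: "X \<in> word_hom z (l @ lo x y @ r)"
    by (rule fund_arrE[OF assms(1) z assms(2)])
  have "ctx_map l (up x y) r c \<noteq> Some (replicate (length (l @ x # y # r)) Top)"
    if len: "length c = length (l @ sym_dom (up x y) @ r)" for c
  proof
    assume "ctx_map l (up x y) r c = Some (replicate (length (l @ x # y # r)) Top)"
    then obtain c1 p q c2 where q: "replicate (length (l @ x # y # r)) Top = c1 @ q @ c2"
      "sym_map (up x y) p = Some q"
      using ctx_map_SomeE[OF _ len] by metis
    have "z = Top" if "z \<in> set q" for z
      using that q(1) by (metis in_set_replicate Un_iff set_append)
    then have "q = replicate (length q) Top"
      by (intro replicate_eqI) auto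
    then have "q = [Top, Top]"
      using sym_map_length[OF q(2)] by (simp add: numeral_2_eq_2)
    then show False using q(2) sym_map_up_Top by simp
  qed
  then have "mat_comp (l @ lo x y @ r) (word_matrix (l @ lo x y @ r) (ctx_map l (up x y) r)) X
      (replicate (length (l @ x # y # r)) Top) b = 0"
    unfolding mat_comp_def crystal_matrix_def by (intro sum.neutral) auto
  then show ?thesis
    using fund_ap[of X z l "up x y" r] X by (simp add: f top_row_def)
qed

lemma top_row_Q:
  assumes "Fund.arr f" "Fund.tgt f = l @ x # y # r"
  shows "top_row (add_mor Fund f (scale_mor Fund (- 1) (fund.ap l (up x y) r (fund.ap l (dn x y) r f)))) b = top_row f b"
  using assms by (subst top_row_add(1)) (simp_all add: top_row_add(2)[OF _ _ HOL.refl HOL.refl] top_row_up)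

lemma top_row_kill_dn:
  "\<lbrakk>Fund.arr f; Fund.tgt f = l @ u\<rbrakk> \<Longrightarrow> top_row (fund.kill_dn l u f) b = top_row f b"
  by (induction l u f rule: fund.kill_dn.induct) (simp_all add: Let_def top_row_Q fund.kill_dn_arr)

lemma top_row_kill_up:
  "\<lbrakk>Fund.arr f; Fund.tgt f = l @ u\<rbrakk> \<Longrightarrow> top_row (fund.kill_up l u f) b = top_row f b"
  by (induction l u f rule: fund.kill_up.induct) (simp_all add: top_row_Q)

lemma top_mat_Top: "(top_mat w (replicate (length w) Top) (replicate (length w) Top) :: 'k::field) = 1"
proof -
  have "top_row (fund.top_proj w :: 'k fund_mor) b = top_row (ident Fund w) b" for b
    unfolding fund.top_proj_def
    by (subst top_row_kill_dn; (subst top_row_kill_up)?)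
      (simp_all add: fund.kill_up_arr[of _ "[]", simplified])
  then have "top_mat w (replicate (length w) Top) b =
      (word_matrix w Some (replicate (length w) Top) b :: 'k)" for b
    by (simp add: top_mat(1) top_row_def Fund_simps)
  then show ?thesis by (simp add: crystal_matrix_def)
qed

text \<open>The coefficient of \<open>c\<close> in the image of \<open>e b\<close> is an entry of
  column \<open>e b\<close>. When \<open>e\<close> is applied after \<open>M\<close> instead, the
  coefficient of \<open>c\<close> is the entry in row \<open>f c\<close>, because \<open>f\<close>
  inverts \<open>e\<close>. So commuting with \<open>e\<close> trades \<open>e\<close> on columns
  for \<open>f\<close> on rows, and conversely.\<close>

lemma word_hom_commute_all:
  assumes "M \<in> word_hom v w" "length b = length v" "length c = length w"
  shows "(case wke v i b of None \<Rightarrow> 0 | Some b' \<Rightarrow> M c b') =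
      (case wkf w i c of None \<Rightarrow> 0 | Some c' \<Rightarrow> M c' b) \<and>
    (case wkf v i b of None \<Rightarrow> 0 | Some b' \<Rightarrow> M c b') =
      (case wke w i c of None \<Rightarrow> 0 | Some c' \<Rightarrow> M c' b) \<and>
    (M c b \<noteq> 0 \<longrightarrow> wwt w c = wwt v b)"
proof -
  have b: "b \<in> elts (word_crystal v)" and c: "c \<in> elts (word_crystal w)" using assms by simp_all
  note V = string_crystalD[OF string_word, of _ v] and W = string_crystalD[OF string_word, of _ w]
  show ?thesis
    using assms(1)
  proof (induction rule: crystal_hom_induct)
    case zero
    then show ?case by (auto split: option.split)
  next
    case (add \<psi> x M)
    note S = strict_morphismD[OF add.hyps(1)]
    let ?P = "word_matrix v \<psi> :: node list \<Rightarrow> node list \<Rightarrow> 'a"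
    have "(case wke v i b of None \<Rightarrow> 0 | Some b' \<Rightarrow> ?P c b') =
        (if Option.bind (\<psi> b) (wke w i) = Some c then 1 else 0)"
      using S(3)[OF b, of i, symmetric] V(2)[OF b, of i]
      by (auto simp: crystal_matrix_def split: option.split)
    also have "Option.bind (\<psi> b) (wke w i) = Some c \<longleftrightarrow>
        (\<exists>d. wkf w i c = Some d \<and> \<psi> b = Some d)"
    proof (cases "\<psi> b")
      case (Some d)
      then have "wke w i d = Some c \<longleftrightarrow> wkf w i c = Some d"
        using W(2)[OF S(1)[OF b], of d i c] W(4)[OF c, of i d] by blast
      then show ?thesis using Some by simp
    qed simp
    finally have e: "(case wke v i b of None \<Rightarrow> 0 | Some b' \<Rightarrow> ?P c b') =
        (case wkf w i c of None \<Rightarrow> 0 | Some c' \<Rightarrow> ?P c' b)"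
      using b by (auto simp: crystal_matrix_def split: option.split)
    have "(case wkf v i b of None \<Rightarrow> 0 | Some b' \<Rightarrow> ?P c b') =
        (if Option.bind (\<psi> b) (wkf w i) = Some c then 1 else 0)"
      using S(4)[OF b, of i, symmetric] V(4)[OF b, of i]
      by (auto simp: crystal_matrix_def split: option.split)
    also have "Option.bind (\<psi> b) (wkf w i) = Some c \<longleftrightarrow>
        (\<exists>d. wke w i c = Some d \<and> \<psi> b = Some d)"
    proof (cases "\<psi> b")
      case (Some d)
      then have "wkf w i d = Some c \<longleftrightarrow> wke w i c = Some d"
        using W(4)[OF S(1)[OF b], of d i c] W(2)[OF c, of i d] by blast
      then show ?thesis using Some by simp
    qed simp
    finally have f: "(case wkf v i b of None \<Rightarrow> 0 | Some b' \<Rightarrow> ?P c b') =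
        (case wke w i c of None \<Rightarrow> 0 | Some c' \<Rightarrow> ?P c' b)"
      using b by (auto simp: crystal_matrix_def split: option.split)
    have "?P c b \<noteq> 0 \<Longrightarrow> wwt w c = wwt v b"
      using S(2)[OF b, of c] by (auto simp: crystal_matrix_def split: if_splits)
    then show ?case
      using e f add.IH by (fastforce split: option.splits)
  qed
qed

lemmas word_hom_commute = word_hom_commute_all[THEN conjunct1]
  word_hom_commute_all[THEN conjunct2, THEN conjunct1]
  word_hom_commute_all[THEN conjunct2, THEN conjunct2, rule_format]

text \<open>The distance from Top ... Top, counted letter by letter. Each \<open>e\<close> lifts one
  letter, so inductions that climb a crystal terminate.\<close>

fun height :: "node list \<Rightarrow> nat" where
  "height [] = 0"
| "height (x # b) = (case x of Top \<Rightarrow> 0 | Mid \<Rightarrow> 1 | Bot \<Rightarrow> 2) + height b"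

lemma height_ke: "\<lbrakk>wke v i b = Some b'; length b = length v\<rbrakk> \<Longrightarrow> height b' < height b"
proof (induction v arbitrary: b b')
  case Nil
  then show ?case by (simp add: unit_crystal_def)
next
  case (Cons j v)
  then obtain a c where b: "b = a # c" "length c = length v" by (auto simp: length_Suc_conv)
  show ?case
  proof (cases "phi (fund_crystal j) i a \<ge> weps v i c")
    case True
    then show ?thesis
      using Cons.prems(1) by (cases a) (auto simp: b(1) cons_crystal_simps fund_simps split: if_splits)
  next
    case False
    then obtain c' where "wke v i c = Some c'" "b' = a # c'"
      using Cons.prems(1) by (auto simp: b(1) cons_crystal_simps)
    then show ?thesis using Cons.IH[of c c'] b by simp
  qed
qed

lemma height_Top: "height (replicate n Top) = 0"
  by (induction n) auto

lemma ke_Top: "wke v i (replicate (length v) Top) = None"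
  using height_ke[of v i "replicate (length v) Top"] height_Top[of "length v"]
  by (cases "wke v i (replicate (length v) Top)") auto

text \<open>This weight records how often each letter occurs, which determines a sorted word; hence
  homs between different sorted words have entry 0 at Top ... Top.\<close>

lemma wt_Top: "wwt v (replicate (length v) Top) k = int (count_list v k)"
  by (induction v) (auto simp: cons_crystal_simps fund_simps unit_crystal_def)

lemma sorted_word_prefix: "sorted_word (p @ I1 # q) \<Longrightarrow> set p \<subseteq> {I1}"
proof (induction p arbitrary: q rule: rev_induct)
  case (snoc x p)
  then have "x = I1" by (cases x) (auto simp: sorted_word_def)
  then show ?case using snoc.IH[of "I1 # q"] snoc.prems by simp
qed simp

lemma sorted_word_eq:
  "sorted_word v \<Longrightarrow> v = replicate (count_list v I1) I1 @ replicate (count_list v I2) I2"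
proof (induction v)
  case (Cons i v)
  have "sorted_word v"
    using Cons.prems unfolding sorted_word_def by (metis append_Cons)
  then have v: "v = replicate (count_list v I1) I1 @ replicate (count_list v I2) I2"
    by (rule Cons.IH)
  show ?case
  proof (cases i)
    case I1
    then show ?thesis using v by simp
  next
    case I2
    have "I1 \<notin> set v"
    proof
      assume "I1 \<in> set v"
      then obtain p q where "v = p @ I1 # q" by (meson split_list)
      then show False using sorted_word_prefix[of "i # p" q] Cons.prems I2 by simp
    qed
    then have "count_list v I1 = 0" by (simp add: count_list_0_iff)
    then show ?thesis using v I2 by simp
  qed
qed simp

lemma phi_ones: "set v \<subseteq> {I1} \<Longrightarrow> wphi v I2 (replicate (length v) Top) = 0"
proof (induction v)
  case Nil
  then show ?case by (simp add: eps_phi_unit)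
next
  case (Cons j v)
  then show ?case
    using word_Cons(2)[of "replicate (length v) Top" v j I2 Top] by (simp add: eps_phi_fund)
qed

text \<open>This is where sortedness enters for crystals. Let \<open>y\<close> be the first letter
  other than Top. At the start of the word some \<open>e\<close> would act on it. After a Top, being
  reduced leaves only Mid at a change of letters, which in a sorted word is the change from 1 to 2;
  but the Tops before it belong to the letter 1 and have \<open>phi\<close> equal to 0 for the index
  2, so they cannot block the \<open>e\<close> that acts on \<open>y\<close>.\<close>

lemma reduced_highest:
  assumes "sorted_word v" "length b = length v" "reduced v b" "\<And>i. wke v i b = None"
  shows "b = replicate (length v) Top"
proof -
  have eps0: "weps v i b = 0" for i
    using string_crystalD(1)[OF string_word, of b v i] assms(2,4) by simp
  have "take k b = replicate k Top" if "k \<le> length v" for k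
    using that
  proof (induction k)
    case (Suc k)
    define v1 j v2 y c where "v1 = take k v" and "j = v ! k" and "v2 = drop (Suc k) v"
      and "y = b ! k" and "c = drop (Suc k) b"
    have v: "v = v1 @ j # v2" and b: "b = replicate k Top @ y # c"
      using Suc assms(2) id_take_nth_drop[of k v] id_take_nth_drop[of k b]
      by (simp_all add: v1_def j_def v2_def y_def c_def)
    have l: "length (replicate k Top) = length v1" "length (y # c) = length (j # v2)" "length c = length v2"
      using Suc.prems assms(2) by (simp_all add: v1_def v2_def c_def)
    \<comment> \<open>Since the whole word has \<open>eps\<close> 0, the suffix starting with
      \<open>y\<close> has \<open>eps\<close> at most the \<open>phi\<close> of the prefix, and
      \<open>y\<close> alone has \<open>eps\<close> at most that of the suffix.\<close>
    have *: "eps (fund_crystal j) i y \<le> wphi v1 i (replicate k Top)" for i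
      using eps0[of i] word_append(2)[OF l(1,2), of i] word_Cons(1)[OF l(3), of j i y] v b by simp
    have "y = Top"
    proof (cases v1 rule: rev_cases)
      case Nil
      then have "eps (fund_crystal j) i y = 0" for i
        using *[of i] l(1) by (simp add: eps_phi_unit)
      from this[of I1] this[of I2] show ?thesis
        by (cases y; cases j) (simp_all add: eps_phi_fund)
    next
      case (snoc v0 j0)
      then have k: "k = Suc (length v0)" using l(1) by simp
      have "b = replicate (length v0) Top @ Top # y # c"
        using b k by (simp add: replicate_append_same)
      moreover have vv: "v = v0 @ j0 # j # v2" using v snoc by simp
      ultimately have s: "sym_map (dn j0 j) [Top, y] = None"
        using assms(3) unfolding reduced_def by (metis length_replicate)
      show ?thesis
      proof (rule ccontr)
        assume "y \<noteq> Top"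
        then have y: "y = Mid" "j0 \<noteq> j"
          using s by (cases y; cases "j0 = j"; simp add: dn_def)+
        have "j0 = I1" "j = I2"
          using assms(1) y(2) vv by (cases j0; cases j; auto simp: sorted_word_def)+
        moreover have "set v1 \<subseteq> {I1}"
          using sorted_word_prefix[of v0 "j # v2"] assms(1) vv snoc calculation by simp
        ultimately show False
          using *[of I2] phi_ones[of v1] l(1) y(1) by (simp add: eps_phi_fund)
      qed
    qed
    then have "take (Suc k) b = replicate k Top @ [Top]"
      using take_Suc_conv_app_nth[of k b] Suc assms(2) by (simp add: y_def)
    then show ?case by (simp add: replicate_append_same)
  qed simp
  then show ?thesis using assms(2) by (metis order_refl take_all)
qed

text \<open>A highest weight argument on entries. A reduced \<open>b\<close> other than Top ... Top
  is \<open>f\<close> of an element of smaller height, whose column vanishes by induction. In the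
  column of Top ... Top a reduced row \<open>c\<close> other than Top ... Top is \<open>f\<close> of
  some \<open>c'\<close>, and its entry would come from \<open>e\<close> applied to Top ... Top,
  which is 0.\<close>

lemma word_hom_zero:
  assumes v: "sorted_word v" and w: "sorted_word w" and N: "N \<in> word_hom v w"
    and rows: "\<And>c b. \<lbrakk>length c = length w; \<not> reduced w c\<rbrakk> \<Longrightarrow> N c b = 0"
    and cols: "\<And>c b. \<lbrakk>length b = length v; \<not> reduced v b\<rbrakk> \<Longrightarrow> N c b = 0"
    and Top: "N (replicate (length w) Top) (replicate (length v) Top) = 0"
  shows "N c b = 0"
proof (induction "height b" arbitrary: b c rule: less_induct)
  case less
  show ?case
  proof (cases "length c = length w \<and> length b = length v \<and> reduced w c \<and> reduced v b")
    case False
    then show ?thesis using rows cols crystal_hom_support[OF N, of b c] by auto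
  next
    case l: True
    show ?thesis
    proof (cases "b = replicate (length v) Top")
      case b: True
      show ?thesis
      proof (cases "c = replicate (length w) Top")
        case True
        then show ?thesis using Top b by simp
      next
        case False
        then obtain i c' where c': "wke w i c = Some c'"
          using reduced_highest[OF w, of c] l by (metis option.exhaust)
        then have "wkf w i c' = Some c" "length c' = length w"
          using string_crystalD(2)[OF string_word, of c w i c'] l by auto
        then show ?thesis
          using word_hom_commute(1)[OF N, of b c' i] l ke_Top[of v i] b by simp
      qed
    next
      case False
      then obtain i b' where b': "wke v i b = Some b'"
        using reduced_highest[OF v, of b] l by (metis option.exhaust)
      then have "wkf v i b' = Some b" "length b' = length v"
        using string_crystalD(2)[OF string_word, of b v i b'] l by auto
      then show ?thesis
        using word_hom_commute(2)[OF N, of b' c i] l less[OF height_ke[OF b']]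
        by (simp split: option.splits)
    qed
  qed
qed

theorem fund_schur:
  fixes f :: "'k::field fund_mor"
  assumes "sorted_word v" "sorted_word w" "Fund.arr f" "Fund.src f = v" "Fund.tgt f = w"
  shows "if w = v then \<exists>c. cmp Fund (fund.top_proj w) (cmp Fund f (fund.top_proj v)) = scale_mor Fund c (fund.top_proj v)
    else cmp Fund (fund.top_proj w) (cmp Fund f (fund.top_proj v)) = zero_mor Fund v w"
proof -
  obtain M where f: "f = (v, w, M)" and M: "M \<in> word_hom v w"
    by (rule fund_arrE[OF assms(3-5)])
  define N where "N = mat_comp w (top_mat w) (mat_comp v M (top_mat v))"
  have eq: "cmp Fund (fund.top_proj w) (cmp Fund f (fund.top_proj v)) = (v, w, N)"
    by (simp add: f top_mat(1) Fund_simps N_def)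
  have N: "N \<in> word_hom v w"
    unfolding N_def using M top_mat(2) by (intro mat_comp_hom)
  have rows: "N c b = 0" if "length c = length w" "\<not> reduced w c" for c b
    using top_mat_support(1)[OF that(2,1), where ?'k = 'k] by (simp add: N_def mat_comp_def)
  have cols: "N c b = 0" if "length b = length v" "\<not> reduced v b" for c b
    using top_mat_support(2)[OF that(2,1), where ?'k = 'k] by (simp add: N_def mat_comp_def)
  show ?thesis
  proof (cases "w = v")
    case False
    have "N (replicate (length w) Top) (replicate (length v) Top) = 0"
    proof (rule ccontr)
      assume "\<not> ?thesis"
      then have "wwt w (replicate (length w) Top) = wwt v (replicate (length v) Top)"
        using word_hom_commute(3)[OF N] by simp
      then have "count_list w k = count_list v k" for k
        using wt_Top[of w k] wt_Top[of v k] by simp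
      then show False
        using sorted_word_eq[OF assms(1)] sorted_word_eq[OF assms(2)] False by simp
    qed
    then have "N = (\<lambda>c b. 0)"
      using word_hom_zero[OF assms(1,2) N rows cols] by blast
    then show ?thesis using False eq by (simp add: Fund_simps)
  next
    case True
    \<comment> \<open>The scalar is forced by the entry at Top ... Top, where \<open>top_mat\<close>
      is 1; after subtraction \<open>word_hom_zero\<close> applies.\<close>
    define x where "x = N (replicate (length w) Top) (replicate (length v) Top)"
    define N' where "N' = (\<lambda>c b. N c b + - x * top_mat v c b)"
    have "N' c b = 0" for c b
    proof (rule word_hom_zero[OF assms(1,2)])
      show "N' \<in> word_hom v w"
        unfolding N'_def using N top_mat(2) True by (intro crystal_hom_add crystal_hom_scale) auto
      show "N' c b = 0" if "length c = length w" "\<not> reduced w c" for c b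
        using rows[OF that] top_mat_support(1)[OF that(2,1), where ?'k = 'k] True by (simp add: N'_def)
      show "N' c b = 0" if "length b = length v" "\<not> reduced v b" for c b
        using cols[OF that] top_mat_support(2)[OF that(2,1), where ?'k = 'k] by (simp add: N'_def)
      show "N' (replicate (length w) Top) (replicate (length v) Top) = 0"
        using True by (simp add: N'_def x_def top_mat_Top)
    qed
    then have "N = (\<lambda>c b. x * top_mat v c b)"
      by (simp add: N'_def fun_eq_iff)
    then have "(v, w, N) = scale_mor Fund x (fund.top_proj v)"
      using True by (simp add: top_mat(1) Fund_simps)
    then show ?thesis using True eq by auto
  qed
qed

section \<open>Faithfulness and fullness\<close>

abbreviation pcomp (infixr "\<bullet>" 70) where "g \<bullet> f \<equiv> cmp pres.Pr g f"
abbreviation fcomp (infixr "\<diamondop>" 70) where "g \<diamondop> f \<equiv> cmp Fund g f"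

lemma fund_scale_top:
  "scale_mor Fund c (fund.top_proj w) = zero_mor Fund v w' \<Longrightarrow> (c :: 'k::field) = 0"
  using top_mat_Top[of w, where ?'k = 'k]
  by (auto simp: top_mat(1) Fund_simps fun_eq_iff)

text \<open>Schur's lemma leaves a scalar at most, and the functor detects it because the image of
  \<open>top_proj\<close> is nonzero.\<close>

lemma realize_zero_top:
  fixes f :: "(ix, gen, 'k::field) tm set"
  assumes f: "pres.arr f" "realize f = zero_mor Fund (pres.src f) (pres.tgt f)"
    and v: "sorted_word v" "pres.arr a" "pres.src a = v" "pres.tgt a = pres.src f"
    and w: "sorted_word w" "pres.arr h" "pres.src h = pres.tgt f" "pres.tgt h = w"
  shows "pres.top_proj w \<bullet> ((h \<bullet> (f \<bullet> a)) \<bullet> pres.top_proj v) =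
    zero_mor pres.Pr v w"
proof -
  let ?k = "h \<bullet> (f \<bullet> a)"
  have k: "pres.arr ?k" "pres.src ?k = v" "pres.tgt ?k = w" using f v w by simp_all
  have 0: "realize (pres.top_proj w \<bullet> (?k \<bullet> pres.top_proj v)) = zero_mor Fund v w"
    using f v w by (simp add: realize_comp realize_arr realize_top_proj)
  show ?thesis
  proof (cases "w = v")
    case True
    then obtain c where c: "pres.top_proj w \<bullet> (?k \<bullet> pres.top_proj v) =
        scale_mor pres.Pr c (pres.top_proj v)"
      using pres.schur[OF v(1) w(1) k] by auto
    then have "scale_mor Fund c (fund.top_proj v) = zero_mor Fund v w"
      using 0 by (simp add: realize_scale realize_top_proj)
    then have "c = 0" by (rule fund_scale_top)
    then show ?thesis using c True by simp
  next
    case False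
    then show ?thesis using pres.schur[OF v(1) w(1) k] by simp
  qed
qed

text \<open>Write \<open>f\<close> as itself between two identities, both of which lie in
  \<open>J\<close>. Expanding them bilinearly leaves terms in which \<open>f\<close> stands between
  two \<open>top_proj\<close>, and these vanish by \<open>realize_zero_top\<close>.\<close>

lemma realize_faithful:
  fixes f :: "(ix, gen, 'k::field) tm set"
  assumes f: "pres.arr f" "realize f = zero_mor Fund (pres.src f) (pres.tgt f)"
  shows "f = zero_mor pres.Pr (pres.src f) (pres.tgt f)"
proof -
  have main: "y \<bullet> (f \<bullet> x) = zero_mor pres.Pr (pres.src x) (pres.tgt y)"
    if "pres.J y" "pres.J x" "pres.tgt x = pres.src f" "pres.src y = pres.tgt f" for x y
    using that
  proof (induction arbitrary: x rule: pres.J.induct)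
    case (J_base w a h)
    note y = J_base.hyps
    from J_base.prems show ?case
    proof (induction rule: pres.J.induct)
      case (J_base v a' h')
      then have "pres.top_proj w \<bullet> ((h \<bullet> (f \<bullet> a')) \<bullet> pres.top_proj v) =
          zero_mor pres.Pr v w"
        using y f by (intro realize_zero_top) simp_all
      moreover have "(a \<bullet> (pres.top_proj w \<bullet> h)) \<bullet> (f \<bullet> (a' \<bullet> (pres.top_proj v \<bullet> h'))) =
          a \<bullet> ((pres.top_proj w \<bullet> ((h \<bullet> (f \<bullet> a')) \<bullet> pres.top_proj v)) \<bullet> h')"
        using J_base y f by (simp add: pres.c_assoc)
      ultimately show ?case using J_base y f by simp
    next
      case (J_zero b c)
      then show ?case using y f by simp
    next
      case (J_add x x')
      then show ?case
        using y f pres.J_arr[OF J_add.hyps(1)] pres.J_arr[OF J_add.hyps(2)] by (simp add: pres.c_add_right)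
    qed
  next
    case (J_zero b c)
    then show ?case using f pres.J_arr[OF J_zero(1)] by simp
  next
    case (J_add y y')
    then show ?case
      using f pres.J_arr[OF J_add.hyps(1)] pres.J_arr[OF J_add.hyps(2)] pres.J_arr[OF J_add.prems(1)]
      by (simp add: pres.c_add_left)
  qed
  show ?thesis
    using main[OF pres.J_all pres.J_all, of "ident pres.Pr (pres.tgt f)" "ident pres.Pr (pres.src f)"] f by simp
qed

text \<open>The same expansion, now with \<open>M\<close> between images of identities. By
  \<open>fund_schur\<close> every piece is 0 or a multiple of a morphism through a single
  \<open>top_proj\<close>, which has an evident preimage; preimages are then added up.\<close>

lemma realize_full:
  fixes M :: "'k::field fund_mor"
  assumes M: "Fund.arr M"
  shows "\<exists>f. pres.arr f \<and> pres.src f = Fund.src M \<and> pres.tgt f = Fund.tgt M \<and> realize f = M"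
proof -
  have main: "\<exists>f. pres.arr f \<and> pres.src f = pres.src x \<and> pres.tgt f = pres.tgt y \<and>
      realize f = realize y \<diamondop> (M \<diamondop> realize x)"
    if "pres.J y" "pres.J x" "pres.tgt x = Fund.src M" "pres.src y = Fund.tgt M"
    for x y :: "(ix, gen, 'k) tm set"
    using that
  proof (induction arbitrary: x rule: pres.J.induct)
    case (J_base w a h)
    note y = J_base.hyps
    from J_base.prems show ?case
    proof (induction rule: pres.J.induct)
      case (J_base v a' h')
      note x = J_base
      let ?k = "realize h \<diamondop> (M \<diamondop> realize a')"
      have k: "Fund.arr ?k" "Fund.src ?k = v" "Fund.tgt ?k = w"
        using x y M by (simp_all add: realize_arr)
      have eq: "realize (a \<bullet> (pres.top_proj w \<bullet> h)) \<diamondop> (M \<diamondop> realize (a' \<bullet> (pres.top_proj v \<bullet> h'))) =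
          realize a \<diamondop> ((fund.top_proj w \<diamondop> (?k \<diamondop> fund.top_proj v)) \<diamondop> realize h')"
        using x y M by (simp add: realize_comp realize_arr realize_top_proj Fund.c_assoc)
      show ?case
      proof (cases "w = v")
        case True
        then obtain c where "fund.top_proj w \<diamondop> (?k \<diamondop> fund.top_proj v) = scale_mor Fund c (fund.top_proj v)"
          using fund_schur[OF x(1) y(1) k] by auto
        then have "realize (scale_mor pres.Pr c (a \<bullet> (pres.top_proj v \<bullet> h'))) =
            realize (a \<bullet> (pres.top_proj w \<bullet> h)) \<diamondop> (M \<diamondop> realize (a' \<bullet> (pres.top_proj v \<bullet> h')))"
          unfolding eq using x y True
          by (simp add: realize_scale realize_comp realize_arr realize_top_proj Fund.c_scale_left Fund.c_scale_right)
        then show ?thesis using x y True 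
            by (intro exI[of _ "scale_mor pres.Pr c (a \<bullet> (pres.top_proj v \<bullet> h'))"] conjI) simp_all
      next
        case False
        then have "fund.top_proj w \<diamondop> (?k \<diamondop> fund.top_proj v) = zero_mor Fund v w"
          using fund_schur[OF x(1) y(1) k] by simp
        then have "realize (zero_mor pres.Pr (pres.src h') (pres.tgt a)) =
            realize (a \<bullet> (pres.top_proj w \<bullet> h)) \<diamondop> (M \<diamondop> realize (a' \<bullet> (pres.top_proj v \<bullet> h')))"
          unfolding eq using x y by (simp add: realize_zero realize_arr)
        then show ?thesis using x y 
            by (intro exI[of _ "zero_mor pres.Pr (pres.src h') (pres.tgt a)"] conjI) simp_all
      qed
    next
      case (J_zero b c)
      then have "realize (zero_mor pres.Pr b (pres.tgt a)) =
          realize (a \<bullet> (pres.top_proj w \<bullet> h)) \<diamondop> (M \<diamondop> realize (zero_mor pres.Pr b c))"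
        using y M by (simp add: realize_zero realize_comp realize_arr realize_top_proj)
      then show ?case using y 
            by (intro exI[of _ "zero_mor pres.Pr b (pres.tgt a)"] conjI) simp_all
    next
      case (J_add x x')
      note x = pres.J_arr[OF J_add.hyps(1)] pres.J_arr[OF J_add.hyps(2)] J_add.hyps(3,4)
      have t: "pres.tgt x = Fund.src M" using J_add.prems(1) x by simp
      obtain f where f: "pres.arr f" "pres.src f = pres.src x" "pres.tgt f = pres.tgt a"
          "realize f = realize (a \<bullet> (pres.top_proj w \<bullet> h)) \<diamondop> (M \<diamondop> realize x)"
        using J_add.IH(1)[OF t J_add.prems(2)] y by auto
      obtain f' where f': "pres.arr f'" "pres.src f' = pres.src x" "pres.tgt f' = pres.tgt a"
          "realize f' = realize (a \<bullet> (pres.top_proj w \<bullet> h)) \<diamondop> (M \<diamondop> realize x')"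
        using J_add.IH(2)[OF _ J_add.prems(2)] x t y by auto
      have "realize (add_mor pres.Pr f f') =
          realize (a \<bullet> (pres.top_proj w \<bullet> h)) \<diamondop>
            (M \<diamondop> realize (add_mor pres.Pr x x'))"
        using f f' x y M t J_add.prems(2)
        by (simp add: realize_add realize_arr Fund.c_add_right realize_comp realize_top_proj)
      then show ?case
        using f f' x y
        by (intro exI[of _ "add_mor pres.Pr f f'"] conjI) simp_all
    qed
  next
    case (J_zero b c)
    then have "realize (zero_mor pres.Pr (pres.src x) c) =
        realize (zero_mor pres.Pr b c) \<diamondop> (M \<diamondop> realize x)"
      using M pres.J_arr[OF J_zero(1)] by (simp add: realize_zero realize_arr)
    then show ?case 
            by (intro exI[of _ "zero_mor pres.Pr (pres.src x) c"] conjI) simp_all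
  next
    case (J_add y y')
    note y = pres.J_arr[OF J_add.hyps(1)] pres.J_arr[OF J_add.hyps(2)] J_add.hyps(3,4)
      and x = pres.J_arr[OF J_add.prems(1)]
    have t: "pres.src y = Fund.tgt M" using J_add.prems(3) y by simp
    obtain f where f: "pres.arr f" "pres.src f = pres.src x" "pres.tgt f = pres.tgt y"
        "realize f = realize y \<diamondop> (M \<diamondop> realize x)"
      using J_add.IH(1)[OF J_add.prems(1,2) t] by auto
    obtain f' where f': "pres.arr f'" "pres.src f' = pres.src x" "pres.tgt f' = pres.tgt y"
        "realize f' = realize y' \<diamondop> (M \<diamondop> realize x)"
      using J_add.IH(2)[OF J_add.prems(1,2)] t y by auto
    have "realize (add_mor pres.Pr f f') =
        realize (add_mor pres.Pr y y') \<diamondop> (M \<diamondop> realize x)"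
      using f f' x y M t J_add.prems(2) by (simp add: realize_add realize_arr Fund.c_add_left)
    then show ?case
      using f f' y
      by (intro exI[of _ "add_mor pres.Pr f f'"] conjI) simp_all
  qed
  show ?thesis
    using main[OF pres.J_all pres.J_all, of "ident pres.Pr (Fund.tgt M)" "ident pres.Pr (Fund.src M)"] M
    by (simp add: realize_ident)
qed

lemma presented_iso: "linear_moncat_iso sl3_presented Fund (\<lambda>w. w) realize"
  unfolding linear_moncat_iso_def sl3_presented_def
proof (intro conjI ballI allI)
  show "linear_moncat pres.Pr" by (rule pres.linear_moncat_presented)
  show "linear_moncat Fund" by (rule linear_moncat_Fund)
  show "bij_betw (\<lambda>w. w) (obj pres.Pr) (obj Fund)"
    by (simp add: bij_betw_def)
next
  fix a b
  let ?P = "pres.Pr :: (ix list, (ix, gen, 'a) tm set, 'a) lmcat"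
  show "bij_betw realize (hom ?P a b) (hom Fund a b)"
  proof (rule bij_betw_imageI)
    show "inj_on realize (hom ?P a b)"
    proof (rule inj_onI)
      fix f g assume fg: "f \<in> hom ?P a b" "g \<in> hom ?P a b" "realize f = realize g"
      then have f: "pres.arr f" "pres.src f = a" "pres.tgt f = b"
        and g: "pres.arr g" "pres.src g = a" "pres.tgt g = b"
        by (simp_all add: pres.hom_iff)
      let ?d = "add_mor ?P f (scale_mor ?P (- 1) g)"
      have "realize ?d = zero_mor Fund a b"
        using f g fg(3) Fund.diff_self[of "realize g"] by (simp add: realize_add realize_scale realize_arr)
      then have "?d = zero_mor ?P a b"
        using realize_faithful[of ?d] f g by simp
      then show "f = g"
        using pres.diff_add[of f g] f g by simp
    qed
    show "realize ` hom ?P a b = hom Fund a b"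
    proof
      show "realize ` hom ?P a b \<subseteq> hom Fund a b"
        by (auto simp: pres.hom_iff Fund.hom_iff realize_arr)
      show "hom Fund a b \<subseteq> realize ` hom ?P a b"
      proof
        fix M :: "'a fund_mor" assume "M \<in> hom Fund a b"
        then obtain f where "pres.arr f" "pres.src f = a" "pres.tgt f = b" "realize f = M"
          using realize_full[of M] by (auto simp: Fund.hom_iff)
        then show "M \<in> realize ` hom ?P a b" by (auto simp: pres.hom_iff)
      qed
    qed
  qed
qed (auto simp: realize_ident pres.hom_iff realize_comp realize_tens realize_add realize_scale Fund_simps(2,3))

section \<open>Uniqueness of the projections\<close>

lemma fund_arrow_cong:
  "(\<And>b. length b = length v \<Longrightarrow> \<psi> b = \<chi> b) \<Longrightarrow> fund_arrow v w \<psi> = fund_arrow v w \<chi>"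
  by (auto simp: fund_arrow_def crystal_matrix_def fun_eq_iff)

lemma realize_sym_arrow: "realize (sym_class s) = fund_arrow (sym_dom s) (sym_cod s) (sym_map s)"
  by (simp add: realize_sym sym_mor_def fund_arrow_def)

lemma length_1_node: "length b = Suc 0 \<longleftrightarrow> b \<in> {[Top], [Mid], [Bot]}"
  using node.exhaust by (auto simp: length_Suc_conv)

lemma length_2_node: "length b = Suc (Suc 0) \<longleftrightarrow>
  b \<in> {[Top, Top], [Top, Mid], [Top, Bot], [Mid, Top], [Mid, Mid], [Mid, Bot], [Bot, Top], [Bot, Mid], [Bot, Bot]}"
proof
  assume "length b = Suc (Suc 0)"
  then obtain x y where "b = [x, y]" by (auto simp: length_Suc_conv)
  then show "b \<in> {[Top, Top], [Top, Mid], [Top, Bot], [Mid, Top], [Mid, Mid], [Mid, Bot], [Bot, Top], [Bot, Mid], [Bot, Bot]}"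
    by (cases x; cases y) simp_all
qed auto

lemma weights_short:
  "wwt [i, j] [a, b] k = wt (fund_crystal i) a k + wt (fund_crystal j) b k"
  "wwt [i] [a] k = wt (fund_crystal i) a k"
  "wwt [] [] k = 0"
  by (simp_all add: crystal_words_short del: word_crystal.simps)

lemma strict_wt:
  "\<lbrakk>word_strict v w \<psi>; \<psi> b = Some c; length b = length v\<rbrakk> \<Longrightarrow>
    length c = length w \<and> (\<forall>k. wwt w c k = wwt v b k)"
  using strict_morphismD(1,2)[of "word_crystal v" "word_crystal w" \<psi> b c] by simp

lemma strict_kf:
  "\<lbrakk>word_strict v w \<psi>; wkf v k b = Some b'; length b = length v\<rbrakk>
    \<Longrightarrow> \<psi> b' = Option.bind (\<psi> b) (wkf w k)"
  using strict_morphismD(4)[of "word_crystal v" "word_crystal w" \<psi> b k] by simp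

lemmas eval_short = crystal_words_short eps_phi_fund fund_simps

text \<open>Enough of the crystal graph to reach the six elements of the component of Top Top and
  the path of three elements starting at Top Mid.\<close>

lemma arrows_same:
  fixes i defines "w \<equiv> word_crystal [i, i]" and "j \<equiv> op_ix i"
  shows "kf w i [Top, Top] = Some [Mid, Top]" "kf w j [Mid, Top] = Some [Bot, Top]"
    "kf w i [Mid, Top] = Some [Mid, Mid]" "kf w j [Mid, Mid] = Some [Bot, Mid]"
    "kf w j [Bot, Mid] = Some [Bot, Bot]" "kf w j [Top, Mid] = Some [Top, Bot]"
    "kf w i [Top, Bot] = Some [Mid, Bot]"
  unfolding w_def j_def by (cases i; simp add: eval_short del: word_crystal.simps)+

lemma arrows_opposite:
  fixes i defines "w \<equiv> word_crystal [i, op_ix i]" and "j \<equiv> op_ix i"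
  shows "kf w i [Top, Top] = Some [Mid, Top]" "kf w j [Top, Top] = Some [Top, Mid]"
    "kf w i [Top, Mid] = Some [Mid, Mid]" "kf w j [Mid, Top] = Some [Bot, Top]"
    "kf w i [Mid, Mid] = Some [Mid, Bot]" "kf w j [Bot, Top] = Some [Bot, Mid]"
    "kf w j [Mid, Bot] = Some [Bot, Bot]" "kf w i [Bot, Mid] = Some [Bot, Bot]"
  unfolding w_def j_def by (cases i; simp add: eval_short del: word_crystal.simps)+

text \<open>By its weight Top Top goes to 0, and with it everything below it. By surjectivity some
  element maps to Top, its weight identifies it as Top Mid, and the other values follow along
  \<open>f\<close>.\<close>

lemma projection_merge:
  assumes "crystal_projection (word_crystal [i, i]) (word_crystal [op_ix i]) \<psi>" "length b = Suc (Suc 0)"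
  shows "\<psi> b = sym_map (Sym_m i) b"
proof -
  have S: "word_strict [i, i] [op_ix i] \<psi>"
    and bij: "bij_betw (\<lambda>b. the (\<psi> b)) {b. length b = Suc (Suc 0) \<and> \<psi> b \<noteq> None} {b. length b = 1}"
    using assms(1) by (simp_all add: crystal_projection_def del: word_crystal.simps)
  note f = strict_kf[OF S] and W = strict_wt[OF S]
  have TT: "\<psi> [Top, Top] = None"
  proof (rule ccontr)
    assume "\<psi> [Top, Top] \<noteq> None"
    then obtain c where c: "\<psi> [Top, Top] = Some c" by auto
    from W[OF c] have "length c = Suc 0" "wwt [op_ix i] c i = 2"
      by (simp_all add: weights_short fund_simps del: word_crystal.simps)
    then show False
      by (auto simp: length_1_node weights_short fund_simps split: if_splits simp del: word_crystal.simps)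
  qed
  have N: "\<psi> [Mid, Top] = None" "\<psi> [Bot, Top] = None" "\<psi> [Mid, Mid] = None" "\<psi> [Bot, Mid] = None" "\<psi> [Bot, Bot] = None"
    using TT f[OF arrows_same(1)] f[OF arrows_same(2)] f[OF arrows_same(3)] f[OF arrows_same(4)] f[OF arrows_same(5)]
    by simp_all
  have "[Top] \<in> (\<lambda>b. the (\<psi> b)) ` {b. length b = Suc (Suc 0) \<and> \<psi> b \<noteq> None}"
    using bij_betw_imp_surj_on[OF bij] by simp
  then obtain b' where b': "\<psi> b' = Some [Top]" "length b' = Suc (Suc 0)"
    by auto
  have "wwt [op_ix i] [Top] i = wwt [i, i] b' i" using W[OF b'(1)] b'(2) by simp
  then have "b' = [Top, Mid]"
    using b' TT N unfolding length_2_node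
    by (auto simp: weights_short fund_simps simp del: word_crystal.simps)
  then have TM: "\<psi> [Top, Mid] = Some [Top]" using b' by simp
  have TB: "\<psi> [Top, Bot] = Some [Mid]"
    using f[OF arrows_same(6)] TM by (simp add: eval_short del: word_crystal.simps)
  have MB: "\<psi> [Mid, Bot] = Some [Bot]"
    using f[OF arrows_same(7)] TB by (simp add: eval_short del: word_crystal.simps)
  show ?thesis
    using assms(2) TT N TM TB MB by (auto simp: length_2_node)
qed

text \<open>Top Top has the wrong weight, and every element except Top Bot lies below it; so Top Bot
  alone can map to the unit.\<close>

lemma projection_cap:
  assumes "crystal_projection (word_crystal [i, op_ix i]) (word_crystal []) \<psi>" "length b = Suc (Suc 0)"
  shows "\<psi> b = sym_map (Sym_c i) b"
proof -
  have S: "word_strict [i, op_ix i] [] \<psi>"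
    and bij: "bij_betw (\<lambda>b. the (\<psi> b)) {b. length b = Suc (Suc 0) \<and> \<psi> b \<noteq> None} {b. length b = 0}"
    using assms(1) by (simp_all add: crystal_projection_def del: word_crystal.simps)
  note f = strict_kf[OF S] and W = strict_wt[OF S]
  have TT: "\<psi> [Top, Top] = None"
  proof (rule ccontr)
    assume "\<psi> [Top, Top] \<noteq> None"
    then obtain c where c: "\<psi> [Top, Top] = Some c" by auto
    have "length [Top, Top] = length [i, op_ix i]" by simp
    from W[OF c this] have "length c = length ([] :: ix list)"
      "wwt [] c i = wwt [i, op_ix i] [Top, Top] i" by blast+
    then show False by (simp add: weights_short fund_simps del: word_crystal.simps)
  qed
  have N: "\<psi> [Mid, Top] = None" "\<psi> [Top, Mid] = None" "\<psi> [Mid, Mid] = None" "\<psi> [Bot, Top] = None"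
    "\<psi> [Mid, Bot] = None" "\<psi> [Bot, Mid] = None" "\<psi> [Bot, Bot] = None"
    using TT f[OF arrows_opposite(1)] f[OF arrows_opposite(2)] f[OF arrows_opposite(3)]
      f[OF arrows_opposite(4)] f[OF arrows_opposite(5)] f[OF arrows_opposite(6)] f[OF arrows_opposite(7)]
    by simp_all
  have "[] \<in> (\<lambda>b. the (\<psi> b)) ` {b. length b = Suc (Suc 0) \<and> \<psi> b \<noteq> None}"
    using bij_betw_imp_surj_on[OF bij] by simp
  then obtain b' where b': "\<psi> b' = Some []" "length b' = Suc (Suc 0)"
    by auto
  then have TB: "\<psi> [Top, Bot] = Some []"
    using TT N unfolding length_2_node by auto
  show ?thesis
    using assms(2) TT N TB by (auto simp: length_2_node)
qed

text \<open>The weight fixes the image of Top Top, and the arrows fix the images of the seven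
  elements below it.\<close>

lemma isomorphism_beta:
  assumes "crystal_iso (word_crystal [i, op_ix i]) (word_crystal [op_ix i, i]) \<psi>" "length b = Suc (Suc 0)"
  shows "\<psi> b = sym_map (Sym_b i) b"
proof -
  have S: "word_strict [i, op_ix i] [op_ix i, i] \<psi>"
    and total: "length b = Suc (Suc 0) \<Longrightarrow> \<psi> b \<noteq> None" for b
    using assms(1) by (simp_all add: crystal_iso_def crystal_projection_def del: word_crystal.simps)
  note f = strict_kf[OF S] and W = strict_wt[OF S]
  note arr = arrows_opposite[of i] arrows_opposite[of "op_ix i", simplified op_ix_op_ix]
  have TT: "\<psi> [Top, Top] = Some [Top, Top]"
  proof -
    obtain c where c: "\<psi> [Top, Top] = Some c" using total[of "[Top, Top]"] by auto
    from W[OF c] have "length c = Suc (Suc 0)" "wwt [op_ix i, i] c i = 1"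
      "wwt [op_ix i, i] c (op_ix i) = 1"
      by (simp_all add: weights_short fund_simps del: word_crystal.simps)
    then have "c = [Top, Top]"
      unfolding length_2_node
      by (auto simp: weights_short fund_simps simp del: word_crystal.simps)
    then show ?thesis using c by simp
  qed
  have MT: "\<psi> [Mid, Top] = Some [Top, Mid]" using f[OF arr(1)] TT arr by simp
  have TM: "\<psi> [Top, Mid] = Some [Mid, Top]" using f[OF arr(2)] TT arr by simp
  have MM: "\<psi> [Mid, Mid] = Some [Bot, Top]" using f[OF arr(3)] TM arr by simp
  have BT: "\<psi> [Bot, Top] = Some [Mid, Mid]" using f[OF arr(4)] MT arr by simp
  have MB: "\<psi> [Mid, Bot] = Some [Bot, Mid]" using f[OF arr(5)] MM arr by simp
  have BM: "\<psi> [Bot, Mid] = Some [Mid, Bot]" using f[OF arr(6)] BT arr by simp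
  have BB: "\<psi> [Bot, Bot] = Some [Bot, Bot]" using f[OF arr(7)] MB arr by simp
  \<comment> \<open>Top Bot is joined to nothing by an arrow. Its image has weight 0 and is
    annihilated by both \<open>e\<close>, which singles out Top Bot among the three elements of
    weight 0.\<close>
  have TB: "\<psi> [Top, Bot] = Some [Top, Bot]"
  proof -
    obtain c where c: "\<psi> [Top, Bot] = Some c" using total[of "[Top, Bot]"] by auto
    from W[OF c] have "length c = Suc (Suc 0)" "wwt [op_ix i, i] c i = 0"
      "wwt [op_ix i, i] c (op_ix i) = 0"
      by (simp_all add: weights_short fund_simps del: word_crystal.simps)
    moreover have "wke [op_ix i, i] i c = None" "wke [op_ix i, i] (op_ix i) c = None"
      using strict_morphismD(3)[OF S, of "[Top, Bot]" i] strict_morphismD(3)[OF S, of "[Top, Bot]" "op_ix i"] c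
      by (simp_all add: eval_short del: word_crystal.simps)
    ultimately have "c = [Top, Bot]"
      unfolding length_2_node
      by (auto simp: weights_short eval_short simp del: word_crystal.simps)
    then show ?thesis using c by simp
  qed
  show ?thesis
    using assms(2) TT MT TM MM BT MB BM BB TB by (auto simp: length_2_node)
qed

lemma Collect_singletonI: "\<lbrakk>\<And>\<psi>. P \<psi> \<Longrightarrow> f \<psi> = a; P \<chi>\<rbrakk> \<Longrightarrow> {f \<psi> | \<psi>. P \<psi>} = {a}"
  by auto

lemma projection_sym_map:
  assumes "bij_betw (\<lambda>b. the (sym_map s b)) {b. length b = length (sym_dom s) \<and> sym_map s b \<noteq> None}
    {c. length c = length (sym_cod s)}"
  shows "crystal_projection (word_crystal (sym_dom s)) (word_crystal (sym_cod s)) (sym_map s)"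
  using assms strict_sym_map by (simp add: crystal_projection_def)

lemma bij_sym_map:
  "bij_betw (\<lambda>b. the (sym_map (Sym_m i) b)) {b. length b = Suc (Suc 0) \<and> sym_map (Sym_m i) b \<noteq> None} {c. length c = Suc 0}"
  "bij_betw (\<lambda>b. the (sym_map (Sym_c i) b)) {b. length b = Suc (Suc 0) \<and> sym_map (Sym_c i) b \<noteq> None} {c. length c = 0}"
  "bij_betw (\<lambda>b. the (sym_map (Sym_b i) b)) {b. length b = Suc (Suc 0) \<and> sym_map (Sym_b i) b \<noteq> None} {c. length c = Suc (Suc 0)}"
proof -
  have "{b. length b = Suc (Suc 0) \<and> sym_map (Sym_m i) b \<noteq> None} = {[Top, Mid], [Top, Bot], [Mid, Bot]}"
    by auto
  moreover have "{c. length c = Suc 0} = {[Top], [Mid], [Bot]}" by (auto simp: length_1_node)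
  ultimately show "bij_betw (\<lambda>b. the (sym_map (Sym_m i) b))
      {b. length b = Suc (Suc 0) \<and> sym_map (Sym_m i) b \<noteq> None} {c. length c = Suc 0}"
    by (simp add: bij_betw_def)
  have "{b. length b = Suc (Suc 0) \<and> sym_map (Sym_c i) b \<noteq> None} = {[Top, Bot]}" by auto
  then show "bij_betw (\<lambda>b. the (sym_map (Sym_c i) b))
      {b. length b = Suc (Suc 0) \<and> sym_map (Sym_c i) b \<noteq> None} {c. length c = 0}"
    by (simp add: bij_betw_def)
  have "{b. length b = Suc (Suc 0) \<and> sym_map (Sym_b i) b \<noteq> None} = {b. length b = Suc (Suc 0)}"
    unfolding length_2_node by auto
  moreover have "{b. length b = Suc (Suc 0)} = {[Top, Top], [Top, Mid], [Top, Bot], [Mid, Top],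
      [Mid, Mid], [Mid, Bot], [Bot, Top], [Bot, Mid], [Bot, Bot]}"
    unfolding length_2_node by (rule Collect_mem_eq)
  ultimately show "bij_betw (\<lambda>b. the (sym_map (Sym_b i) b))
      {b. length b = Suc (Suc 0) \<and> sym_map (Sym_b i) b \<noteq> None} {c. length c = Suc (Suc 0)}"
    by (auto simp: bij_betw_def)
qed

theorem proposition4p1p1:
  shows "\<exists>(Fo :: ix list \<Rightarrow> ix list) (Fm :: (ix, gen, 'k::field) tm set \<Rightarrow> 'k fund_mor).
    linear_moncat_iso sl3_presented Fund Fo Fm \<and>
    (\<forall>i. Fo [i] = [i]) \<and>
    (\<forall>i. projections [i, i] [op_ix i] = {Fm (sym_class (Sym_m i))}) \<and>
    (\<forall>i. projections [i, op_ix i] [] = {Fm (sym_class (Sym_c i))}) \<and>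
    (\<forall>i. isomorphisms [i, op_ix i] [op_ix i, i] = {Fm (sym_class (Sym_b i))})"
proof (intro exI conjI allI)
  \<comment> \<open>The objects on both sides are words, so the functor can be the identity on
    objects.\<close>
  show "linear_moncat_iso sl3_presented Fund (\<lambda>w. w) (realize :: (ix, gen, 'k) tm set \<Rightarrow> 'k fund_mor)"
    by (rule presented_iso)
  fix i :: ix
  show "[i] = [i]" ..
  show "projections [i, i] [op_ix i] = {realize (sym_class (Sym_m i)) :: 'k fund_mor}"
  proof -
    have eq: "fund_arrow [i, i] [op_ix i] \<psi> = (realize (sym_class (Sym_m i)) :: 'k fund_mor)"
      if "crystal_projection (word_crystal [i, i]) (word_crystal [op_ix i]) \<psi>" for \<psi>
      unfolding realize_sym_arrow sym_dom.simps sym_cod.simps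
      by (rule fund_arrow_cong) (use projection_merge[OF that] in simp)
    have pr: "crystal_projection (word_crystal [i, i]) (word_crystal [op_ix i]) (sym_map (Sym_m i))"
      using projection_sym_map[of "Sym_m i"] bij_sym_map(1)[of i] by (simp del: sym_map.simps word_crystal.simps)
    show ?thesis
      unfolding projections_def
      by (rule Collect_singletonI[where P = "crystal_projection (word_crystal [i, i]) (word_crystal [op_ix i])"
            and f = "fund_arrow [i, i] [op_ix i]", OF eq pr])
  qed
  show "projections [i, op_ix i] [] = {realize (sym_class (Sym_c i)) :: 'k fund_mor}"
  proof -
    have eq: "fund_arrow [i, op_ix i] [] \<psi> = (realize (sym_class (Sym_c i)) :: 'k fund_mor)"
      if "crystal_projection (word_crystal [i, op_ix i]) (word_crystal []) \<psi>" for \<psi>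
      unfolding realize_sym_arrow sym_dom.simps sym_cod.simps
      by (rule fund_arrow_cong) (use projection_cap[OF that] in simp)
    have pr: "crystal_projection (word_crystal [i, op_ix i]) (word_crystal []) (sym_map (Sym_c i))"
      using projection_sym_map[of "Sym_c i"] bij_sym_map(2)[of i] by (simp del: sym_map.simps word_crystal.simps)
    show ?thesis
      unfolding projections_def
      by (rule Collect_singletonI[where P = "crystal_projection (word_crystal [i, op_ix i]) (word_crystal [])"
            and f = "fund_arrow [i, op_ix i] []", OF eq pr])
  qed
  show "isomorphisms [i, op_ix i] [op_ix i, i] = {realize (sym_class (Sym_b i)) :: 'k fund_mor}"
  proof -
    have eq: "fund_arrow [i, op_ix i] [op_ix i, i] \<psi> = (realize (sym_class (Sym_b i)) :: 'k fund_mor)"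
      if "crystal_iso (word_crystal [i, op_ix i]) (word_crystal [op_ix i, i]) \<psi>" for \<psi>
      unfolding realize_sym_arrow sym_dom.simps sym_cod.simps
      by (rule fund_arrow_cong) (use isomorphism_beta[OF that] in simp)
    have pr: "crystal_iso (word_crystal [i, op_ix i]) (word_crystal [op_ix i, i]) (sym_map (Sym_b i))"
      unfolding crystal_iso_def
    proof
      show "crystal_projection (word_crystal [i, op_ix i]) (word_crystal [op_ix i, i]) (sym_map (Sym_b i))"
        using projection_sym_map[of "Sym_b i"] bij_sym_map(3)[of i]
        by (simp del: sym_map.simps word_crystal.simps)
      show "\<forall>b\<in>elts (word_crystal [i, op_ix i]). sym_map (Sym_b i) b \<noteq> None"
        unfolding elts_word by (simp add: length_2_node)
    qed
    show ?thesis
      unfolding isomorphisms_def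
      by (rule Collect_singletonI[where P = "crystal_iso (word_crystal [i, op_ix i]) (word_crystal [op_ix i, i])"
            and f = "fund_arrow [i, op_ix i] [op_ix i, i]", OF eq pr])
  qed
qed

end
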